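(* Let $k\ge2$ and $p<0$ be integers with $\gcd(|p|,k)=1$, and let $$F(z)= z^{p}e^{Az^k}\,\frac{\prod_{\nu=1}^{\omega_1}\left(1+\frac{z^k}{a_\nu}\right)}{\prod_{\mu=1}^{\omega_2}\left(1-\frac{z^k}{b_\mu}\right)},\qquad F(z)\not\equiv z^p,$$ where $0<\omega_1,\omega_2\le+\infty$, $A\ge0$ and $a_\nu,b_\mu>0$ for all $\nu,\mu$. Let $\alpha\in\mathbb{C}\setminus\{0\}$ be such that the $\alpha$-set of $F$ is nonempty, and let $q\in\{0,\dots,k-1\}$ and $\varkappa\in\{0,1\}$ be chosen so that $\alpha\in\widetilde Q_{2q-\varkappa}$. If $\alpha\in Q_{2q-\varkappa}$, then the $\alpha$-point $z_0$ of $F$ closest to the origin is simple and distinct in argument and absolute value from the succeeding $\alpha$-point. Furthermore, $z_0\in Q_{2m-\sigma}$, where $\sigma:=\varkappa$ for even $p$, $\sigma:=1-\varkappa$ for odd $p$, and the integer $m$ satisfies $pm\equiv q-(-1)^\sigma\left\lceil\frac p2\right\rceil\pmod k$. If $\alpha e_{-2q+\varkappa}>0$, where $p$ and $\varkappa$ have the same parity, then the $\alpha$-point $z_0$ of $F$ closest to the origin is simple and distinct in argument and absolute value from the succeeding $\alpha$-point. Moreover, $z_0e_{-2m+1}>0$ for $m$ with $pm\equiv q+\left\lceil\frac{p-1}2\right\rceil\pmod k$. If $\alpha e_{-2q+\varkappa}>0$, where $p$ and $\varkappa$ have distinct parity, then the two zeros of $F(z)-\alpha$ closest to the origin (counting double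 zeros as two) are equal in absolute value or in argument. In the latter case (equal argument, including the case of one double zero), which is possible only when $p=-1$, both zeros belong to the ray $\{z:ze_{-2m}>0\}$. In the former case (two distinct zeros of equal absolute value), one of them belongs to $Q_{2m}$ and the other belongs to $Q_{-2s-2m-1}$. Here $m$ solves $pm\equiv q-\left\lceil\frac{p+1}2\right\rceil\pmod k$ and $s$ is an integer such that $\Im(\alpha e_{ps})=0$.
   Context: $e_m:=\exp\left(i\frac{m}{k}\pi\right)$; for $s\in\mathbb{Z}$, $Q_s:=\{z\ne0:0<\operatorname{Arg}(ze_{-s})<\frac{\pi}{k}\}$ and $\widetilde Q_s:=\{z\ne0:0\le\operatorname{Arg}(ze_{-s})<\frac{\pi}{k}\}$ ($\operatorname{Arg}$ the principal argument); indices are taken modulo $2k$. $\lceil a\rceil$ is the least integer $\ge a$. The products are absolutely convergent. An $\alpha$-point of $F$ is a $z$ with $F(z)=\alpha$ (the $\alpha$-set is the set of all of them), simple if $F'(z)\ne0$. "The succeeding $\alpha$-point" is any $\alpha$-point having the next smallest absolute value (if any). "$x>0$" for a complex expression means it is real and positive. *)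

theory Defs
  imports
    "HOL-Complex_Analysis.Complex_Analysis"
    "HOL-Library.Complex_Order"
    "HOL-Library.Extended_Nat"
    "HOL-Number_Theory.Cong"
begin

(* Positivity of complex expressions is the order of HOL-Library.Complex_Order:
   0 < x says that x is real and positive. *)

definition root_e :: "nat \<Rightarrow> int \<Rightarrow> complex" where
  "root_e k m = exp (\<i> * of_real (of_int m / of_nat k * pi))"

definition open_sector :: "nat \<Rightarrow> int \<Rightarrow> complex set" where
  "open_sector k s =
     {z. z \<noteq> 0 \<and> 0 < Arg (z * root_e k (- s)) \<and> Arg (z * root_e k (- s)) < pi / of_nat k}"

definition half_open_sector :: "nat \<Rightarrow> int \<Rightarrow> complex set" where
  "half_open_sector k s =
     {z. z \<noteq> 0 \<and> 0 \<le> Arg (z * root_e k (- s)) \<and> Arg (z * root_e k (- s)) < pi / of_nat k}"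

(* Products over 1, ..., omega with omega finite or infinite. The factors are numbered from 0,
   and for finite omega the sequence of factors is continued by 1. *)

definition factor :: "enat \<Rightarrow> (nat \<Rightarrow> complex) \<Rightarrow> nat \<Rightarrow> complex" where
  "factor \<omega> f \<nu> = (if enat \<nu> < \<omega> then f \<nu> else 1)"

definition num_factor :: "nat \<Rightarrow> enat \<Rightarrow> (nat \<Rightarrow> real) \<Rightarrow> complex \<Rightarrow> nat \<Rightarrow> complex" where
  "num_factor k \<omega> a z = factor \<omega> (\<lambda>\<nu>. 1 + z ^ k / of_real (a \<nu>))"

definition den_factor :: "nat \<Rightarrow> enat \<Rightarrow> (nat \<Rightarrow> real) \<Rightarrow> complex \<Rightarrow> nat \<Rightarrow> complex" where
  "den_factor k \<omega> b z = factor \<omega> (\<lambda>\<mu>. 1 - z ^ k / of_real (b \<mu>))"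

(* At its poles (0, as p < 0, and the points with z ^ k = b \<mu>) this function has the value 0 by the
   conventions for division by zero; so for \<alpha> \<noteq> 0 no pole is mistaken for an \<alpha>-point. *)

definition mero_fun ::
  "nat \<Rightarrow> int \<Rightarrow> real \<Rightarrow> enat \<Rightarrow> (nat \<Rightarrow> real) \<Rightarrow> enat \<Rightarrow> (nat \<Rightarrow> real) \<Rightarrow> complex \<Rightarrow> complex" where
  "mero_fun k p A \<omega>1 a \<omega>2 b z =
     z powi p * exp (of_real A * z ^ k) *
       (prodinf (num_factor k \<omega>1 a z) / prodinf (den_factor k \<omega>2 b z))"

definition mero_domain :: "nat \<Rightarrow> enat \<Rightarrow> (nat \<Rightarrow> real) \<Rightarrow> complex set" where
  "mero_domain k \<omega>2 b = {z. z \<noteq> 0 \<and> (\<forall>\<mu>. enat \<mu> < \<omega>2 \<longrightarrow> z ^ k \<noteq> of_real (b \<mu>))}"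

definition alpha_set :: "(complex \<Rightarrow> complex) \<Rightarrow> complex \<Rightarrow> complex set" where
  "alpha_set F \<alpha> = {z. F z = \<alpha>}"

definition simple_point :: "(complex \<Rightarrow> complex) \<Rightarrow> complex \<Rightarrow> bool" where
  "simple_point F z \<longleftrightarrow> deriv F z \<noteq> 0"

definition closest_alpha_point :: "(complex \<Rightarrow> complex) \<Rightarrow> complex \<Rightarrow> complex \<Rightarrow> bool" where
  "closest_alpha_point F \<alpha> z \<longleftrightarrow>
     z \<in> alpha_set F \<alpha> \<and> (\<forall>w \<in> alpha_set F \<alpha>. norm z \<le> norm w)"

(* "Succeeding" is minimality among all the other \<alpha>-points and does not presuppose a strictly
   larger absolute value; otherwise the assertion that the absolute values differ would be void. *)

definition succeeding_alpha_point ::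
  "(complex \<Rightarrow> complex) \<Rightarrow> complex \<Rightarrow> complex \<Rightarrow> complex \<Rightarrow> bool" where
  "succeeding_alpha_point F \<alpha> z w \<longleftrightarrow>
     w \<in> alpha_set F \<alpha> - {z} \<and> (\<forall>u \<in> alpha_set F \<alpha> - {z}. norm w \<le> norm u)"

definition alpha_mult :: "(complex \<Rightarrow> complex) \<Rightarrow> complex \<Rightarrow> complex \<Rightarrow> nat" where
  "alpha_mult F \<alpha> z =
     (if z \<in> alpha_set F \<alpha> then nat (zorder (\<lambda>w. F w - \<alpha>) z) else 0)"

(* The first two elements z1, z2 of the multiset of zeros of F - \<alpha>, ordered by absolute value:
   {#z1, z2#} is contained in it, and all that remains is at least as far from 0 as z1 and z2. *)

definition closest_pair :: "(complex \<Rightarrow> complex) \<Rightarrow> complex \<Rightarrow> complex \<Rightarrow> complex \<Rightarrow> bool" where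
  "closest_pair F \<alpha> z1 z2 \<longleftrightarrow>
     (\<forall>w. count {#z1, z2#} w \<le> alpha_mult F \<alpha> w) \<and>
     norm z1 \<le> norm z2 \<and>
     (\<forall>w. count {#z1, z2#} w < alpha_mult F \<alpha> w \<longrightarrow> norm z2 \<le> norm w)"

end

theory Submission
  imports Defs
begin

text \<open>
  In the coordinate \<open>s = k * log z\<close> the sector \<open>0 \<le> Arg z \<le> pi / k\<close> becomes the strip
  \<open>0 \<le> Im s \<le> pi\<close>, inside which the derivative of \<open>log F\<close> has positive imaginary part. Hence
  \<open>|F|\<close> decreases on every arc \<open>|z| = r\<close> of the sector, so that \<open>|F| = |\<alpha>|\<close> holds at most once on
  each arc, and along the curve of these points, ordered by \<open>r\<close>, the argument of \<open>F\<close> increases. Continued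
  suitably over the missing radii it becomes a continuous function of \<open>r\<close>; as \<open>p < 0\<close>, it starts
  with the value \<open>p * pi / k\<close>. By the symmetries \<open>F (cnj z) = cnj (F z)\<close> and
  \<open>F (z * e_{2m}) = e_{2pm} * F z\<close>, the \<open>\<alpha>\<close>-points correspond to the points of this curve at which the
  argument of \<open>F\<close> is \<open>Arg \<alpha>\<close> or \<open>- Arg \<alpha>\<close> modulo \<open>2 * pi / k\<close>. The one closest to the origin
  comes from the first such value, which lies between \<open>p * pi / k\<close> and \<open>(p + 1) * pi / k\<close>. Only for
  \<open>p = -1\<close> can the decisive value \<open>(p + 1) * pi / k = 0\<close> be taken on the positive ray, where \<open>log F\<close> is
  strictly convex as a function of \<open>log r\<close> up to the first pole.
\<close>

section \<open>Products with negative zeros and their logarithms on a strip\<close>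

text \<open>The positivity has one source: \<open>c * w / (1 + c * w)\<close> and
  \<open>d * w / (1 - d * w)\<close> with positive \<open>c\<close>, \<open>d\<close> map the upper
  half-plane into itself. It is exploited for difference quotients between two points rather than
  along a curve, so the level set of \<open>|F|\<close> has to be neither parametrized nor shown to
  be smooth or connected. Only two points on one boundary ray, where all zeros and poles lie, are
  compared otherwise: by counting zeros or poles between them. The continuation over missing radii
  must avoid zeros and poles. An arc with \<open>|F| < |\<alpha>|\<close> carries no pole, so there
  it follows the ray of the poles; an arc with \<open>|F| > |\<alpha>|\<close> carries no zero, so
  there it follows the ray of the zeros. On both rays the argument is constant modulo
  \<open>pi\<close>, so nothing changes on the way. In units of \<open>pi / k\<close>, with
  \<open>b\<close> for the argument of \<open>\<alpha>\<close>, the values sought are congruent to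
  \<open>b\<close> or \<open>- b\<close> modulo 2. Exactly one lies in \<open>[p, p + 1]\<close>:
  inside, at \<open>p\<close> or at \<open>p + 1\<close>, which are the three cases of the theorem.
  At the ends both signs apply. At \<open>p\<close> the point is on a ray and both signs give the
  same \<open>\<alpha>\<close>-point; at \<open>p + 1\<close> it is usually interior and they give
  two of equal modulus.\<close>

definition gprod :: "(nat \<Rightarrow> real) \<Rightarrow> complex \<Rightarrow> complex" where
  "gprod c w = (\<Prod>\<nu>. 1 + of_real (c \<nu>) * w)"

definition logprod :: "(nat \<Rightarrow> real) \<Rightarrow> complex \<Rightarrow> complex" where
  "logprod c s = (\<Sum>\<nu>. Ln (1 + of_real (c \<nu>) * exp s))"

definition cstrip :: "complex set" where
  "cstrip = {s. 0 \<le> Im s \<and> Im s \<le> pi}"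

text \<open>For points of the closed strip this says exactly that the open segment between them
  stays inside the strip. The excluded segments lie in one boundary line, where the argument of
  \<open>F\<close> is locally constant and no strict inequality can hold.\<close>

definition transversal :: "complex \<Rightarrow> complex \<Rightarrow> bool" where
  "transversal u v \<longleftrightarrow> u \<noteq> v \<and> \<not> (Im u = Im v \<and> Im u \<in> {0, pi})"

lemma Im_exp_cstrip: "s \<in> cstrip \<Longrightarrow> 0 \<le> Im (exp s)"
  by (auto simp: cstrip_def Im_exp intro!: mult_nonneg_nonneg sin_ge_zero)

lemma transversal_between:
  assumes "u \<in> cstrip" "v \<in> cstrip" "transversal u v" "0 < t" "t < 1"
  shows "0 < Im (u + of_real t * (v - u))" "Im (u + of_real t * (v - u)) < pi"
proof -
  have I: "Im (u + of_real t * (v - u)) = (1 - t) * Im u + t * Im v"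
    by (simp add: algebra_simps)
  have b: "0 \<le> Im u" "0 \<le> Im v" "Im u \<le> pi" "Im v \<le> pi"
    using assms by (auto simp: cstrip_def)
  consider "Im u > 0" | "Im v > 0" using assms b by (fastforce simp: transversal_def)
  then show "0 < Im (u + of_real t * (v - u))"
    unfolding I using b assms(4,5) 
    by cases (simp_all add: add_pos_nonneg add_nonneg_pos)
  consider "Im u < pi" | "Im v < pi" using assms b by (fastforce simp: transversal_def)
  then have "0 < (1 - t) * (pi - Im u) + t * (pi - Im v)"
    using b assms(4,5) by cases (simp_all add: add_pos_nonneg add_nonneg_pos)
  then show "Im (u + of_real t * (v - u)) < pi"
    unfolding I by (simp add: algebra_simps)
qed

text \<open>Along the segment \<open>g / (v - u)\<close> has derivative \<open>g'\<close> with
  respect to the parameter, so its imaginary part increases strictly. At the end points, which may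
  lie on the boundary lines, continuity suffices.\<close>

lemma Im_quotient_pos:
  assumes cont: "continuous_on (closed_segment u v) g"
    and der: "\<And>s. 0 < Im s \<Longrightarrow> Im s < pi \<Longrightarrow> (g has_field_derivative g' s) (at s)"
    and pos: "\<And>s. 0 < Im s \<Longrightarrow> Im s < pi \<Longrightarrow> 0 < Im (g' s)"
    and uv: "u \<in> cstrip" "v \<in> cstrip" "transversal u v"
  shows "0 < Im ((g v - g u) / (v - u))"
proof -
  let ?l = "\<lambda>t::real. u + of_real t * (v - u)"
  have ne: "v - u \<noteq> 0" using uv by (auto simp: transversal_def)
  define f where "f = (\<lambda>t. Im (g (?l t) / (v - u)))"
  have lin: "?l t \<in> closed_segment u v" if "t \<in> {0..1}" for t
    using that by (auto simp: closed_segment_def scaleR_conv_of_real algebra_simps)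
  have "continuous_on {0..1} (g \<circ> ?l)"
  proof (rule continuous_on_compose)
    show "continuous_on (?l ` {0..1}) g"
      using lin by (intro continuous_on_subset[OF cont]) blast
  qed (intro continuous_intros)
  then have cf: "continuous_on {0..1} f"
    unfolding f_def comp_def using ne by (intro continuous_intros) auto
  have df: "(f has_real_derivative Im (g' (?l t))) (at t)" if "0 < t" "t < 1" for t
  proof -
    have "(g has_field_derivative g' (?l t)) (at (?l t))"
      by (intro der transversal_between uv that)
    then have "((g \<circ> ?l) has_vector_derivative (v - u) * g' (?l t)) (at t)"
      by (rule field_vector_diff_chain_at[rotated]) (auto intro!: derivative_eq_intros)
    then have "((\<lambda>t. g (?l t) / (v - u)) has_vector_derivative ((v - u) * g' (?l t)) / (v - u)) (at t)"
      unfolding comp_def by (rule has_vector_derivative_divide)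
    then show ?thesis
      unfolding f_def using ne
      by (auto simp: has_real_derivative_iff_has_vector_derivative intro: bounded_linear.has_vector_derivative[OF bounded_linear_Im])
  qed
  have "f 0 < f 1"
  proof (rule DERIV_pos_imp_increasing_open[OF zero_less_one])
    show "\<exists>y. DERIV f t :> y \<and> 0 < y" if "0 < t" "t < 1" for t
      using df[OF that] pos transversal_between[OF uv that] by blast
  qed (rule cf)
  then show ?thesis by (simp add: f_def diff_divide_distrib)
qed

text \<open>On its cut \<open>Ln\<close> takes the value with imaginary part \<open>pi\<close>,
  which is the limit from above. A quarter turn moves the cut to the negative imaginary axis, out of
  the way.\<close>

lemma continuous_within_Ln_upper:
  assumes "z \<noteq> 0"
  shows "continuous (at z within {w. 0 \<le> Im w}) Ln"
proof (cases "z \<in> \<real>\<^sub>\<le>\<^sub>0")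
  case False
  then show ?thesis by (rule continuous_at_imp_continuous_within[OF continuous_at_Ln])
next
  case True
  \<comment> \<open>On the closed upper half-plane \<open>Im (Ln w)\<close> lies between 0 and
    \<open>pi\<close>, so subtracting \<open>pi / 2\<close> stays in the principal range.\<close>
  have eq: "Ln w = Ln (w * (-\<i>)) + \<i> * (pi / 2)" if "w \<noteq> 0" "0 \<le> Im w" for w
  proof -
    have "0 \<le> Im (Ln w)" "Im (Ln w) \<le> pi" using Im_Ln_pos_le that by blast+
    then show ?thesis
      using that pi_gt_zero by (subst Ln_times) (auto simp: Ln_minus_ii simp del: pi_gt_zero)
  qed
  show ?thesis
  proof (rule continuous_transform_within[where \<delta> = "norm z" and f = "\<lambda>w. Ln (w * (-\<i>)) + \<i> * (pi / 2)"])
    show "continuous (at z within {w. 0 \<le> Im w}) (\<lambda>w. Ln (w * (-\<i>)) + \<i> * (pi / 2))"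
    proof (rule continuous_add[OF continuous_at_imp_continuous_within[OF isCont_Ln'] continuous_const])
      show "z * (-\<i>) \<notin> \<real>\<^sub>\<le>\<^sub>0"
        using True assms by (auto simp: complex_nonpos_Reals_iff complex_eq_iff)
    qed (intro continuous_intros)
    show "Ln (w * (-\<i>)) + \<i> * (pi / 2) = Ln w" if "w \<in> {w. 0 \<le> Im w}" "dist w z < norm z" for w
      using that by (intro eq[symmetric]) (auto simp: dist_norm)
    show "z \<in> {w. 0 \<le> Im w}" using True by (auto simp: complex_nonpos_Reals_iff)
  qed (use assms in auto)
qed

lemma continuous_on_Ln_upper [continuous_intros]:
  assumes "continuous_on S f" "\<And>x. x \<in> S \<Longrightarrow> f x \<noteq> 0" "\<And>x. x \<in> S \<Longrightarrow> 0 \<le> Im (f x)"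
  shows "continuous_on S (\<lambda>x. Ln (f x))"
proof -
  have "continuous_on {w. w \<noteq> 0 \<and> 0 \<le> Im w} Ln"
    unfolding continuous_on_eq_continuous_within
    using continuous_within_Ln_upper by (auto intro: continuous_within_subset)
  then show ?thesis
    by (rule continuous_on_compose2[OF _ assms(1)]) (use assms(2,3) in auto)
qed

text \<open>The sign up to the zero is what the applications need: it tells on which boundary line
  the continued level curve stays until the first crossing.\<close>

lemma first_zero:
  fixes f :: "real \<Rightarrow> real"
  assumes "a \<le> b" "continuous_on {a..b} f" "0 < f a" "f b \<le> 0"
  obtains x where "a < x" "x \<le> b" "f x = 0" "\<And>t. a \<le> t \<Longrightarrow> t \<le> x \<Longrightarrow> 0 \<le> f t"
proof -
  define X where "X = {x \<in> {a..b}. f x \<le> 0}"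
  have "closed ({a..b} \<inter> f -` {..0})"
    by (intro continuous_closed_preimage assms) auto
  also have "{a..b} \<inter> f -` {..0} = X" by (auto simp: X_def)
  finally have "closed X" .
  moreover have bb: "bdd_below X" by (auto simp: X_def)
  moreover have "X \<noteq> {}" using assms by (auto simp: X_def)
  ultimately have "Inf X \<in> X" using closed_contains_Inf by blast
  then obtain x where x: "x = Inf X" "a \<le> x" "x \<le> b" "f x \<le> 0" by (auto simp: X_def)
  have pos: "0 < f t" if "a \<le> t" "t < x" for t
    using that x cInf_lower[OF _ bb, of t] by (force simp: X_def)
  have "a < x" using x assms by (cases "a = x") auto
  have "\<exists>t\<ge>a. t \<le> x \<and> f t = 0"
    using x assms by (intro IVT2') (auto intro: continuous_on_subset)
  then have "f x = 0" using pos by (metis less_irrefl order_le_less)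
  then show thesis using that[of x] x pos \<open>a < x\<close> by (metis less_imp_le order_le_less)
qed

text \<open>Meant for the argument of \<open>F\<close> on a boundary line: there \<open>F\<close> is
  real up to a constant factor, so its argument is fixed modulo \<open>pi\<close> and, being
  continuous, cannot move.\<close>

lemma constant_if_pi_discrete:
  fixes f :: "real \<Rightarrow> real"
  assumes "continuous_on {a..b} f" "\<And>x. x \<in> {a..b} \<Longrightarrow> \<exists>N::nat. f x = r + of_nat N * pi"
    and "x \<in> {a..b}" "y \<in> {a..b}"
  shows "f x = f y"
proof -
  have "f constant_on {a..b}"
  proof (rule continuous_discrete_range_constant)
    fix x assume "x \<in> {a..b}"
    then obtain N :: nat where N: "f x = r + of_nat N * pi" using assms(2) by blast
    have "pi \<le> norm (f y - f x)" if y: "y \<in> {a..b}" "f y \<noteq> f x" for y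
    proof -
      obtain M :: nat where M: "f y = r + of_nat M * pi" using assms(2) y by blast
      have "f y - f x = of_int (int M - int N) * pi" unfolding M N by (simp add: algebra_simps)
      moreover have "int M - int N \<noteq> 0" using y M N by auto
      then have "1 \<le> \<bar>real_of_int (int M - int N)\<bar>" by linarith
      ultimately show ?thesis by (simp add: abs_mult)
    qed
    then show "\<exists>e>0. \<forall>y. y \<in> {a..b} \<and> f y \<noteq> f x \<longrightarrow> e \<le> norm (f y - f x)"
      by (intro exI[of _ pi]) auto
  qed (use assms in auto)
  then show ?thesis using assms(3,4) by (auto simp: constant_on_def)
qed

lemma mult_exp_less_1_mono: "0 \<le> (a::real) \<Longrightarrow> x \<le> x' \<Longrightarrow> a * exp x' < 1 \<Longrightarrow> a * exp x < 1"
  by (meson exp_le_cancel_iff le_less_trans mult_left_mono)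

text \<open>In the application \<open>c \<nu>\<close> is the reciprocal of \<open>a \<nu>\<close> or
  \<open>b \<nu>\<close>, continued by 0. Finite and infinite products, in the numerator and (at
  \<open>- w\<close>) in the denominator, thus become values of the same kind of entire
  function.\<close>

locale nonneg_summable =
  fixes c :: "nat \<Rightarrow> real"
  assumes nonneg: "\<And>\<nu>. 0 \<le> c \<nu>" and summable_c: "summable c"
begin

lemma le_suminf: "c \<nu> \<le> suminf c"
proof -
  have "sum c {\<nu>} \<le> suminf c" using summable_c nonneg by (intro sum_le_suminf) auto
  then show ?thesis by simp
qed

lemma summable_norm_mult: "summable (\<lambda>\<nu>. norm (of_real (c \<nu>) * (w::complex)))"
  using summable_mult2[OF summable_c, of "norm w"] nonneg by (simp add: norm_mult)

lemma abs_convergent_gprod: "abs_convergent_prod (\<lambda>\<nu>. 1 + of_real (c \<nu>) * (w::complex))"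
  by (rule summable_imp_abs_convergent_prod) (use summable_norm_mult[of w] in simp)

lemma convergent_gprod: "convergent_prod (\<lambda>\<nu>. 1 + of_real (c \<nu>) * (w::complex))"
  using abs_convergent_gprod by (rule abs_convergent_prod_imp_convergent_prod)

lemma has_prod_gprod: "(\<lambda>\<nu>. 1 + of_real (c \<nu>) * w) has_prod gprod c w"
  using convergent_gprod unfolding gprod_def by (rule convergent_prod_has_prod)

lemma gprod_eq_0_iff: "gprod c w = 0 \<longleftrightarrow> (\<exists>\<nu>. 1 + of_real (c \<nu>) * w = 0)"
  using has_prod_eq_0_iff[OF has_prod_gprod, of w] by (simp add: image_iff eq_commute[of 0])

lemma gprod_cnj: "gprod c (cnj w) = cnj (gprod c w)"
proof (cases "gprod c w = 0")
  case True
  then obtain \<nu> where "1 + of_real (c \<nu>) * w = 0" unfolding gprod_eq_0_iff by auto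
  then have "cnj (1 + of_real (c \<nu>) * w) = 0" by (subst complex_cnj_zero_iff)
  then have "1 + of_real (c \<nu>) * cnj w = 0" by simp
  then have "gprod c (cnj w) = 0" unfolding gprod_eq_0_iff by blast
  with True show ?thesis by simp
next
  case False
  have "(\<lambda>n. \<Prod>\<nu>\<le>n. 1 + of_real (c \<nu>) * w) \<longlonglongrightarrow> gprod c w"
    using convergent_prod_LIMSEQ[OF convergent_gprod] unfolding gprod_def .
  then have "(\<lambda>n. cnj (\<Prod>\<nu>\<le>n. 1 + of_real (c \<nu>) * w)) \<longlonglongrightarrow> cnj (gprod c w)"
    by (rule tendsto_cnj)
  moreover have "(\<lambda>n. \<Prod>\<nu>\<le>n. 1 + of_real (c \<nu>) * cnj w) \<longlonglongrightarrow> gprod c (cnj w)"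
    using convergent_prod_LIMSEQ[OF convergent_gprod] unfolding gprod_def .
  ultimately show ?thesis
    by (auto simp: cnj_prod intro: LIMSEQ_unique)
qed

lemma uniform_limit_gprod:
  "uniform_limit (cball 0 R) (\<lambda>N w. \<Prod>\<nu><N. 1 + of_real (c \<nu>) * w) (gprod c) sequentially"
proof -
  have "uniformly_convergent_on (cball 0 R) (\<lambda>N w. \<Prod>\<nu><N. 1 + of_real (c \<nu>) * (w::complex))"
  proof (rule uniformly_convergent_on_prod)
    show "uniformly_convergent_on (cball 0 R) (\<lambda>N w. \<Sum>n<N. norm (of_real (c n) * (w::complex)))"
    proof (rule Weierstrass_m_test')
      show "norm (norm (of_real (c n) * w)) \<le> c n * R" if "w \<in> cball 0 R" for n and w :: complex
        using that nonneg by (auto simp: norm_mult intro!: mult_left_mono)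
    qed (use summable_c in \<open>rule summable_mult2\<close>)
  qed (auto intro!: continuous_intros)
  then obtain g where g: "uniform_limit (cball 0 R) (\<lambda>N w. \<Prod>\<nu><N. 1 + of_real (c \<nu>) * (w::complex)) g sequentially"
    unfolding uniformly_convergent_on_def by blast
  also have "?this \<longleftrightarrow> ?thesis"
  proof (intro uniform_limit_cong)
    fix w :: complex assume "w \<in> cball 0 R"
    \<comment> \<open>The index is shifted because the limit defining the infinite product runs over
      \<open>{..n}\<close>.\<close>
    with g have "(\<lambda>n. \<Prod>\<nu><Suc n. 1 + of_real (c \<nu>) * w) \<longlonglongrightarrow> g w"
      using \<open>w \<in> cball 0 R\<close> by (intro LIMSEQ_Suc[OF tendsto_uniform_limitI])
    moreover have "(\<lambda>n. \<Prod>\<nu><Suc n. 1 + of_real (c \<nu>) * w) \<longlonglongrightarrow> gprod c w"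
      using convergent_prod_LIMSEQ[OF convergent_gprod[of w]] unfolding lessThan_Suc_atMost gprod_def .
    ultimately show "g w = gprod c w" using LIMSEQ_unique by blast
  qed auto
  finally show ?thesis .
qed

lemma holomorphic_gprod: "gprod c holomorphic_on UNIV"
proof (rule holomorphic_uniform_sequence)
  fix w :: complex
  have "uniform_limit (cball w 1) (\<lambda>N w. \<Prod>\<nu><N. 1 + of_real (c \<nu>) * w) (gprod c) sequentially"
    by (rule uniform_limit_on_subset[OF uniform_limit_gprod[of "norm w + 1"]])
       (simp add: cball_subset_cball_iff)
  then show "\<exists>d>0. cball w d \<subseteq> UNIV \<and>
      uniform_limit (cball w d) (\<lambda>N w. \<Prod>\<nu><N. 1 + of_real (c \<nu>) * w) (gprod c) sequentially"
    by (intro exI[of _ 1]) auto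
qed (auto intro!: holomorphic_intros)

lemma continuous_gprod [continuous_intros]:
  "continuous_on S f \<Longrightarrow> continuous_on S (\<lambda>x. gprod c (f x))"
  using holomorphic_on_imp_continuous_on[OF holomorphic_gprod]
  by (rule continuous_on_compose2) auto

lemma logderiv_gprod:
  assumes "gprod c w \<noteq> 0"
  shows "(\<lambda>\<nu>. of_real (c \<nu>) / (1 + of_real (c \<nu>) * w)) sums (deriv (gprod c) w / gprod c w)"
proof -
  have "(\<lambda>\<nu>. deriv (\<lambda>w. 1 + of_real (c \<nu>) * w) w / (1 + of_real (c \<nu>) * w)) sums
      (deriv (gprod c) w / gprod c w)"
  proof (rule logderiv_prodinf_complex_uniform_limit[where A = "ball 0 (norm w + 1)"])
    show "uniform_limit (ball 0 (norm w + 1)) (\<lambda>N w. \<Prod>\<nu><N. 1 + of_real (c \<nu>) * w) (gprod c) sequentially"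
      by (rule uniform_limit_on_subset[OF uniform_limit_gprod[of "norm w + 1"]]) auto
  qed (use assms in \<open>auto intro!: holomorphic_intros\<close>)
  moreover have "deriv (\<lambda>w. 1 + of_real (c \<nu>) * w) w = of_real (c \<nu>)" for \<nu>
    by (rule DERIV_imp_deriv) (auto intro!: derivative_eq_intros)
  ultimately show ?thesis by simp
qed

section \<open>The logarithm of a product on the closed strip\<close>

lemma eventually_small: "\<forall>\<^sub>F n in sequentially. c n * R < 1 / 2"
proof -
  have "(\<lambda>n. c n * R) \<longlonglongrightarrow> 0 * R" by (intro tendsto_intros summable_LIMSEQ_zero summable_c)
  then show ?thesis by (auto dest: order_tendstoD(2)[where a = "1/2"])
qed

text \<open>The estimate of \<open>Ln (1 + x)\<close> by twice \<open>norm x\<close> requires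
  \<open>norm x < 1 / 2\<close>. This holds for all but finitely many factors, uniformly on the
  disc, because \<open>c\<close> tends to 0.\<close>

lemma eventually_Ln_bound:
  "\<forall>\<^sub>F n in sequentially. \<forall>w\<in>cball 0 R. norm (Ln (1 + of_real (c n) * w)) \<le> 2 * (c n * R)"
  using eventually_small[of R]
proof eventually_elim
  case (elim n)
  show ?case
  proof
    fix w :: complex assume "w \<in> cball 0 R"
    then have *: "norm (of_real (c n) * w) \<le> c n * R"
      using nonneg by (auto simp: norm_mult intro!: mult_left_mono)
    then have "norm (Ln (1 + of_real (c n) * w)) \<le> 2 * norm (of_real (c n) * w)"
      using elim by (intro norm_Ln_le) auto
    with * show "norm (Ln (1 + of_real (c n) * w)) \<le> 2 * (c n * R)" by linarith
  qed
qed

lemma summable_Ln: "summable (\<lambda>\<nu>. Ln (1 + of_real (c \<nu>) * w))"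
proof (rule summable_comparison_test_ev)
  show "\<forall>\<^sub>F n in sequentially. norm (Ln (1 + of_real (c n) * w)) \<le> 2 * (c n * norm w)"
    using eventually_Ln_bound[of "norm w"] by eventually_elim auto
qed (intro summable_mult summable_mult2 summable_c)

lemma logprod_sums: "(\<lambda>\<nu>. Ln (1 + of_real (c \<nu>) * exp s)) sums logprod c s"
  unfolding logprod_def by (intro summable_sums summable_Ln)

lemma exp_logprod:
  assumes "gprod c (exp s) \<noteq> 0"
  shows "exp (logprod c s) = gprod c (exp s)"
proof -
  have "exp (logprod c s) = (\<Prod>\<nu>. exp (Ln (1 + of_real (c \<nu>) * exp s)))"
    unfolding logprod_def by (rule prodinf_exp[symmetric]) (rule summable_Ln)
  also have "\<dots> = gprod c (exp s)"
    unfolding gprod_def using assms by (intro prodinf_cong exp_Ln) (auto simp: gprod_eq_0_iff)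
  finally show ?thesis .
qed

lemma factor_Im: "s \<in> cstrip \<Longrightarrow> 0 \<le> Im (1 + of_real (c \<nu>) * exp s)"
  using nonneg Im_exp_cstrip by simp

text \<open>For \<open>s\<close> in the closed strip every factor stays in the closed upper
  half-plane, where \<open>Ln\<close> is continuous off 0. The majorant
  \<open>2 * (c n * exp X)\<close> is available only for \<open>Re s < X\<close>, so the series
  converges uniformly on left half-strips; continuity being local, these suffice.\<close>

lemma continuous_logprod:
  assumes "S \<subseteq> cstrip" "\<And>s. s \<in> S \<Longrightarrow> gprod c (exp s) \<noteq> 0"
  shows "continuous_on S (logprod c)"
proof -
  have loc: "continuous_on (S \<inter> {s. Re s < X}) (logprod c)" for X
  proof (rule uniform_limit_theorem)
    show "uniform_limit (S \<inter> {s. Re s < X})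
        (\<lambda>N s. \<Sum>\<nu><N. Ln (1 + of_real (c \<nu>) * exp s)) (logprod c) sequentially"
      unfolding logprod_def
    proof (rule Weierstrass_m_test_ev)
      show "\<forall>\<^sub>F n in sequentially. \<forall>s\<in>S \<inter> {s. Re s < X}.
          norm (Ln (1 + of_real (c n) * exp s)) \<le> 2 * (c n * exp X)"
        using eventually_Ln_bound[of "exp X"] by eventually_elim auto
    qed (intro summable_mult summable_mult2 summable_c)
    show "\<forall>\<^sub>F N in sequentially. continuous_on (S \<inter> {s. Re s < X})
        (\<lambda>s. \<Sum>\<nu><N. Ln (1 + of_real (c \<nu>) * exp s))"
    proof (rule always_eventually, rule allI)
      fix N
      have "1 + of_real (c \<nu>) * exp s \<noteq> 0" if "s \<in> S" for s \<nu>
        using assms(2)[OF that] by (auto simp: gprod_eq_0_iff)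
      then show "continuous_on (S \<inter> {s. Re s < X}) (\<lambda>s. \<Sum>\<nu><N. Ln (1 + of_real (c \<nu>) * exp s))"
        using assms(1) factor_Im by (intro continuous_intros) auto
    qed
  qed auto
  have "continuous (at s within S) (logprod c)" if "s \<in> S" for s
  proof -
    have "continuous (at s within (S \<inter> {u. Re u < Re s + 1})) (logprod c)"
      using loc[of "Re s + 1"] that by (auto simp: continuous_on_eq_continuous_within)
    moreover have "at s within (S \<inter> {u. Re u < Re s + 1}) = at s within S"
      by (rule at_within_nhd[where S = "{u. Re u < Re s + 1}"])
         (auto intro!: open_halfspace_Re_lt)
    ultimately show ?thesis by simp
  qed
  then show ?thesis by (simp add: continuous_on_eq_continuous_within)
qed

lemma Im_logprod_sums: "(\<lambda>\<nu>. Im (Ln (1 + of_real (c \<nu>) * exp s))) sums Im (logprod c s)"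
  using logprod_sums[of s] by (simp add: sums_complex_iff)

lemma factor_nz: "gprod c (exp s) \<noteq> 0 \<Longrightarrow> 1 + of_real (c \<nu>) * exp s \<noteq> 0"
  by (auto simp: gprod_eq_0_iff)

lemma Im_logprod_nonneg:
  assumes "s \<in> cstrip" "gprod c (exp s) \<noteq> 0"
  shows "0 \<le> Im (logprod c s)"
proof (rule sums_le[OF _ sums_zero Im_logprod_sums])
  show "0 \<le> Im (Ln (1 + of_real (c \<nu>) * exp s))" for \<nu>
    using Im_Ln_pos_le[OF factor_nz[OF assms(2)]] factor_Im[OF assms(1)] by blast
qed

lemma gprod_nz_real: "Im s = 0 \<Longrightarrow> gprod c (exp s) \<noteq> 0"
proof
  assume "Im s = 0" "gprod c (exp s) = 0"
  then obtain \<nu> where \<nu>: "1 + of_real (c \<nu>) * exp s = 0" by (auto simp: gprod_eq_0_iff)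
  have "1 + c \<nu> * exp (Re s) = Re (1 + of_real (c \<nu>) * exp s)"
    using \<open>Im s = 0\<close> by (simp add: Re_exp)
  also have "\<dots> = 0" by (simp only: \<nu> zero_complex.simps)
  moreover have "0 \<le> c \<nu> * exp (Re s)" using nonneg by simp
  ultimately show False by linarith
qed

lemma Im_logprod_real: "Im s = 0 \<Longrightarrow> Im (logprod c s) = 0"
proof -
  assume s: "Im s = 0"
  have "Im (Ln (1 + of_real (c \<nu>) * exp s)) = 0" for \<nu>
  proof -
    have "1 + of_real (c \<nu>) * exp s = of_real (1 + c \<nu> * exp (Re s))"
      using s by (simp add: complex_eq_iff Re_exp Im_exp)
    moreover have "0 < 1 + c \<nu> * exp (Re s)" using nonneg by (simp add: add_pos_nonneg)
    ultimately show ?thesis by (metis Im_complex_of_real Ln_of_real)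
  qed
  then have "(\<lambda>\<nu>::nat. 0) sums Im (logprod c s)" using Im_logprod_sums[of s] by simp
  then show ?thesis by (rule sums_unique2[OF _ sums_zero])
qed

lemma factor_real_line:
  assumes "Im s = pi"
  shows "1 + of_real (c \<nu>) * exp s = of_real (1 - c \<nu> * exp (Re s))"
  using assms by (simp add: complex_eq_iff Re_exp Im_exp)

lemma Im_Ln_factor_top:
  assumes "Im s = pi" "gprod c (exp s) \<noteq> 0"
  shows "Im (Ln (1 + of_real (c \<nu>) * exp s)) = (if c \<nu> * exp (Re s) < 1 then 0 else pi)"
proof -
  have "1 - c \<nu> * exp (Re s) \<noteq> 0"
    using factor_nz[OF assms(2), of \<nu>] unfolding factor_real_line[OF assms(1)] by (metis of_real_0)
  then show ?thesis
    unfolding factor_real_line[OF assms(1)]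
    by (auto simp: Im_Ln_eq_0 Im_Ln_eq_pi simp del: of_real_diff of_real_mult)
qed

text \<open>The multiple is the number of zeros of the product already passed on the line
  \<open>Im s = pi\<close>. It is finite because \<open>c\<close> tends to 0.\<close>

lemma Im_logprod_pi:
  assumes "Im s = pi" "gprod c (exp s) \<noteq> 0"
  shows "\<exists>N::nat. Im (logprod c s) = of_nat N * pi"
proof -
  let ?A = "{\<nu>. \<not> c \<nu> * exp (Re s) < 1}"
  have "\<forall>\<^sub>F \<nu> in sequentially. c \<nu> * exp (Re s) < 1"
    using eventually_small[of "exp (Re s)"] by eventually_elim auto
  then have fin: "finite ?A"
    by (simp add: eventually_cofinite cofinite_eq_sequentially[symmetric])
  have "(\<lambda>\<nu>. if \<nu> \<in> ?A then pi else 0) sums (\<Sum>\<nu>\<in>?A. pi)"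
    by (rule sums_If_finite_set[OF fin])
  moreover have "(\<lambda>\<nu>. if \<nu> \<in> ?A then pi else 0) = (\<lambda>\<nu>. Im (Ln (1 + of_real (c \<nu>) * exp s)))"
    using Im_Ln_factor_top[OF assms] by auto
  ultimately have "Im (logprod c s) = (\<Sum>\<nu>\<in>?A. pi)"
    using Im_logprod_sums[of s] sums_unique2 by metis
  then show ?thesis by (intro exI[of _ "card ?A"]) simp
qed

lemma Im_logprod_pi_eq_0:
  assumes "Im s = pi" "gprod c (exp s) \<noteq> 0"
  shows "Im (logprod c s) = 0 \<longleftrightarrow> (\<forall>\<nu>. c \<nu> * exp (Re s) < 1)"
proof
  assume "Im (logprod c s) = 0"
  then have z: "(\<lambda>\<nu>. if c \<nu> * exp (Re s) < 1 then 0 else pi) sums 0"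
    using Im_logprod_sums[of s] unfolding Im_Ln_factor_top[OF assms] by simp
  then have "(\<Sum>\<nu>. if c \<nu> * exp (Re s) < 1 then 0 else pi) = 0" "summable (\<lambda>\<nu>. if c \<nu> * exp (Re s) < 1 then 0 else pi)"
    by (auto simp: sums_iff)
  then have "\<forall>\<nu>. (if c \<nu> * exp (Re s) < 1 then 0 else pi) = 0"
    by (subst suminf_eq_zero_iff[symmetric]) auto
  then show "\<forall>\<nu>. c \<nu> * exp (Re s) < 1" by (metis pi_neq_zero)
next
  assume "\<forall>\<nu>. c \<nu> * exp (Re s) < 1"
  then show "Im (logprod c s) = 0"
    using Im_logprod_sums[of s] sums_unique2[OF _ sums_zero] unfolding Im_Ln_factor_top[OF assms] by simp
qed

lemma Im_logprod_pi_mono: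
  assumes "Im u = pi" "gprod c (exp u) \<noteq> 0" "Im v = pi" "gprod c (exp v) \<noteq> 0" "Re u \<le> Re v"
  shows "Im (logprod c u) \<le> Im (logprod c v)"
proof (rule sums_le[OF _ Im_logprod_sums Im_logprod_sums])
  fix \<nu>
  have "c \<nu> * exp (Re u) \<le> c \<nu> * exp (Re v)" using nonneg assms by (simp add: mult_left_mono)
  then show "Im (Ln (1 + of_real (c \<nu>) * exp u)) \<le> Im (Ln (1 + of_real (c \<nu>) * exp v))"
    using Im_Ln_factor_top[OF assms(1,2), of \<nu>] Im_Ln_factor_top[OF assms(3,4), of \<nu>] by auto
qed

text \<open>The logarithm of a factor has the derivative
  \<open>1 - 1 / (1 + c \<nu> * exp s)\<close>. Inside the strip the factor lies in the upper
  half-plane, which \<open>w \<mapsto> - 1 / w\<close> maps into itself.\<close>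

lemma Im_quotient_factor:
  assumes uv: "u \<in> cstrip" "v \<in> cstrip" "transversal u v"
    and nz: "gprod c (exp u) \<noteq> 0" "gprod c (exp v) \<noteq> 0" and pos: "0 < c \<nu>"
  shows "0 < Im ((Ln (1 + of_real (c \<nu>) * exp v) - Ln (1 + of_real (c \<nu>) * exp u)) / (v - u))"
proof (rule Im_quotient_pos[where g' = "\<lambda>s. of_real (c \<nu>) * exp s / (1 + of_real (c \<nu>) * exp s)"])
  have inner: "0 < Im (1 + of_real (c \<nu>) * exp s)" if "0 < Im s" "Im s < pi" for s
    using that pos by (simp add: Im_exp sin_gt_zero)
  show "continuous_on (closed_segment u v) (\<lambda>s. Ln (1 + of_real (c \<nu>) * exp s))"
  proof (rule continuous_on_Ln_upper)
    fix s assume "s \<in> closed_segment u v"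
    then obtain t where t: "s = u + of_real t * (v - u)" "0 \<le> t" "t \<le> 1"
      by (auto simp: closed_segment_def scaleR_conv_of_real algebra_simps)
    consider "t = 0" | "t = 1" | "0 < t" "t < 1" using t by linarith
    then have "1 + of_real (c \<nu>) * exp s \<noteq> 0 \<and> 0 \<le> Im (1 + of_real (c \<nu>) * exp s)"
    proof cases
      case 3
      then have "0 < Im (1 + of_real (c \<nu>) * exp s)"
        unfolding t(1) by (intro inner transversal_between uv)
      then show ?thesis by (metis less_imp_le less_irrefl zero_complex.simps(2))
    qed (use t uv nz factor_nz factor_Im in auto)
    then show "1 + of_real (c \<nu>) * exp s \<noteq> 0" "0 \<le> Im (1 + of_real (c \<nu>) * exp s)" by auto
  qed (intro continuous_intros)
  fix s assume s: "0 < Im s" "Im s < pi"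
  from inner[OF s] have "1 + of_real (c \<nu>) * exp s \<notin> \<real>\<^sub>\<le>\<^sub>0" by (auto simp: complex_nonpos_Reals_iff)
  then show "((\<lambda>s. Ln (1 + of_real (c \<nu>) * exp s)) has_field_derivative
      of_real (c \<nu>) * exp s / (1 + of_real (c \<nu>) * exp s)) (at s)"
    by (auto intro!: derivative_eq_intros simp: divide_inverse mult_ac)
  have nz: "1 + of_real (c \<nu>) * exp s \<noteq> 0" using inner[OF s] by (metis less_irrefl zero_complex.simps(2))
  have "of_real (c \<nu>) * exp s / (1 + of_real (c \<nu>) * exp s) = 1 - 1 / (1 + of_real (c \<nu>) * exp s)"
    using nz by (simp add: field_simps)
  also have "Im \<dots> = Im (1 + of_real (c \<nu>) * exp s) / (norm (1 + of_real (c \<nu>) * exp s))\<^sup>2"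
    by (simp add: Im_divide cmod_def)
  also have "\<dots> > 0" using inner[OF s] nz by simp
  finally show "0 < Im (of_real (c \<nu>) * exp s / (1 + of_real (c \<nu>) * exp s))" .
qed (use uv in auto)

text \<open>The inequality for single factors is summed; all terms are nonnegative, so one positive
  term makes the sum positive.\<close>

lemma Im_quotient_logprod:
  assumes uv: "u \<in> cstrip" "v \<in> cstrip" "transversal u v"
    and nz: "gprod c (exp u) \<noteq> 0" "gprod c (exp v) \<noteq> 0"
  shows "0 \<le> Im ((logprod c v - logprod c u) / (v - u))"
    and "0 < c 0 \<Longrightarrow> 0 < Im ((logprod c v - logprod c u) / (v - u))"
proof -
  let ?f = "\<lambda>\<nu>. Im ((Ln (1 + of_real (c \<nu>) * exp v) - Ln (1 + of_real (c \<nu>) * exp u)) / (v - u))"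
  have s: "?f sums Im ((logprod c v - logprod c u) / (v - u))"
    by (intro sums_Im sums_divide sums_diff logprod_sums)
  have nn: "0 \<le> ?f \<nu>" for \<nu>
    using Im_quotient_factor[OF assms, of \<nu>] nonneg[of \<nu>] by (cases "c \<nu> = 0") auto
  show "0 \<le> Im ((logprod c v - logprod c u) / (v - u))"
    by (rule sums_le[OF nn sums_zero s])
  assume "0 < c 0"
  then have "0 < ?f 0" by (rule Im_quotient_factor[OF assms])
  moreover have "sum ?f {0} \<le> suminf ?f"
    using s nn by (intro sum_le_suminf) (auto simp: sums_iff)
  ultimately show "0 < Im ((logprod c v - logprod c u) / (v - u))"
    using s by (simp add: sums_iff)
qed

end

section \<open>The logarithm of the function on the strip\<close>

text \<open>Reflection in the middle line \<open>Im s = pi / 2\<close>. As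
  \<open>1 - d \<nu> * exp s\<close> is the conjugate of
  \<open>1 + d \<nu> * exp (refl_strip s)\<close>, it reduces the denominator to products with plus
  signs.\<close>

definition refl_strip :: "complex \<Rightarrow> complex" where
  "refl_strip s = cnj s + \<i> * of_real pi"

lemma refl_strip [simp]:
  "Re (refl_strip s) = Re s" "Im (refl_strip s) = pi - Im s"
  "refl_strip s \<in> cstrip \<longleftrightarrow> s \<in> cstrip"
  by (auto simp: refl_strip_def cstrip_def)

lemma exp_refl_strip [simp]: "exp (refl_strip s) = - cnj (exp s)"
  by (simp add: refl_strip_def exp_add exp_cnj)

lemma transversal_refl_strip: "transversal (refl_strip u) (refl_strip v) \<longleftrightarrow> transversal u v"
  by (auto simp: transversal_def complex_eq_iff)

lemma continuous_on_refl_strip [continuous_intros]: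
  "continuous_on S f \<Longrightarrow> continuous_on S (\<lambda>x. refl_strip (f x))"
  unfolding refl_strip_def by (intro continuous_intros)

text \<open>\<open>c0\<close> and \<open>d0\<close> express that both products have at least one
  factor. The former makes the inequality for \<open>phi\<close> strict and supplies a zero on the
  line \<open>Im s = pi\<close>; the latter supplies a pole on the positive ray.\<close>

locale pf_quotient =
  fixes k :: nat and p :: int and A :: real and c d :: "nat \<Rightarrow> real"
  assumes k2: "2 \<le> k" and p_neg: "p < 0" and cop: "coprime p (int k)" and A_nonneg: "0 \<le> A"
    and c: "nonneg_summable c" and d: "nonneg_summable d"
    and c0: "0 < c 0" and d0: "0 < d 0"
begin

sublocale C: nonneg_summable c by (rule c)
sublocale D: nonneg_summable d by (rule d)

definition F :: "complex \<Rightarrow> complex" where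
  "F z = z powi p * exp (of_real A * z ^ k) * (gprod c (z ^ k) / gprod d (- (z ^ k)))"

definition good :: "complex set" where
  "good = {s \<in> cstrip. gprod c (exp s) \<noteq> 0 \<and> gprod d (- exp s) \<noteq> 0}"

text \<open>\<open>phi s\<close> is a branch of \<open>log F\<close> at \<open>exp (s / k)\<close>. The reflection makes the logarithm of
  the denominator continuous up to both boundary lines: on \<open>Im s = 0\<close> the factor \<open>1 - d \<nu> * exp s\<close>
  must be approached from the lower half-plane, where \<open>Ln\<close> jumps.\<close>

definition phi :: "complex \<Rightarrow> complex" where
  "phi s = of_real (of_int p / of_nat k) * s + of_real A * exp s + logprod c s
     - cnj (logprod d (refl_strip s))"

abbreviation "pik \<equiv> of_int p * pi / of_nat k"

lemma kpos: "0 < real k" "0 < k" using k2 by auto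

lemma gprod_d_refl: "gprod d (exp (refl_strip s)) = cnj (gprod d (- exp s))"
  using D.gprod_cnj[of "- exp s"] by simp

lemma exp_phi:
  assumes "s \<in> good"
  shows "exp (phi s) = F (exp (s / of_nat k))"
proof -
  have nz: "gprod c (exp s) \<noteq> 0" "gprod d (- exp s) \<noteq> 0" using assms by (auto simp: good_def)
  have "gprod d (exp (refl_strip s)) \<noteq> 0" unfolding gprod_d_refl using nz by simp
  then have "exp (logprod d (refl_strip s)) = cnj (gprod d (- exp s))"
    using D.exp_logprod gprod_d_refl by metis
  then have 1: "exp (cnj (logprod d (refl_strip s))) = gprod d (- exp s)"
    by (metis exp_cnj complex_cnj_cnj)
  have 2: "exp (logprod c s) = gprod c (exp s)" by (rule C.exp_logprod[OF nz(1)])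
  have 3: "exp (s / of_nat k) ^ k = exp s" using kpos by (simp add: exp_divide_power_eq)
  have 4: "exp (s / of_nat k) powi p = exp (of_real (of_int p / of_nat k) * s)"
    by (simp add: exp_power_int)
  show ?thesis
    unfolding phi_def F_def exp_diff exp_add 1 2 3 4 by simp
qed

lemma F_exp_bad:
  assumes "s \<in> cstrip" "s \<notin> good"
  shows "F (exp (s / of_nat k)) = 0"
proof -
  have 3: "exp (s / of_nat k) ^ k = exp s" using kpos by (simp add: exp_divide_power_eq)
  show ?thesis unfolding F_def 3 using assms by (auto simp: good_def)
qed

lemma good_cstrip: "s \<in> good \<Longrightarrow> s \<in> cstrip" by (simp add: good_def)

lemma continuous_phi: "continuous_on good phi"
proof -
  have "continuous_on good (logprod c)"
    by (rule C.continuous_logprod) (auto simp: good_def)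
  moreover have "continuous_on (refl_strip ` good) (logprod d)"
  proof (rule D.continuous_logprod)
    show "gprod d (exp s) \<noteq> 0" if "s \<in> refl_strip ` good" for s
    proof -
      from that obtain t where t: "s = refl_strip t" "gprod d (- exp t) \<noteq> 0" by (auto simp: good_def)
      show ?thesis unfolding t(1) gprod_d_refl using t(2) by simp
    qed
  qed (auto simp: good_def)
  then have "continuous_on good (\<lambda>s. logprod d (refl_strip s))"
    by (rule continuous_on_compose2) (auto intro!: continuous_intros)
  ultimately show ?thesis
    unfolding phi_def by (intro continuous_intros)
qed

lemma Im_quotient_exp:
  assumes "u \<in> cstrip" "v \<in> cstrip" "transversal u v"
  shows "0 < Im ((exp v - exp u) / (v - u))"
  using assms
  by (intro Im_quotient_pos[where g' = exp])
     (auto intro!: continuous_intros derivative_eq_intros simp: Im_exp sin_gt_zero)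

text \<open>All monotonicity and injectivity properties of \<open>phi\<close> on the closed strip are instances of this
  inequality, for vertical segments and for segments joining points with equal \<open>|F|\<close>.\<close>

lemma phi_quotient:
  assumes "u \<in> good" "v \<in> good" "transversal u v"
  shows "0 < Im ((phi v - phi u) / (v - u))"
proof -
  have ne: "v - u \<noteq> 0" using assms by (auto simp: transversal_def)
  let ?r = refl_strip
  have nzd: "gprod d (exp (?r s)) \<noteq> 0" if "s \<in> good" for s
    unfolding gprod_d_refl using that by (simp add: good_def)
  have q: "(phi v - phi u) / (v - u) = of_real (of_int p / of_nat k)
      + of_real A * ((exp v - exp u) / (v - u)) + (logprod c v - logprod c u) / (v - u)
      - cnj ((logprod d (?r v) - logprod d (?r u)) / (?r v - ?r u))"
  proof -
    have "?r v - ?r u = cnj (v - u)" by (simp add: refl_strip_def)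
    then have "cnj ((logprod d (?r v) - logprod d (?r u)) / (?r v - ?r u)) =
        (cnj (logprod d (?r v)) - cnj (logprod d (?r u))) / (v - u)" by simp
    moreover have "phi v - phi u = of_real (of_int p / of_nat k) * (v - u) + of_real A * (exp v - exp u)
        + (logprod c v - logprod c u) - (cnj (logprod d (?r v)) - cnj (logprod d (?r u)))"
      by (simp add: phi_def algebra_simps del: of_real_divide)
    ultimately show ?thesis using ne
      by (simp only: add_divide_distrib diff_divide_distrib[of "_ + _"] divide_self[OF ne] mult_1_right
          times_divide_eq_right[symmetric])
  qed
  have I: "Im (of_real r + of_real A * X + Y - cnj Z) = A * Im X + Im Y + Im Z" for r X Y Z
    by simp
  have "0 \<le> A * Im ((exp v - exp u) / (v - u))"
    using Im_quotient_exp[of u v] assms A_nonneg by (auto simp: good_def)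
  moreover have "0 < Im ((logprod c v - logprod c u) / (v - u))"
    using assms c0 by (intro C.Im_quotient_logprod) (auto simp: good_def)
  moreover have "0 \<le> Im ((logprod d (?r v) - logprod d (?r u)) / (?r v - ?r u))"
    using assms nzd by (intro D.Im_quotient_logprod) (auto simp: good_def transversal_refl_strip)
  ultimately show ?thesis unfolding q I by linarith
qed

lemma Re_phi_decreasing:
  assumes "u \<in> good" "v \<in> good" "Re u = Re v" "Im u < Im v"
  shows "Re (phi v) < Re (phi u)"
proof -
  have vu: "v - u = \<i> * of_real (Im v - Im u)" using assms by (simp add: complex_eq_iff)
  have "0 < Im ((phi v - phi u) / (v - u))"
    using assms by (intro phi_quotient) (auto simp: transversal_def)
  also have "(phi v - phi u) / (v - u) = (- \<i> * (phi v - phi u)) / of_real (Im v - Im u)"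
    unfolding vu using assms(4) by (simp add: field_simps)
  also have "Im \<dots> = (Re (phi u) - Re (phi v)) / (Im v - Im u)"
    by (simp only: Im_divide_of_real) simp
  finally show ?thesis using assms(4) by (simp add: zero_less_divide_iff)
qed

text \<open>Here \<open>phi v - phi u\<close> is purely imaginary, so the imaginary part of the
  quotient has the sign of \<open>Im (phi v - phi u) * Re (v - u)\<close>.\<close>

lemma Im_phi_increasing_on_level:
  assumes "u \<in> good" "v \<in> good" "Re (phi u) = Re (phi v)" "Re u < Re v" "transversal u v"
  shows "Im (phi u) < Im (phi v)"
proof -
  let ?D = "Im (phi v) - Im (phi u)"
  have "phi v - phi u = \<i> * of_real ?D" using assms by (simp add: complex_eq_iff)
  then have "0 < Im (\<i> * of_real ?D / (v - u))" using phi_quotient[OF assms(1,2,5)] by simp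
  also have "Im (\<i> * of_real ?D / (v - u)) = ?D * ((Re v - Re u) / (norm (v - u))\<^sup>2)"
    by (simp add: Im_divide cmod_def)
  finally have "0 < ?D * ((Re v - Re u) / (norm (v - u))\<^sup>2)" .
  moreover have "0 \<le> (Re v - Re u) / (norm (v - u))\<^sup>2" using assms(4) by simp
  ultimately have "0 < ?D" using mult_nonpos_nonneg by (metis not_less)
  then show ?thesis by simp
qed

section \<open>Bounds for the argument and its values on the boundary lines\<close>

lemma Im_phi_eq:
  "Im (phi s) = of_int p / of_nat k * Im s + A * Im (exp s) + Im (logprod c s)
     + Im (logprod d (refl_strip s))"
  by (simp add: phi_def)

lemma nz_refl: "s \<in> good \<Longrightarrow> gprod d (exp (refl_strip s)) \<noteq> 0"
  unfolding gprod_d_refl by (simp add: good_def)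

text \<open>On the strip every summand of \<open>phi\<close> except the linear one has nonnegative
  imaginary part. The first bound is kept because it locates the equality case of the second: as
  \<open>p < 0\<close>, equality forces \<open>Im s = pi\<close>.\<close>

lemma Im_phi_ge:
  assumes "s \<in> good"
  shows "of_int p / of_nat k * Im s \<le> Im (phi s)" "pik \<le> Im (phi s)"
proof -
  show 1: "of_int p / of_nat k * Im s \<le> Im (phi s)"
  proof -
    have "0 \<le> A * Im (exp s)" using A_nonneg Im_exp_cstrip assms by (simp add: good_def)
    moreover have "0 \<le> Im (logprod c s)"
      using assms by (intro C.Im_logprod_nonneg) (auto simp: good_def)
    moreover have "0 \<le> Im (logprod d (refl_strip s))"
      using assms nz_refl by (intro D.Im_logprod_nonneg) (auto simp: good_def)
    ultimately show ?thesis unfolding Im_phi_eq by linarith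
  qed
  have "of_int p * pi \<le> of_int p * Im s"
    using assms p_neg by (intro mult_left_mono_neg) (auto simp: good_def cstrip_def)
  then have "pik \<le> of_int p / of_nat k * Im s" using kpos by (simp add: divide_right_mono)
  with 1 show "pik \<le> Im (phi s)" by linarith
qed

lemma Im_phi_bottom_eq:
  assumes "s \<in> good" "Im s = 0"
  shows "Im (phi s) = Im (logprod d (refl_strip s))"
  unfolding Im_phi_eq using assms C.Im_logprod_real by (simp add: Im_exp)

lemma Im_phi_top_eq:
  assumes "s \<in> good" "Im s = pi"
  shows "Im (phi s) = pik + Im (logprod c s)"
  unfolding Im_phi_eq using assms D.Im_logprod_real by (simp add: Im_exp)

lemma Im_phi_bottom:
  assumes "s \<in> good" "Im s = 0"
  obtains N :: nat where "Im (phi s) = of_nat N * pi"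
  using D.Im_logprod_pi[OF _ nz_refl[OF assms(1)]] assms Im_phi_bottom_eq by auto

lemma Im_phi_top:
  assumes "s \<in> good" "Im s = pi"
  obtains N :: nat where "Im (phi s) = pik + of_nat N * pi"
  using C.Im_logprod_pi[of s] assms Im_phi_top_eq by (auto simp: good_def)

lemma Im_phi_bottom_0:
  assumes "s \<in> good" "Im s = 0"
  shows "Im (phi s) = 0 \<longleftrightarrow> (\<forall>\<nu>. d \<nu> * exp (Re s) < 1)"
  using D.Im_logprod_pi_eq_0[OF _ nz_refl[OF assms(1)]] assms Im_phi_bottom_eq by simp

lemma Im_phi_top_0:
  assumes "s \<in> good" "Im s = pi"
  shows "Im (phi s) = pik \<longleftrightarrow> (\<forall>\<nu>. c \<nu> * exp (Re s) < 1)"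
  using C.Im_logprod_pi_eq_0[of s] assms Im_phi_top_eq by (simp add: good_def)

text \<open>If the pair is not transversal, both points lie on one boundary line. There the argument
  counts the zeros or poles passed, so it cannot decrease, but it may stay constant.\<close>

lemma Im_phi_mono_on_level:
  assumes "u \<in> good" "v \<in> good" "Re (phi u) = Re (phi v)" "Re u < Re v"
  shows "Im (phi u) \<le> Im (phi v)"
proof (cases "transversal u v")
  case True
  then show ?thesis using Im_phi_increasing_on_level assms by fastforce
next
  case False
  then consider "Im u = 0" "Im v = 0" | "Im u = pi" "Im v = pi"
    using assms by (auto simp: transversal_def)
  then show ?thesis
  proof cases
    case 1
    then show ?thesis
      using assms nz_refl by (auto simp: Im_phi_bottom_eq intro!: D.Im_logprod_pi_mono)
  next
    case 2
    then show ?thesis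
      using assms by (auto simp: Im_phi_top_eq good_def intro!: C.Im_logprod_pi_mono)
  qed
qed

lemma level_point_unique:
  assumes "u \<in> good" "v \<in> good" "Re (phi u) = Re (phi v)" "Re u = Re v"
  shows "u = v"
  using Re_phi_decreasing[of u v] Re_phi_decreasing[of v u] assms
  by (metis complex_eq_iff less_irrefl linorder_neqE_linordered_idom)

text \<open>A vanishing factor makes \<open>exp s\<close> a negative real number, so the zeros of
  the numerator lie on \<open>Im s = pi\<close>. Likewise those of the denominator lie on
  \<open>Im s = 0\<close>.\<close>

lemma gprod_c_nz: "s \<in> cstrip \<Longrightarrow> Im s < pi \<Longrightarrow> gprod c (exp s) \<noteq> 0"
proof
  assume s: "s \<in> cstrip" "Im s < pi" "gprod c (exp s) = 0"
  then obtain \<nu> where \<nu>: "1 + of_real (c \<nu>) * exp s = 0" by (auto simp: C.gprod_eq_0_iff)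
  then have "c \<nu> \<noteq> 0" by auto
  moreover from \<nu> have "Im (1 + of_real (c \<nu>) * exp s) = 0" by (simp only: zero_complex.simps)
  ultimately have "Im (exp s) = 0" by simp
  then have "sin (Im s) = 0" by (simp add: Im_exp)
  then have "Im s = 0" using s sin_gt_zero[of "Im s"] by (force simp: cstrip_def)
  then show False using C.gprod_nz_real s by blast
qed

lemma gprod_d_nz: "s \<in> cstrip \<Longrightarrow> 0 < Im s \<Longrightarrow> gprod d (- exp s) \<noteq> 0"
proof
  assume s: "s \<in> cstrip" "0 < Im s" "gprod d (- exp s) = 0"
  then obtain \<nu> where \<nu>: "1 + of_real (d \<nu>) * (- exp s) = 0" by (auto simp: D.gprod_eq_0_iff)
  then have "d \<nu> \<noteq> 0" by auto
  moreover from \<nu> have "Im (1 + of_real (d \<nu>) * (- exp s)) = 0" by (simp only: zero_complex.simps)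
  ultimately have "Im (exp s) = 0" by simp
  then have "sin (Im s) = 0" by (simp add: Im_exp)
  then have "Im s = pi" using s sin_gt_zero[of "Im s"] by (force simp: cstrip_def)
  then have "gprod d (- exp s) \<noteq> 0"
    using D.gprod_nz_real[of "refl_strip s"] unfolding gprod_d_refl by simp
  then show False using s by blast
qed

lemma good_interior: "0 < Im s \<Longrightarrow> Im s < pi \<Longrightarrow> s \<in> good"
  using gprod_c_nz gprod_d_nz by (auto simp: good_def cstrip_def)

section \<open>Level curves of the modulus\<close>

text \<open>The sign of \<open>|F| - \<rho>\<close>, multiplied by the denominator so that it is continuous at the poles too.\<close>

definition excess :: "real \<Rightarrow> complex \<Rightarrow> real" where
  "excess \<rho> s = norm (exp (of_real (of_int p / of_nat k) * s + of_real A * exp s)) * norm (gprod c (exp s))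
     - \<rho> * norm (gprod d (- exp s))"

lemma continuous_excess [continuous_intros]:
  "continuous_on S f \<Longrightarrow> continuous_on S (\<lambda>x. excess \<rho> (f x))"
  unfolding excess_def by (intro continuous_intros)

lemma excess_good:
  assumes "s \<in> good"
  shows "excess \<rho> s = norm (gprod d (- exp s)) * (exp (Re (phi s)) - \<rho>)"
proof -
  have nz: "gprod d (- exp s) \<noteq> 0" "gprod c (exp s) \<noteq> 0" using assms by (auto simp: good_def)
  have "exp (logprod d (refl_strip s)) = gprod d (exp (refl_strip s))"
    by (rule D.exp_logprod[OF nz_refl[OF assms]])
  then have "norm (exp (logprod d (refl_strip s))) = norm (gprod d (- exp s))"
    unfolding gprod_d_refl by (simp del: norm_exp_eq_Re)
  then have 1: "exp (Re (logprod d (refl_strip s))) = norm (gprod d (- exp s))" by simp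
  have 2: "exp (Re (logprod c s)) = norm (gprod c (exp s))"
    using C.exp_logprod[OF nz(2)] norm_exp_eq_Re by metis
  show ?thesis
    unfolding excess_def phi_def using nz by (simp add: exp_diff exp_add norm_mult 1 2 field_simps)
qed

lemma excess_sgn:
  assumes "s \<in> good" "0 < \<rho>"
  shows "excess \<rho> s = 0 \<longleftrightarrow> Re (phi s) = ln \<rho>" "excess \<rho> s < 0 \<longleftrightarrow> Re (phi s) < ln \<rho>"
    "0 < excess \<rho> s \<longleftrightarrow> ln \<rho> < Re (phi s)"
proof -
  have nz: "0 < norm (gprod d (- exp s))" using assms by (auto simp: good_def)
  have e: "exp (ln \<rho>) = \<rho>" using assms by simp
  have "exp (Re (phi s)) = \<rho> \<longleftrightarrow> Re (phi s) = ln \<rho>" by (metis e exp_inj_iff)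
  then show "excess \<rho> s = 0 \<longleftrightarrow> Re (phi s) = ln \<rho>" unfolding excess_good[OF assms(1)] using nz by simp
  have "exp (Re (phi s)) < \<rho> \<longleftrightarrow> Re (phi s) < ln \<rho>" by (metis e exp_less_cancel_iff)
  then show "excess \<rho> s < 0 \<longleftrightarrow> Re (phi s) < ln \<rho>"
    unfolding excess_good[OF assms(1)] using nz by (auto simp: mult_less_0_iff)
  have "\<rho> < exp (Re (phi s)) \<longleftrightarrow> ln \<rho> < Re (phi s)" by (metis e exp_less_cancel_iff)
  then show "0 < excess \<rho> s \<longleftrightarrow> ln \<rho> < Re (phi s)"
    unfolding excess_good[OF assms(1)] using nz by (auto simp: zero_less_mult_iff)
qed

text \<open>This extends the decrease of \<open>|F|\<close> on arcs to those ending in zeros or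
  poles: the excess is positive at a pole and negative at a zero, so neither can spoil the order of
  signs.\<close>

lemma excess_crossing:
  assumes "s \<in> cstrip" "t \<in> cstrip" "Re s = Re t" "Im s < Im t" "excess \<rho> s \<le> 0" "0 < \<rho>"
  shows "excess \<rho> t < 0"
proof -
  have c_nz: "gprod c (exp s) \<noteq> 0" using assms by (intro gprod_c_nz) (auto simp: cstrip_def)
  have d_nz: "gprod d (- exp t) \<noteq> 0" using assms by (intro gprod_d_nz) (auto simp: cstrip_def)
  have "gprod d (- exp s) \<noteq> 0"
  proof
    assume "gprod d (- exp s) = 0"
    then have "0 < excess \<rho> s" unfolding excess_def using c_nz by simp
    then show False using assms by simp
  qed
  then have s: "s \<in> good" using c_nz assms by (simp add: good_def)
  show ?thesis
  proof (cases "gprod c (exp t) = 0")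
    case True
    then show ?thesis unfolding excess_def using d_nz assms by simp
  next
    case False
    then have t: "t \<in> good" using d_nz assms by (simp add: good_def)
    show ?thesis
      using Re_phi_decreasing[OF s t] excess_sgn[OF s assms(6)] excess_sgn[OF t assms(6)] assms by force
  qed
qed

text \<open>For each \<open>x\<close> the set where \<open>|F| = \<rho>\<close> meets the segment \<open>Re s = x\<close> in at most one point.
  Its height is continued by \<open>0\<close> if \<open>|F| < \<rho>\<close> on the whole segment, and by \<open>pi\<close> if \<open>|F| > \<rho>\<close>.\<close>

lemma level_height_exists:
  assumes "0 < \<rho>"
  shows "\<exists>y. 0 \<le> y \<and> y \<le> pi \<and> (\<forall>t. 0 \<le> t \<and> t < y \<longrightarrow> 0 < excess \<rho> (Complex x t)) \<and>
     (\<forall>t. y < t \<and> t \<le> pi \<longrightarrow> excess \<rho> (Complex x t) < 0)"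
proof -
  let ?h = "\<lambda>t. excess \<rho> (Complex x t)"
  have cross: "?h t < 0" if "0 \<le> y" "y < t" "t \<le> pi" "?h y \<le> 0" for y t
    using that assms by (intro excess_crossing[of "Complex x y"]) (auto simp: cstrip_def)
  have cont: "continuous_on S ?h" for S unfolding Complex_eq by (intro continuous_intros)
  consider "?h 0 \<le> 0" | "0 \<le> ?h pi" | "0 < ?h 0" "?h pi < 0" by linarith
  then show ?thesis
  proof cases
    case 1
    then show ?thesis using cross by (intro exI[of _ 0]) auto
  next
    case 2
    then have "0 < ?h t" if "0 \<le> t" "t < pi" for t using cross[of t pi] that by fastforce
    then show ?thesis by (intro exI[of _ pi]) auto
  next
    case 3
    then obtain y where y: "0 \<le> y" "y \<le> pi" "?h y = 0"
      using IVT2'[of ?h pi 0 0] cont by force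
    have "0 < ?h t" if "0 \<le> t" "t < y" for t using cross[of t y] that y by fastforce
    then show ?thesis using y cross[of y] by (intro exI[of _ y]) auto
  qed
qed

text \<open>The two sign conditions exclude a second height, so the choice is unique.\<close>

definition level_height :: "real \<Rightarrow> real \<Rightarrow> real" where
  "level_height \<rho> x = (SOME y. 0 \<le> y \<and> y \<le> pi \<and> (\<forall>t. 0 \<le> t \<and> t < y \<longrightarrow> 0 < excess \<rho> (Complex x t)) \<and>
     (\<forall>t. y < t \<and> t \<le> pi \<longrightarrow> excess \<rho> (Complex x t) < 0))"

context
  fixes \<rho> :: real
  assumes \<rho>: "0 < \<rho>"
begin

abbreviation "hgt \<equiv> level_height \<rho>"

definition lev :: "real \<Rightarrow> complex" where "lev x = Complex x (hgt x)"

lemma level_height: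
  "0 \<le> hgt x" "hgt x \<le> pi" "0 \<le> t \<Longrightarrow> t < hgt x \<Longrightarrow> 0 < excess \<rho> (Complex x t)"
  "hgt x < t \<Longrightarrow> t \<le> pi \<Longrightarrow> excess \<rho> (Complex x t) < 0"
  using someI_ex[OF level_height_exists[OF \<rho>, of x]] unfolding level_height_def[symmetric] by auto

lemma continuous_excess_line: "continuous_on S (\<lambda>t. excess \<rho> (Complex x t))"
  "continuous_on S (\<lambda>x. excess \<rho> (Complex x t))"
  unfolding Complex_eq by (intro continuous_intros)+

lemma excess_lev_nonneg: "0 < hgt x \<Longrightarrow> 0 \<le> excess \<rho> (lev x)"
proof (rule ccontr)
  assume a: "0 < hgt x" "\<not> 0 \<le> excess \<rho> (lev x)"
  have "isCont (\<lambda>t. excess \<rho> (Complex x t)) (hgt x)"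
    using continuous_excess_line(1)[of UNIV] by (simp add: continuous_on_eq_continuous_at)
  then have "\<forall>\<^sub>F t in at_left (hgt x). excess \<rho> (Complex x t) < 0"
    using a by (intro order_tendstoD) (auto simp: isCont_def lev_def intro: tendsto_within_subset)
  moreover have "\<forall>\<^sub>F t in at_left (hgt x). 0 < t \<and> t < hgt x"
    using a(1) by (auto intro!: eventually_conj eventually_at_left_real simp: eventually_at_left_field)
  ultimately have "\<forall>\<^sub>F t in at_left (hgt x). False"
    by eventually_elim (metis less_imp_le less_asym level_height(3))
  then show False by simp
qed

lemma excess_lev_nonpos: "hgt x < pi \<Longrightarrow> excess \<rho> (lev x) \<le> 0"
proof (rule ccontr)
  assume a: "hgt x < pi" "\<not> excess \<rho> (lev x) \<le> 0"
  have "isCont (\<lambda>t. excess \<rho> (Complex x t)) (hgt x)"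
    using continuous_excess_line(1)[of UNIV] by (simp add: continuous_on_eq_continuous_at)
  then have "\<forall>\<^sub>F t in at_right (hgt x). 0 < excess \<rho> (Complex x t)"
    using a by (intro order_tendstoD) (auto simp: isCont_def lev_def intro: tendsto_within_subset)
  moreover have "\<forall>\<^sub>F t in at_right (hgt x). hgt x < t \<and> t < pi"
    using a(1) by (auto simp: eventually_at_right_field)
  ultimately have "\<forall>\<^sub>F t in at_right (hgt x). False"
    by eventually_elim (use level_height(4)[of x] in fastforce)
  then show False by simp
qed

text \<open>Halfway between a bound \<open>a\<close> and the height at \<open>x\<close> the excess
  has a strict sign. This sign persists for neighbouring abscissae and keeps their heights on the
  same side of \<open>a\<close>.\<close>

lemma continuous_hgt: "continuous_on UNIV hgt"
proof -
  have "isCont hgt x" for x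
    unfolding isCont_def
  proof (rule order_tendstoI)
    fix a assume a: "a < hgt x"
    show "\<forall>\<^sub>F x' in at x. a < hgt x'"
    proof (cases "a < 0")
      case True
      then show ?thesis using level_height(1) by (intro always_eventually) (auto intro: less_le_trans)
    next
      case False
      let ?t = "(a + hgt x) / 2"
      have t: "0 \<le> ?t" "a < ?t" "?t < hgt x" "?t \<le> pi" using a False level_height(2)[of x] by auto
      have "isCont (\<lambda>x. excess \<rho> (Complex x ?t)) x"
        using continuous_excess_line(2)[of UNIV] by (simp add: continuous_on_eq_continuous_at)
      then have "\<forall>\<^sub>F x' in at x. 0 < excess \<rho> (Complex x' ?t)"
        using level_height(3)[OF t(1,3)] by (intro order_tendstoD) (auto simp: isCont_def)
      then show ?thesis
      proof eventually_elim
        case (elim x')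
        then show ?case using level_height(4)[of x' ?t] t by fastforce
      qed
    qed
  next
    fix a assume a: "hgt x < a"
    show "\<forall>\<^sub>F x' in at x. hgt x' < a"
    proof (cases "pi < a")
      case True
      then show ?thesis using level_height(2) by (intro always_eventually) (auto intro: le_less_trans)
    next
      case False
      let ?t = "(a + hgt x) / 2"
      have t: "0 \<le> ?t" "?t < a" "hgt x < ?t" "?t \<le> pi" using a False level_height(1)[of x] by auto
      have "isCont (\<lambda>x. excess \<rho> (Complex x ?t)) x"
        using continuous_excess_line(2)[of UNIV] by (simp add: continuous_on_eq_continuous_at)
      then have "\<forall>\<^sub>F x' in at x. excess \<rho> (Complex x' ?t) < 0"
        using level_height(4)[OF t(3,4)] by (intro order_tendstoD) (auto simp: isCont_def)
      then show ?thesis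
      proof eventually_elim
        case (elim x')
        then show ?case using level_height(3)[OF t(1), of x'] t by fastforce
      qed
    qed
  qed
  then show ?thesis by (simp add: continuous_on_eq_continuous_at)
qed

lemma lev_simps [simp]: "Re (lev x) = x" "Im (lev x) = hgt x" by (auto simp: lev_def)

text \<open>At height 0 the excess is not positive, so the point is no pole; at height
  \<open>pi\<close> it is not negative, so the point is no zero. Thus the argument is defined all
  along the continued curve.\<close>

lemma lev_good: "lev x \<in> good"
proof (cases "0 < hgt x \<and> hgt x < pi")
  case True
  then show ?thesis by (intro good_interior) auto
next
  case False
  have cs: "lev x \<in> cstrip" using level_height(1,2) by (simp add: cstrip_def)
  consider "hgt x = 0" | "hgt x = pi" using False level_height(1,2)[of x] by linarith
  then show ?thesis
  proof cases
    case 1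
    have nz: "gprod c (exp (lev x)) \<noteq> 0" using cs 1 by (intro gprod_c_nz) auto
    have "excess \<rho> (lev x) \<le> 0" using 1 by (intro excess_lev_nonpos) auto
    then have "gprod d (- exp (lev x)) \<noteq> 0"
      using nz by (auto simp: excess_def mult_le_0_iff)
    then show ?thesis using nz cs by (simp add: good_def)
  next
    case 2
    have nz: "gprod d (- exp (lev x)) \<noteq> 0" using cs 2 by (intro gprod_d_nz) auto
    have "0 \<le> excess \<rho> (lev x)" using 2 by (intro excess_lev_nonneg) auto
    then have "gprod c (exp (lev x)) \<noteq> 0"
      using nz \<rho> by (auto simp: excess_def zero_le_mult_iff mult_le_0_iff)
    then show ?thesis using nz cs by (simp add: good_def)
  qed
qed

text \<open>The argument of \<open>F\<close> along the level curve, bridged over the intervals on which the curve is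
  absent: there \<open>lev\<close> runs along the boundary, where \<open>Im phi\<close> is locally constant.\<close>

definition turn :: "real \<Rightarrow> real" where "turn x = Im (phi (lev x))"

lemma continuous_turn: "continuous_on S turn"
proof -
  have "continuous_on S lev" unfolding lev_def Complex_eq
    using continuous_hgt by (intro continuous_intros) (auto intro: continuous_on_subset)
  then have "continuous_on S (\<lambda>x. phi (lev x))"
    using lev_good by (intro continuous_on_compose2[OF continuous_phi]) auto
  then show ?thesis unfolding turn_def by (intro continuous_intros)
qed

definition level :: "complex set" where "level = {s \<in> good. Re (phi s) = ln \<rho>}"

lemma level_iff_lev: "s \<in> level \<longleftrightarrow> s = lev (Re s) \<and> excess \<rho> s = 0"
proof
  assume s: "s \<in> level"
  then have e: "excess \<rho> s = 0" using excess_sgn \<rho> by (simp add: level_def)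
  have b: "0 \<le> Im s" "Im s \<le> pi" using s by (auto simp: level_def good_def cstrip_def)
  have "Im s = hgt (Re s)"
    using level_height(3)[of "Im s" "Re s"] level_height(4)[of "Re s" "Im s"] b e
    by (metis complex.collapse less_irrefl linorder_neqE_linordered_idom)
  then show "s = lev (Re s) \<and> excess \<rho> s = 0" using e by (simp add: complex_eq_iff)
next
  assume s: "s = lev (Re s) \<and> excess \<rho> s = 0"
  then have "s \<in> good" using lev_good by metis
  then show "s \<in> level" using excess_sgn \<rho> s by (auto simp: level_def)
qed

lemma turn_level: "s \<in> level \<Longrightarrow> turn (Re s) = Im (phi s)"
  using level_iff_lev unfolding turn_def by metis

lemma turn_const_bottom:
  assumes "\<And>x. x \<in> {a..b} \<Longrightarrow> hgt x = 0" "x \<in> {a..b}" "y \<in> {a..b}"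
  shows "turn x = turn y"
proof (rule constant_if_pi_discrete[OF continuous_turn _ assms(2,3)])
  fix x assume "x \<in> {a..b}"
  then show "\<exists>N::nat. turn x = 0 + of_nat N * pi"
    unfolding turn_def using Im_phi_bottom[OF lev_good[of x]] assms(1) by auto
qed

lemma turn_const_top:
  assumes "\<And>x. x \<in> {a..b} \<Longrightarrow> hgt x = pi" "x \<in> {a..b}" "y \<in> {a..b}"
  shows "turn x = turn y"
proof (rule constant_if_pi_discrete[OF continuous_turn _ assms(2,3)])
  fix x assume "x \<in> {a..b}"
  then have "Im (lev x) = pi" using assms(1) by simp
  then obtain N :: nat where "Im (phi (lev x)) = pik + of_nat N * pi"
    by (rule Im_phi_top[OF lev_good])
  then show "\<exists>N::nat. turn x = pik + of_nat N * pi" unfolding turn_def by blast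
qed

lemma first_crossing:
  assumes "x0 < x1" "turn x0 < \<beta>" "\<beta> \<le> turn x1"
  obtains s where "s \<in> level" "x0 < Re s" "Re s \<le> x1" "Im (phi s) = \<beta>"
proof -
  define X where "X = {x \<in> {x0..x1}. turn x = \<beta>}"
  have "\<exists>x. x0 \<le> x \<and> x \<le> x1 \<and> turn x = \<beta>"
    using assms by (intro IVT') (auto intro: continuous_turn)
  then have ne: "X \<noteq> {}" by (auto simp: X_def)
  have "closed X"
  proof -
    have "closed ({x0..x1} \<inter> turn -` {\<beta>})"
      by (intro continuous_closed_preimage continuous_turn) auto
    also have "{x0..x1} \<inter> turn -` {\<beta>} = X" by (auto simp: X_def)
    finally show ?thesis .
  qed
  moreover have bb: "bdd_below X" by (auto simp: X_def)
  ultimately have "Inf X \<in> X" using ne closed_contains_Inf by blast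
  then obtain x where x: "x = Inf X" "x0 \<le> x" "x \<le> x1" "turn x = \<beta>" by (auto simp: X_def)
  have first: "turn x' \<noteq> \<beta>" if "x0 \<le> x'" "x' < x" for x'
    using that x cInf_lower[OF _ bb, of x'] by (auto simp: X_def)
  have "x0 < x" using x assms by (cases "x = x0") auto
  \<comment> \<open>off the level curve \<open>turn\<close> is locally constant, so \<open>x\<close> could not be the first solution\<close>
  have "excess \<rho> (lev x) = 0"
  proof (rule ccontr)
    assume "excess \<rho> (lev x) \<noteq> 0"
    then consider "excess \<rho> (lev x) < 0" "hgt x = 0" | "0 < excess \<rho> (lev x)" "hgt x = pi"
      using excess_lev_nonneg[of x] excess_lev_nonpos[of x] level_height(1,2)[of x] by linarith
    then show False
    proof cases
      case 1
      have "isCont (\<lambda>x. excess \<rho> (Complex x 0)) x"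
        using continuous_excess_line(2)[of UNIV] by (simp add: continuous_on_eq_continuous_at)
      moreover have "excess \<rho> (Complex x 0) < 0" using 1 by (simp add: lev_def)
      ultimately have "\<forall>\<^sub>F x' in nhds x. excess \<rho> (Complex x' 0) < 0"
        by (auto simp: eventually_nhds_conv_at isCont_def intro: order_tendstoD)
      then obtain e where e: "e > 0" "\<And>x'. dist x' x < e \<Longrightarrow> excess \<rho> (Complex x' 0) < 0"
        by (auto simp: eventually_nhds_metric)
      define x' where "x' = max x0 (x - e / 2)"
      have x': "x0 \<le> x'" "x' < x" "x - e / 2 \<le> x'" using \<open>x0 < x\<close> e by (auto simp: x'_def)
      have "hgt u = 0" if "u \<in> {x'..x}" for u
      proof -
        have "excess \<rho> (Complex u 0) < 0" using e x' that by (intro e(2)) (auto simp: dist_real_def)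
        then show ?thesis using level_height(1)[of u] level_height(3)[of 0 u] by force
      qed
      then have "turn x' = turn x" using x' by (intro turn_const_bottom[of x' x]) auto
      then show False using first[of x'] x' x by simp
    next
      case 2
      have "isCont (\<lambda>x. excess \<rho> (Complex x pi)) x"
        using continuous_excess_line(2)[of UNIV] by (simp add: continuous_on_eq_continuous_at)
      moreover have "0 < excess \<rho> (Complex x pi)" using 2 by (simp add: lev_def)
      ultimately have "\<forall>\<^sub>F x' in nhds x. 0 < excess \<rho> (Complex x' pi)"
        by (auto simp: eventually_nhds_conv_at isCont_def intro: order_tendstoD)
      then obtain e where e: "e > 0" "\<And>x'. dist x' x < e \<Longrightarrow> 0 < excess \<rho> (Complex x' pi)"
        by (auto simp: eventually_nhds_metric)
      define x' where "x' = max x0 (x - e / 2)"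
      have x': "x0 \<le> x'" "x' < x" "x - e / 2 \<le> x'" using \<open>x0 < x\<close> e by (auto simp: x'_def)
      have "hgt u = pi" if "u \<in> {x'..x}" for u
      proof -
        have "0 < excess \<rho> (Complex u pi)" using e x' that by (intro e(2)) (auto simp: dist_real_def)
        then show ?thesis using level_height(2)[of u] level_height(4)[of u pi] by force
      qed
      then have "turn x' = turn x" using x' by (intro turn_const_top[of x' x]) auto
      then show False using first[of x'] x' x by simp
    qed
  qed
  then have "lev x \<in> level" by (simp add: level_iff_lev)
  then show thesis
    using that[of "lev x"] x \<open>x0 < x\<close> by (simp add: turn_def)
qed

end


section \<open>Behaviour near the origin and existence of level points\<close>

lemma filterlim_excess_top: "filterlim (\<lambda>x. excess \<rho> (Complex x pi)) at_top at_bot"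
proof -
  have e: "exp (Complex x pi) = - of_real (exp x)" for x
    by (simp add: complex_eq_iff Re_exp Im_exp)
  have cc: "isCont (gprod c) 0" "isCont (gprod d) 0"
    using C.holomorphic_gprod D.holomorphic_gprod
    by (auto dest!: holomorphic_on_imp_continuous_on simp: continuous_on_eq_continuous_at)
  have one: "gprod c 0 = 1" "gprod d 0 = 1" by (simp_all add: gprod_def)
  have e0: "((\<lambda>x. exp x) \<longlongrightarrow> (0::real)) at_bot" by (rule exp_at_bot)
  have "((\<lambda>x. gprod c (- of_real (exp x))) \<longlongrightarrow> gprod c 0) at_bot"
    by (rule isCont_tendsto_compose[OF cc(1)]) (use tendsto_minus[OF tendsto_of_real[OF e0]] in simp)
  then have lc: "((\<lambda>x. norm (gprod c (- of_real (exp x)))) \<longlongrightarrow> 1) at_bot"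
    using tendsto_norm one by fastforce
  have "((\<lambda>x. gprod d (of_real (exp x))) \<longlongrightarrow> gprod d 0) at_bot"
    by (rule isCont_tendsto_compose[OF cc(2)]) (use tendsto_of_real[OF e0] in simp)
  then have ld: "((\<lambda>x. - (\<rho> * norm (gprod d (of_real (exp x))))) \<longlongrightarrow> - \<rho>) at_bot"
    using tendsto_minus[OF tendsto_mult_left[OF tendsto_norm]] one by fastforce
  have lA: "((\<lambda>x. exp (- (A * exp x))) \<longlongrightarrow> 1) at_bot"
    using tendsto_exp[OF tendsto_minus[OF tendsto_mult_left[OF e0, of A]]] by simp
  \<comment> \<open>The only unbounded factor near the origin: \<open>|F|\<close> tends to infinity
    there because \<open>p < 0\<close>, while all other factors tend to 1.\<close>
  have "0 < - (real_of_int p / of_nat k)" using p_neg kpos by (simp add: divide_neg_pos)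
  then have "filterlim (\<lambda>x::real. - (of_int p / of_nat k) * - x) at_top at_bot"
    by (rule filterlim_tendsto_pos_mult_at_top[OF tendsto_const _ filterlim_uminus_at_top_at_bot])
  then have "filterlim (\<lambda>x::real. (of_int p / of_nat k) * x) at_top at_bot" by simp
  then have "filterlim (\<lambda>x::real. exp ((of_int p / of_nat k) * x)) at_top at_bot"
    by (rule filterlim_compose[OF exp_at_top])
  then have "filterlim (\<lambda>x. (exp (- (A * exp x)) * norm (gprod c (- of_real (exp x)))) * exp ((of_int p / of_nat k) * x)) at_top at_bot"
    using tendsto_mult[OF lA lc] by (intro filterlim_tendsto_pos_mult_at_top) auto
  then have "filterlim (\<lambda>x. - (\<rho> * norm (gprod d (of_real (exp x)))) +
     (exp (- (A * exp x)) * norm (gprod c (- of_real (exp x)))) * exp ((of_int p / of_nat k) * x)) at_top at_bot"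
    by (rule filterlim_tendsto_add_at_top[OF ld])
  also have "(\<lambda>x. - (\<rho> * norm (gprod d (of_real (exp x)))) +
     (exp (- (A * exp x)) * norm (gprod c (- of_real (exp x)))) * exp ((of_int p / of_nat k) * x))
     = (\<lambda>x. excess \<rho> (Complex x pi))"
    unfolding excess_def e by (rule ext) (simp add: exp_add norm_mult algebra_simps, simp add: exp_add[symmetric])
  finally show ?thesis .
qed

text \<open>Near the origin \<open>|F|\<close> exceeds \<open>\<rho>\<close> on the whole arc, so
  the continuation runs along the line \<open>Im s = pi\<close>. There
  \<open>suminf c * exp x < 1\<close> guarantees that no zero has been passed, so the argument still
  has its least value.\<close>

lemma turn_initial:
  assumes \<rho>: "0 < \<rho>"
  obtains X where "\<And>x. x \<le> X \<Longrightarrow> 0 < excess \<rho> (Complex x pi)"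
    "\<And>x. x \<le> X \<Longrightarrow> level_height \<rho> x = pi" "\<And>x. x \<le> X \<Longrightarrow> turn \<rho> x = pik"
proof -
  have 1: "\<forall>\<^sub>F x in at_bot. 0 < excess \<rho> (Complex x pi)"
    using filterlim_excess_top by (simp add: filterlim_at_top_dense)
  have "((\<lambda>x. suminf c * exp x) \<longlongrightarrow> suminf c * 0) at_bot"
    by (intro tendsto_mult_left exp_at_bot)
  then have 2: "\<forall>\<^sub>F x in at_bot. suminf c * exp x < 1"
    by (rule order_tendstoD) simp
  from 1 2 have "\<forall>\<^sub>F x in at_bot. 0 < excess \<rho> (Complex x pi) \<and> suminf c * exp x < 1"
    by (rule eventually_conj)
  then obtain X where X: "\<And>x. x \<le> X \<Longrightarrow> 0 < excess \<rho> (Complex x pi) \<and> suminf c * exp x < 1"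
    by (auto simp: eventually_at_bot_linorder)
  have h: "level_height \<rho> x = pi" if "x \<le> X" for x
    using X[OF that] level_height(2)[OF \<rho>, of x] level_height(4)[OF \<rho>, of x pi] by force
  have t: "turn \<rho> x = pik" if "x \<le> X" for x
  proof -
    have g: "lev \<rho> x \<in> good" by (rule lev_good[OF \<rho>])
    have "c \<nu> * exp x < 1" for \<nu>
    proof -
      have "c \<nu> * exp x \<le> suminf c * exp x" using C.le_suminf by (simp add: mult_right_mono)
      then show ?thesis using X[OF that] by linarith
    qed
    then show ?thesis
      unfolding turn_def[OF \<rho>] using Im_phi_top_0[OF g] lev_simps[OF \<rho>] h[OF that] by simp
  qed
  show thesis using that X h t by blast
qed

lemma reach:
  assumes \<rho>: "0 < \<rho>" and s: "s \<in> level \<rho>" and b: "pik < \<beta>" "\<beta> \<le> Im (phi s)"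
  obtains s' where "s' \<in> level \<rho>" "Re s' \<le> Re s" "Im (phi s') = \<beta>"
proof -
  obtain X where X: "\<And>x. x \<le> X \<Longrightarrow> 0 < excess \<rho> (Complex x pi)"
    "\<And>x. x \<le> X \<Longrightarrow> level_height \<rho> x = pi" "\<And>x. x \<le> X \<Longrightarrow> turn \<rho> x = pik"
    using turn_initial[OF \<rho>] by blast
  \<comment> \<open>Far enough to the left for \<open>turn\<close> to have its initial
    value.\<close>
  define x0 where "x0 = min X (Re s - 1)"
  have "turn \<rho> x0 < \<beta>" using X(3)[of x0] b by (simp add: x0_def)
  moreover have "\<beta> \<le> turn \<rho> (Re s)" using turn_level[OF \<rho> s] b by simp
  moreover have "x0 < Re s" by (simp add: x0_def)
  ultimately show thesis using first_crossing[OF \<rho>] that by metis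
qed

text \<open>On the line \<open>Im s = pi\<close> the excess is positive near the origin and not
  positive at a zero of the numerator. Up to the first change of sign the continued curve follows
  this line, so the argument keeps its initial value.\<close>

lemma top_level_point:
  assumes \<rho>: "0 < \<rho>"
  obtains s where "s \<in> level \<rho>" "Im s = pi" "Im (phi s) = pik"
proof -
  obtain X where X: "\<And>x. x \<le> X \<Longrightarrow> 0 < excess \<rho> (Complex x pi)"
    "\<And>x. x \<le> X \<Longrightarrow> level_height \<rho> x = pi" "\<And>x. x \<le> X \<Longrightarrow> turn \<rho> x = pik"
    using turn_initial[OF \<rho>] by blast
  let ?h = "\<lambda>x. excess \<rho> (Complex x pi)"
  \<comment> \<open>The zero of factor 0, where \<open>exp s = - 1 / c 0\<close>; it need not be the
    first zero.\<close>
  define x1 where "x1 = - ln (c 0)"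
  have "1 + of_real (c 0) * exp (Complex x1 pi) = 0"
    using C.factor_real_line[of "Complex x1 pi" 0] c0 by (simp add: x1_def exp_minus)
  then have "gprod c (exp (Complex x1 pi)) = 0" unfolding C.gprod_eq_0_iff by blast
  then have h1: "?h x1 \<le> 0" unfolding excess_def using \<rho> by simp
  have "X \<le> x1" using X(1)[of x1] h1 by force
  then obtain x where x: "X < x" "?h x = 0" "\<And>t. X \<le> t \<Longrightarrow> t \<le> x \<Longrightarrow> 0 \<le> ?h t"
    using first_zero[OF \<open>X \<le> x1\<close> continuous_excess_line(2)[OF \<rho>] X(1)[OF order.refl] h1] by metis
  have hp: "level_height \<rho> t = pi" if "t \<in> {X..x}" for t
    using x(3)[of t] that level_height(2)[OF \<rho>, of t] level_height(4)[OF \<rho>, of t pi] by force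
  have "turn \<rho> X = turn \<rho> x" using x(1) hp by (intro turn_const_top[OF \<rho>]) auto
  then have t: "turn \<rho> x = pik" using X(3)[of X] by simp
  have l: "lev \<rho> x = Complex x pi" using hp[of x] x(1) by (simp add: lev_def[OF \<rho>])
  have "lev \<rho> x \<in> level \<rho>"
    using x(2) by (simp add: level_iff_lev[OF \<rho>] lev_simps[OF \<rho>] l)
  then show thesis using that[of "lev \<rho> x"] t by (simp add: turn_def[OF \<rho>] l)
qed

section \<open>The logarithmic derivative and its sign\<close>

text \<open>\<open>k * dlog (z ^ k)\<close> is \<open>z * F' z / F z\<close>.\<close>

definition dlog :: "complex \<Rightarrow> complex" where
  "dlog w = of_real (of_int p / of_nat k) + of_real A * w + w * (deriv (gprod c) w / gprod c w)
     + w * (deriv (gprod d) (- w) / gprod d (- w))"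

lemma gprod_deriv:
  "(gprod c has_field_derivative deriv (gprod c) w) (at w)"
  "(gprod d has_field_derivative deriv (gprod d) w) (at w)"
  using C.holomorphic_gprod D.holomorphic_gprod by (auto intro: holomorphic_derivI)

lemma F_nz: "F z \<noteq> 0 \<longleftrightarrow> z \<noteq> 0 \<and> gprod c (z ^ k) \<noteq> 0 \<and> gprod d (- (z ^ k)) \<noteq> 0"
  using p_neg by (auto simp: F_def)

lemma F_deriv:
  assumes "F z \<noteq> 0"
  shows "(F has_field_derivative of_nat k * F z / z * dlog (z ^ k)) (at z)"
proof -
  have nz: "z \<noteq> 0" "gprod c (z ^ k) \<noteq> 0" "gprod d (- (z ^ k)) \<noteq> 0" using assms F_nz by auto
  have zk: "z ^ k = z * z ^ (k - 1)" using kpos by (simp add: power_eq_if)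
  have zp: "z powi p = z * z powi (p - 1)" using nz by (simp add: power_int_diff)
  have 1: "((\<lambda>z. gprod c (z ^ k)) has_field_derivative deriv (gprod c) (z ^ k) * (of_nat k * z ^ (k - 1))) (at z)"
    by (rule DERIV_chain2[OF gprod_deriv(1)]) (auto intro!: derivative_eq_intros)
  have 2: "((\<lambda>z. gprod d (- (z ^ k))) has_field_derivative deriv (gprod d) (- (z ^ k)) * (- (of_nat k * z ^ (k - 1)))) (at z)"
    by (rule DERIV_chain2[OF gprod_deriv(2)]) (auto intro!: derivative_eq_intros)
  have 3: "((\<lambda>z. z powi p) has_field_derivative of_int p * z powi (p - 1)) (at z)"
    using nz by (auto intro!: derivative_eq_intros)
  have 4: "((\<lambda>z. exp (of_real A * z ^ k)) has_field_derivative exp (of_real A * z ^ k) * (of_real A * (of_nat k * z ^ (k - 1)))) (at z)"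
    by (auto intro!: derivative_eq_intros)
  have D: "(F has_field_derivative
      (of_int p * z powi (p - 1) * exp (of_real A * z ^ k) + exp (of_real A * z ^ k) * (of_real A * (of_nat k * z ^ (k - 1))) * z powi p)
        * (gprod c (z ^ k) / gprod d (- (z ^ k)))
      + (deriv (gprod c) (z ^ k) * (of_nat k * z ^ (k - 1)) * gprod d (- (z ^ k))
         - gprod c (z ^ k) * (deriv (gprod d) (- (z ^ k)) * (- (of_nat k * z ^ (k - 1)))))
        / (gprod d (- (z ^ k)) * gprod d (- (z ^ k))) * (z powi p * exp (of_real A * z ^ k))) (at z)"
    unfolding F_def[abs_def] by (rule DERIV_mult[OF DERIV_mult[OF 3 4] DERIV_divide[OF 1 2 nz(3)]])
  have "of_nat k * F z / z * dlog (z ^ k) =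
      (of_int p * z powi (p - 1) * exp (of_real A * z ^ k) + exp (of_real A * z ^ k) * (of_real A * (of_nat k * z ^ (k - 1))) * z powi p)
        * (gprod c (z ^ k) / gprod d (- (z ^ k)))
      + (deriv (gprod c) (z ^ k) * (of_nat k * z ^ (k - 1)) * gprod d (- (z ^ k))
         - gprod c (z ^ k) * (deriv (gprod d) (- (z ^ k)) * (- (of_nat k * z ^ (k - 1)))))
        / (gprod d (- (z ^ k)) * gprod d (- (z ^ k))) * (z powi p * exp (of_real A * z ^ k))"
  proof -
    \<comment> \<open>With these abbreviations the claim is an identity of rational expressions,
      which the simplifier can clear of denominators without touching the powers of
      \<open>z\<close>.\<close>
    define e Y P Q P' Q' where "e = exp (of_real A * z ^ k)" "Y = z ^ (k - 1)" "P = gprod c (z ^ k)"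
      "Q = gprod d (- (z ^ k))" "P' = deriv (gprod c) (z ^ k)" "Q' = deriv (gprod d) (- (z ^ k))"
    note defs = this
    have a: "of_nat k * F z / z * dlog (z ^ k) = of_nat k * (z powi (p - 1) * e * (P / Q)) *
       (of_int p / of_nat k + of_real A * (z * Y) + (z * Y) * (P' / P) + (z * Y) * (Q' / Q))"
      unfolding F_def dlog_def defs(1)[symmetric] defs(3-6)[symmetric]
      unfolding zk zp defs(2)[symmetric] using nz by simp
    show ?thesis
      unfolding a unfolding defs(1)[symmetric] defs(3-6)[symmetric]
      unfolding zp defs(2)[symmetric]
      using nz(1) nz(2)[folded defs(3)] nz(3)[folded defs(4)] kpos
      by (simp add: divide_simps) (simp add: algebra_simps)
  qed
  with D show ?thesis by simp
qed

lemma dlog_sums: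
  assumes "gprod c w \<noteq> 0" "gprod d (- w) \<noteq> 0"
  shows "(\<lambda>\<nu>. of_real (c \<nu>) * w / (1 + of_real (c \<nu>) * w) + of_real (d \<nu>) * w / (1 - of_real (d \<nu>) * w))
     sums (dlog w - of_real (of_int p / of_nat k) - of_real A * w)"
proof -
  have "(\<lambda>\<nu>. w * (of_real (c \<nu>) / (1 + of_real (c \<nu>) * w)) + w * (of_real (d \<nu>) / (1 + of_real (d \<nu>) * (- w))))
     sums (w * (deriv (gprod c) w / gprod c w) + w * (deriv (gprod d) (- w) / gprod d (- w)))"
    by (intro sums_add sums_mult C.logderiv_gprod D.logderiv_gprod assms)
  then show ?thesis by (simp add: dlog_def mult.commute)
qed

text \<open>\<open>Im (dlog w)\<close> is \<open>Im w\<close> times the sum of \<open>A\<close> and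
  a series of nonnegative terms, whose term 0 is positive. Critical points with
  \<open>F z \<noteq> 0\<close> can therefore occur only where \<open>z ^ k\<close> is real.\<close>

lemma dlog_nonzero:
  assumes "gprod c w \<noteq> 0" "gprod d (- w) \<noteq> 0" "Im w \<noteq> 0"
  shows "dlog w \<noteq> 0"
proof
  assume 0: "dlog w = 0"
  let ?f = "\<lambda>\<nu>. c \<nu> / (norm (1 + of_real (c \<nu>) * w))\<^sup>2 + d \<nu> / (norm (1 - of_real (d \<nu>) * w))\<^sup>2"
  have im: "Im (v / (1 + v)) = Im v / (norm (1 + v))\<^sup>2" for v
  proof (cases "1 + v = 0")
    case False
    then have "v / (1 + v) = 1 - 1 / (1 + v)" by (simp add: field_simps)
    then show ?thesis by (simp add: Im_divide cmod_power2)
  qed simp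
  have im1: "Im (of_real a * w / (1 + of_real a * w)) = a / (norm (1 + of_real a * w))\<^sup>2 * Im w" for a
    unfolding im by simp
  have im2: "Im (of_real a * w / (1 - of_real a * w)) = a / (norm (1 - of_real a * w))\<^sup>2 * Im w" for a
    using im[of "- (of_real a * w)"] by simp
  have "(\<lambda>\<nu>. Im (of_real (c \<nu>) * w / (1 + of_real (c \<nu>) * w) + of_real (d \<nu>) * w / (1 - of_real (d \<nu>) * w)))
     sums Im (dlog w - of_real (of_int p / of_nat k) - of_real A * w)"
    using dlog_sums[OF assms(1,2)] by (simp add: sums_complex_iff)
  then have "(\<lambda>\<nu>. ?f \<nu> * Im w) sums (- A * Im w)"
    unfolding plus_complex.simps im1 im2 by (simp add: 0 distrib_right)
  then have s: "?f sums (- A)" using assms(3) by (subst (asm) sums_mult2_iff) auto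
  have nn: "0 \<le> ?f \<nu>" for \<nu> using C.nonneg D.nonneg by (intro add_nonneg_nonneg) auto
  have "sum ?f {0} \<le> suminf ?f" using s nn by (intro sum_le_suminf) (auto simp: sums_iff)
  then have le: "?f 0 \<le> - A" using s by (simp add: sums_iff)
  have "1 + of_real (c 0) * w \<noteq> 0" using assms(1) by (auto simp: C.gprod_eq_0_iff)
  then have "0 < c 0 / (norm (1 + of_real (c 0) * w))\<^sup>2" using c0 by simp
  moreover have "0 \<le> d 0 / (norm (1 - of_real (d 0) * w))\<^sup>2" using d0 by simp
  ultimately show False using le A_nonneg by linarith
qed

text \<open>Before the first zero on the negative axis all terms of the series are at most 0, so is
  \<open>- A * t\<close>, and \<open>p / k\<close> is negative. Hence \<open>|F|\<close> decreases
  strictly along the corresponding rays.\<close>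

lemma dlog_neg:
  assumes "0 < t" "\<And>\<nu>. c \<nu> * t < 1"
  shows "Re (dlog (- of_real t)) < 0"
proof -
  have nz: "1 - c \<nu> * t \<noteq> 0" "0 < 1 + d \<nu> * t" for \<nu>
    using assms(2)[of \<nu>] D.nonneg[of \<nu>] assms(1) by (auto intro: add_pos_nonneg)
  have eq1: "1 + of_real (c \<nu>) * (- of_real t) = complex_of_real (1 - c \<nu> * t)"
    "1 + of_real (d \<nu>) * (- (- of_real t)) = complex_of_real (1 + d \<nu> * t)"
    "1 - of_real (d \<nu>) * (- of_real t) = complex_of_real (1 + d \<nu> * t)" for \<nu> by simp_all
  have g: "gprod c (- of_real t) \<noteq> 0" "gprod d (- (- of_real t)) \<noteq> 0"
    unfolding C.gprod_eq_0_iff D.gprod_eq_0_iff eq1 of_real_eq_0_iff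
    using nz less_irrefl by (blast, metis)
  let ?f = "\<lambda>\<nu>. - (c \<nu> * t / (1 - c \<nu> * t) + d \<nu> * t / (1 + d \<nu> * t))"
  have e: "of_real (c \<nu>) * (- of_real t) / (1 + of_real (c \<nu>) * (- of_real t)) + of_real (d \<nu>) * (- of_real t) / (1 - of_real (d \<nu>) * (- of_real t))
     = complex_of_real (?f \<nu>)" for \<nu>
    unfolding eq1 by simp
  have fs: "?f sums Re (dlog (- of_real t) - of_real (of_int p / of_nat k) - of_real A * (- of_real t))"
    using dlog_sums[OF g] unfolding e by (simp only: sums_complex_iff Re_complex_of_real)
  have "?f \<nu> \<le> 0" for \<nu>
  proof -
    have "0 \<le> c \<nu> * t / (1 - c \<nu> * t)" using assms C.nonneg by (intro divide_nonneg_nonneg) (auto simp: less_imp_le)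
    moreover have "0 \<le> d \<nu> * t / (1 + d \<nu> * t)" using assms D.nonneg nz(2)[of \<nu>] by (intro divide_nonneg_nonneg) auto
    ultimately show ?thesis by linarith
  qed
  then have "Re (dlog (- of_real t) - of_real (of_int p / of_nat k) - of_real A * (- of_real t)) \<le> 0"
    by (rule sums_le[OF _ fs sums_zero])
  then have "Re (dlog (- of_real t)) \<le> of_int p / of_nat k - A * t" by simp
  moreover have "real_of_int p / of_nat k < 0" using p_neg kpos by (simp add: divide_neg_pos)
  moreover have "0 \<le> A * t" using A_nonneg assms by simp
  ultimately show ?thesis by linarith
qed

text \<open>Up to the first pole every term of the series and \<open>A * t\<close> increase with
  \<open>t\<close>; the bound keeps one term. It yields both the strict monotonicity of
  \<open>slope\<close> and the nonvanishing of the derivative of \<open>dlog\<close>.\<close>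

lemma dlog_real_incr:
  assumes "0 < t" "t \<le> t'" "\<And>\<nu>. d \<nu> * t' < 1"
  shows "c 0 * t' / (1 + c 0 * t') - c 0 * t / (1 + c 0 * t) \<le> Re (dlog (of_real t')) - Re (dlog (of_real t))"
proof -
  have dt: "d \<nu> * t < 1" for \<nu>
    using assms D.nonneg[of \<nu>] by (meson le_less_trans mult_left_mono)
  have main: "(\<lambda>\<nu>. c \<nu> * u / (1 + c \<nu> * u) + d \<nu> * u / (1 - d \<nu> * u)) sums
      (Re (dlog (of_real u)) - of_int p / of_nat k - A * u)"
    if u: "0 < u" "\<And>\<nu>. d \<nu> * u < 1" for u
  proof -
    have nz: "1 - d \<nu> * u \<noteq> 0" "0 < 1 + c \<nu> * u" for \<nu>
      using u(2)[of \<nu>] C.nonneg[of \<nu>] u(1) by (auto intro: add_pos_nonneg)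
    have eq1: "1 + of_real (c \<nu>) * of_real u = complex_of_real (1 + c \<nu> * u)"
      "1 + of_real (d \<nu>) * (- of_real u) = complex_of_real (1 - d \<nu> * u)"
      "1 - of_real (d \<nu>) * of_real u = complex_of_real (1 - d \<nu> * u)" for \<nu> by simp_all
    have g: "gprod c (of_real u) \<noteq> 0" "gprod d (- of_real u) \<noteq> 0"
      unfolding C.gprod_eq_0_iff D.gprod_eq_0_iff eq1 of_real_eq_0_iff using nz by (metis less_irrefl)+
    have e: "of_real (c \<nu>) * of_real u / (1 + of_real (c \<nu>) * of_real u) + of_real (d \<nu>) * of_real u / (1 - of_real (d \<nu>) * of_real u)
       = complex_of_real (c \<nu> * u / (1 + c \<nu> * u) + d \<nu> * u / (1 - d \<nu> * u))" for \<nu>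
      unfolding eq1 by simp
    show ?thesis
      using dlog_sums[OF g] unfolding e by (simp only: sums_complex_iff Re_complex_of_real) simp
  qed
  let ?f = "\<lambda>\<nu>. (c \<nu> * t' / (1 + c \<nu> * t') - c \<nu> * t / (1 + c \<nu> * t)) + (d \<nu> * t' / (1 - d \<nu> * t') - d \<nu> * t / (1 - d \<nu> * t))"
  have "0 < t'" using assms by linarith
  have s: "?f sums (Re (dlog (of_real t')) - Re (dlog (of_real t)) - A * (t' - t))"
    using sums_diff[OF main[OF \<open>0 < t'\<close> assms(3)] main[OF assms(1) dt]] by (simp add: algebra_simps)
  have nc: "0 \<le> c \<nu> * t' / (1 + c \<nu> * t') - c \<nu> * t / (1 + c \<nu> * t)" for \<nu>
  proof -
    have "c \<nu> * t / (1 + c \<nu> * t) \<le> c \<nu> * t' / (1 + c \<nu> * t')"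
    proof -
      have "x / (1 + x) \<le> y / (1 + y)" if "0 \<le> x" "x \<le> y" for x y :: real
      proof -
        have "0 < 1 + x" "0 < 1 + y" using that by auto
        then show ?thesis using that by (simp add: field_simps)
      qed
      then show ?thesis using C.nonneg[of \<nu>] assms(1,2) mult_left_mono[OF assms(2) C.nonneg[of \<nu>]] by simp
    qed
    then show ?thesis by simp
  qed
  have nd: "0 \<le> d \<nu> * t' / (1 - d \<nu> * t') - d \<nu> * t / (1 - d \<nu> * t)" for \<nu>
  proof -
    have "d \<nu> * t / (1 - d \<nu> * t) \<le> d \<nu> * t' / (1 - d \<nu> * t')"
      using D.nonneg[of \<nu>] assms \<open>0 < t'\<close> mult_left_mono[OF assms(2) D.nonneg[of \<nu>]] dt[of \<nu>]
      by (intro frac_le) auto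
    then show ?thesis by simp
  qed
  have nn: "0 \<le> ?f \<nu>" for \<nu> using nc nd by (intro add_nonneg_nonneg)
  have "sum ?f {0} \<le> suminf ?f" using s nn by (intro sum_le_suminf) (auto simp: sums_iff)
  then have "?f 0 \<le> Re (dlog (of_real t')) - Re (dlog (of_real t)) - A * (t' - t)"
    using s by (simp add: sums_iff)
  moreover have "0 \<le> A * (t' - t)" using A_nonneg assms by simp
  ultimately show ?thesis using nd[of 0] by linarith
qed


section \<open>Symmetries of the function\<close>

lemma F_rotate: "u ^ k = 1 \<Longrightarrow> F (u * z) = u powi p * F z"
  by (simp add: F_def power_mult_distrib power_int_mult_distrib)

lemma F_cnj: "F (cnj z) = cnj (F z)"
proof -
  have "gprod d (- (cnj z ^ k)) = cnj (gprod d (- (z ^ k)))"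
    using D.gprod_cnj[of "- (z ^ k)"] by simp
  moreover have "gprod c (cnj z ^ k) = cnj (gprod c (z ^ k))"
    using C.gprod_cnj[of "z ^ k"] by simp
  ultimately show ?thesis by (simp add: F_def exp_cnj)
qed

section \<open>Points of the plane in terms of the strip\<close>

text \<open>For \<open>s\<close> in the strip, \<open>e = 1\<close> gives a point of the sector \<open>Q\<close> with index \<open>2 * m\<close> and \<open>e = -1\<close> its
  mirror image, in the sector with index \<open>2 * m - 1\<close>.\<close>

definition pt :: "complex \<Rightarrow> int \<Rightarrow> int \<Rightarrow> complex" where
  "pt s e m = exp (Complex (Re s) (of_int e * Im s + 2 * pi * of_int m) / of_nat k)"

text \<open>The argument of \<open>F\<close> in units of \<open>pi / k\<close>.\<close>

definition tau :: "complex \<Rightarrow> real" where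
  "tau s = Im (phi s) * of_nat k / pi"

text \<open>The values of \<open>tau\<close> at which a level point yields some \<open>\<alpha>\<close>-point, if \<open>Arg \<alpha> = b * pi / k\<close>.\<close>

definition target :: "real \<Rightarrow> real \<Rightarrow> bool" where
  "target b t \<longleftrightarrow> (\<exists>e j::int. e \<in> {1, -1} \<and> of_int e * t = b + 2 * of_int j)"

lemma norm_pt [simp]: "norm (pt s e m) = exp (Re s / k)"
  by (simp add: pt_def)

lemma Re_eqI_norm_pt: "norm (pt s e m) = norm (pt s' e' m') \<Longrightarrow> Re s = Re s'"
  using kpos by simp

lemma norm_pt_less: "norm (pt s e m) < norm (pt s' e' m') \<longleftrightarrow> Re s < Re s'"
  using kpos by (simp add: divide_less_cancel)

lemma pt_rotate: "pt s e m = exp (2 * of_int m * pi * \<i> / of_nat k) * pt s e 0"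
  unfolding pt_def exp_add[symmetric]
  by (rule arg_cong[of _ _ exp]) (simp add: complex_eq_iff add_divide_distrib)

lemma rotation_power: "exp (2 * of_int m * pi * \<i> / of_nat k) ^ k = 1"
proof -
  have "exp (2 * of_int m * pi * \<i> / of_nat k) ^ k = exp (2 * of_int m * pi * \<i>)"
    using kpos by (intro exp_divide_power_eq)
  also have "\<dots> = 1" unfolding exp_eq_1 by (auto intro: exI[of _ m])
  finally show ?thesis .
qed

lemma pt_pow: "pt s e m ^ k = exp (Complex (Re s) (of_int e * Im s))"
proof -
  have "pt s e 0 ^ k = exp (Complex (Re s) (of_int e * Im s))"
    unfolding pt_def using kpos by (subst exp_divide_power_eq) auto
  then show ?thesis using rotation_power by (subst pt_rotate) (simp add: power_mult_distrib)
qed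

lemma pt_0: "pt s 1 0 = exp (s / of_nat k)" "pt s (-1) 0 = cnj (exp (s / of_nat k))"
proof -
  have "Complex (Re s) (of_int 1 * Im s + 2 * pi * of_int 0) = s" by (simp add: complex_eq_iff)
  then show "pt s 1 0 = exp (s / of_nat k)" by (simp only: pt_def)
  have "Complex (Re s) (of_int (- 1) * Im s + 2 * pi * of_int 0) = cnj s" by (simp add: complex_eq_iff)
  then show "pt s (-1) 0 = cnj (exp (s / of_nat k))" by (simp add: pt_def exp_cnj)
qed

lemma F_pt:
  assumes "s \<in> good" "e \<in> {1, -1}"
  shows "F (pt s e m) = exp (Complex (Re (phi s)) (of_int e * Im (phi s) + 2 * pi * of_int (p * m) / of_nat k))"
proof -
  have 1: "F (pt s e 0) = exp (Complex (Re (phi s)) (of_int e * Im (phi s)))"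
    using assms(2)
  proof
    assume "e = 1"
    then show ?thesis using exp_phi[OF assms(1)] by (simp add: pt_0)
  next
    assume "e \<in> {- 1}"
    moreover have "Complex (Re (phi s)) (- Im (phi s)) = cnj (phi s)" by (simp add: complex_eq_iff)
    ultimately show ?thesis using exp_phi[OF assms(1)] by (simp add: pt_0 F_cnj exp_cnj[symmetric])
  qed
  have "F (pt s e m) = exp (2 * of_int m * pi * \<i> / of_nat k) powi p * F (pt s e 0)"
    by (subst pt_rotate) (rule F_rotate[OF rotation_power])
  also have "\<dots> = exp (of_int p * (2 * of_int m * pi * \<i> / of_nat k)) * F (pt s e 0)"
    by (simp add: exp_power_int)
  also have "\<dots> = exp (Complex (Re (phi s)) (of_int e * Im (phi s) + 2 * pi * of_int (p * m) / of_nat k))"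
    unfolding 1 exp_add[symmetric]
    by (rule arg_cong[of _ _ exp]) (simp add: complex_eq_iff)
  finally show ?thesis .
qed

lemma F_pt_bad:
  assumes "s \<in> cstrip" "s \<notin> good" "e \<in> {1, -1}"
  shows "F (pt s e m) = 0"
proof -
  have "F (pt s e 0) = 0" using assms F_exp_bad[OF assms(1,2)] by (auto simp: pt_0 F_cnj)
  then show ?thesis unfolding pt_rotate[of s e m] F_rotate[OF rotation_power] by simp
qed

text \<open>The modulus of \<open>F (pt s e m)\<close> is \<open>exp (Re (phi s))\<close>; in units
  of \<open>pi / k\<close> its argument is \<open>e * tau s + 2 * p * m\<close>, and that of the
  right-hand side is \<open>b\<close>. A full turn is \<open>2 * k\<close> units, and
  \<open>n\<close> counts the turns.\<close>

lemma alpha_pt: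
  assumes "s \<in> cstrip" "e \<in> {1, -1}" and \<rho>: "0 < \<rho>"
  shows "F (pt s e m) = of_real \<rho> * exp (\<i> * of_real (b * pi / of_nat k)) \<longleftrightarrow>
    s \<in> level \<rho> \<and> (\<exists>n::int. of_int e * tau s + 2 * of_int (p * m) = b + 2 * of_nat k * of_int n)"
proof (cases "s \<in> good")
  case False
  then show ?thesis using F_pt_bad[OF assms(1) _ assms(2)] \<rho> by (simp add: level_def[OF \<rho>])
next
  case True
  have "of_real \<rho> * exp (\<i> * of_real (b * pi / of_nat k)) = exp (Complex (ln \<rho>) (b * pi / of_nat k))"
  proof -
    have "complex_of_real \<rho> = exp (of_real (ln \<rho>))" using \<rho> by (simp add: exp_of_real)
    then show ?thesis by (simp add: exp_add[symmetric] Complex_eq)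
  qed
  then have "F (pt s e m) = of_real \<rho> * exp (\<i> * of_real (b * pi / of_nat k)) \<longleftrightarrow>
     (\<exists>n::int. Complex (Re (phi s)) (of_int e * Im (phi s) + 2 * pi * of_int (p * m) / of_nat k)
        = Complex (ln \<rho>) (b * pi / of_nat k) + of_real (of_int (2 * n) * pi) * \<i>)"
    unfolding F_pt[OF True assms(2)] by (simp only: exp_eq)
  also have "\<dots> \<longleftrightarrow> Re (phi s) = ln \<rho> \<and> (\<exists>n::int. of_int e * Im (phi s) + 2 * pi * of_int (p * m) / of_nat k
        = b * pi / of_nat k + 2 * of_int n * pi)"
    by (simp add: complex_eq_iff)
  also have "(\<lambda>n::int. of_int e * Im (phi s) + 2 * pi * of_int (p * m) / of_nat k
        = b * pi / of_nat k + 2 * of_int n * pi) =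
      (\<lambda>n. of_int e * tau s + 2 * of_int (p * m) = b + 2 * of_nat k * of_int n)"
  proof
    fix n :: int
    have "of_int e * Im (phi s) + 2 * pi * of_int (p * m) / of_nat k = b * pi / of_nat k + 2 * of_int n * pi
       \<longleftrightarrow> (of_int e * tau s + 2 * of_int (p * m)) * (pi / k) = (b + 2 * of_nat k * of_int n) * (pi / k)"
    proof -
      have "(of_int e * tau s + 2 * of_int (p * m)) * (pi / k) = of_int e * Im (phi s) + 2 * pi * of_int (p * m) / of_nat k"
        using kpos by (simp add: tau_def field_simps)
      moreover have "(b + 2 * of_nat k * of_int n) * (pi / k) = b * pi / of_nat k + 2 * of_int n * pi"
        using kpos by (simp add: field_simps)
      ultimately show ?thesis by (simp only:)
    qed
    also have "\<dots> \<longleftrightarrow> of_int e * tau s + 2 * of_int (p * m) = b + 2 * of_nat k * of_int n"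
      using kpos by simp
    finally show "(of_int e * Im (phi s) + 2 * pi * of_int (p * m) / of_nat k = b * pi / of_nat k + 2 * of_int n * pi)
      = (of_int e * tau s + 2 * of_int (p * m) = b + 2 * of_nat k * of_int n)" .
  qed
  finally show ?thesis using True by (simp add: level_def[OF \<rho>])
qed

lemma pt_cong: "[m = m'] (mod int k) \<Longrightarrow> pt s e m = pt s e m'"
proof -
  assume "[m = m'] (mod int k)"
  then obtain n where n: "m = m' + int k * n" by (metis cong_iff_lin cong_sym)
  have "exp (2 * of_int m * pi * \<i> / of_nat k) = exp (2 * of_int m' * pi * \<i> / of_nat k + of_real (of_int (2 * n) * pi) * \<i>)"
    unfolding n using kpos by (intro arg_cong[of _ _ exp]) (simp add: field_simps)
  also have "\<dots> = exp (2 * of_int m' * pi * \<i> / of_nat k)" by (subst exp_eq) blast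
  finally show ?thesis using pt_rotate by metis
qed

lemma pt_exists:
  assumes "z \<noteq> 0"
  obtains s e m where "s \<in> cstrip" "e \<in> {1, -1}" "z = pt s e m"
proof -
  define L where "L = of_nat k * Ln z"
  have z: "z = exp (L / of_nat k)" using kpos assms by (simp add: L_def)
  \<comment> \<open>\<open>j\<close> numbers the sector containing \<open>z\<close>. An odd sector
    is treated as mirror image of an even one: \<open>s\<close> is then measured backwards from the
    even ray at its end.\<close>
  define j where "j = \<lfloor>Im L / pi\<rfloor>"
  have j: "of_int j * pi \<le> Im L" "Im L < (of_int j + 1) * pi"
    using floor_divide_lower[OF pi_gt_zero] floor_divide_upper[OF pi_gt_zero] unfolding j_def by auto
  show thesis
  proof (cases "even j")
    case True
    then obtain m where m: "j = 2 * m" by blast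
    define s where "s = Complex (Re L) (Im L - 2 * pi * of_int m)"
    have "Complex (Re s) (of_int 1 * Im s + 2 * pi * of_int m) = L" by (simp add: s_def complex_eq_iff)
    then have "z = pt s 1 m" using z by (simp only: pt_def)
    moreover have "s \<in> cstrip" using j by (simp add: s_def cstrip_def m algebra_simps)
    ultimately show thesis using that by blast
  next
    case False
    then obtain m' where m': "j = 2 * m' + 1" by (blast elim: oddE)
    define m where "m = m' + 1"
    have m: "j = 2 * m - 1" by (simp add: m_def m')
    define s where "s = Complex (Re L) (2 * pi * of_int m - Im L)"
    have "Complex (Re s) (of_int (-1) * Im s + 2 * pi * of_int m) = L" by (simp add: s_def complex_eq_iff)
    then have "z = pt s (-1) m" using z by (simp only: pt_def)
    moreover have "s \<in> cstrip" using j by (simp add: s_def cstrip_def m algebra_simps)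
    ultimately show thesis using that by blast
  qed
qed

text \<open>As \<open>p\<close> is invertible modulo \<open>k\<close>, rotations by multiples of
  \<open>2 * pi / k\<close> shift the argument of \<open>F\<close> by every even number of units. So
  \<open>tau\<close> matters only modulo 2 for the existence of an
  \<open>\<alpha>\<close>-point.\<close>

lemma residue_exists: "\<exists>m n. p * m = j + int k * n"
proof -
  obtain m where "[p * m = 1] (mod int k)" using cop cong_solve_coprime_int by blast
  then have "[p * (m * j) = j] (mod int k)" using cong_mult[of "p * m" 1 "int k" j j] by (simp add: mult_ac)
  then show ?thesis by (metis cong_iff_lin cong_sym)
qed

lemma residue_cancel: "[p * m = p * m'] (mod int k) \<Longrightarrow> [m = m'] (mod int k)"
  using cop by (simp add: cong_mult_lcancel)

lemma pt_root_e: "pt s e m * root_e k j = exp (Complex (Re s) (of_int e * Im s + 2 * pi * of_int m + of_int j * pi) / of_nat k)"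
  unfolding pt_def root_e_def exp_add[symmetric]
  by (rule arg_cong[of _ _ exp]) (simp add: complex_eq_iff add_divide_distrib)

lemma exp_in_sector:
  assumes "0 < \<theta>" "\<theta> < pi"
  shows "0 < Arg (exp (Complex x \<theta> / of_nat k))" "Arg (exp (Complex x \<theta> / of_nat k)) < pi / k"
proof -
  have "\<theta> / k < pi / k" using assms kpos by (simp add: divide_strict_right_mono)
  moreover have "pi / k \<le> pi" using kpos by (simp add: divide_le_eq)
  moreover have "0 < \<theta> / k" using assms kpos by simp
  ultimately have "Arg (exp (Complex x \<theta> / of_nat k)) = \<theta> / k"
    using pi_gt_zero by (subst Arg_exp) (auto simp del: pi_gt_zero)
  then show "0 < Arg (exp (Complex x \<theta> / of_nat k))" "Arg (exp (Complex x \<theta> / of_nat k)) < pi / k"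
    using \<open>0 < \<theta> / k\<close> \<open>\<theta> / k < pi / k\<close> by auto
qed

lemma pt_sector:
  assumes "0 < Im s" "Im s < pi"
  shows "pt s 1 m \<in> open_sector k (2 * m)" "pt s (-1) m \<in> open_sector k (2 * m - 1)"
proof -
  have "pt s 1 m * root_e k (- (2 * m)) = exp (Complex (Re s) (Im s) / of_nat k)"
    unfolding pt_root_e by (simp add: algebra_simps)
  then show "pt s 1 m \<in> open_sector k (2 * m)"
    using exp_in_sector[OF assms, of "Re s"] by (simp add: open_sector_def pt_def)
  have "pt s (-1) m * root_e k (- (2 * m - 1)) = exp (Complex (Re s) (pi - Im s) / of_nat k)"
    unfolding pt_root_e by (simp add: algebra_simps)
  then show "pt s (-1) m \<in> open_sector k (2 * m - 1)"
    using exp_in_sector[of "pi - Im s" "Re s"] assms by (simp add: open_sector_def pt_def)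
qed

lemma pt_flip_top: "Im s = pi \<Longrightarrow> pt s 1 m = pt s (-1) (m + 1)"
  by (simp add: pt_def algebra_simps)

lemma pt_flip_bottom: "Im s = 0 \<Longrightarrow> pt s e m = pt s e' m"
  by (simp add: pt_def)

lemma pt_flip_interior:
  assumes "0 < Im s" "Im s < pi"
  shows "pt s 1 m \<noteq> pt s (-1) m'"
proof
  assume "pt s 1 m = pt s (-1) m'"
  then obtain n :: int where "Complex (Re s) (of_int 1 * Im s + 2 * pi * of_int m) / of_nat k =
      Complex (Re s) (of_int (-1) * Im s + 2 * pi * of_int m') / of_nat k + of_real (of_int (2 * n) * pi) * \<i>"
    unfolding pt_def exp_eq by blast
  then have "(Im s + 2 * pi * of_int m) / k = (- Im s + 2 * pi * of_int m') / k + 2 * of_int n * pi"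
    by (simp add: complex_eq_iff)
  then have "Im s = of_int (m' - m + int k * n) * pi" using kpos by (simp add: field_simps)
  then obtain N :: int where N: "Im s = of_int N * pi" by blast
  then have "0 < N" "N < 1" using assms by (auto simp: zero_less_mult_iff)
  then show False by linarith
qed

lemma pt_positive_bottom:
  assumes "Im s = 0"
  shows "0 < pt s e m * root_e k (- 2 * m)"
proof -
  have "pt s e m * root_e k (- 2 * m) = exp (Complex (Re s) 0 / of_nat k)"
    unfolding pt_root_e using assms by (simp add: algebra_simps)
  also have "\<dots> = of_real (exp (Re s / k))" by (simp add: exp_of_real[symmetric] Complex_eq)
  also have "\<dots> > 0" by (simp add: less_complex_def)
  finally show ?thesis .
qed

lemma pt_positive_top:
  assumes "Im s = pi"
  shows "0 < pt s (-1) m * root_e k (- 2 * m + 1)"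
proof -
  have "pt s (-1) m * root_e k (- 2 * m + 1) = exp (Complex (Re s) 0 / of_nat k)"
    unfolding pt_root_e using assms by (simp add: algebra_simps)
  also have "\<dots> = of_real (exp (Re s / k))" by (simp add: exp_of_real[symmetric] Complex_eq)
  also have "\<dots> > 0" by (simp add: less_complex_def)
  finally show ?thesis .
qed

section \<open>Simplicity of points and the behaviour on the boundary rays\<close>

lemma F_deriv_nz:
  assumes "F z \<noteq> 0" "dlog (z ^ k) \<noteq> 0"
  shows "deriv F z \<noteq> 0"
  using DERIV_imp_deriv[OF F_deriv[OF assms(1)]] assms kpos F_nz by auto

lemma deriv_nz_interior:
  assumes "F (pt s e m) \<noteq> 0" "0 < Im s" "Im s < pi" "e \<in> {1, -1}"
  shows "deriv F (pt s e m) \<noteq> 0"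
proof (rule F_deriv_nz[OF assms(1) dlog_nonzero])
  show "gprod c (pt s e m ^ k) \<noteq> 0" "gprod d (- (pt s e m ^ k)) \<noteq> 0" using assms(1) F_nz by auto
  have "sin (Im s) \<noteq> 0" using sin_gt_zero[OF assms(2,3)] by simp
  then show "Im (pt s e m ^ k) \<noteq> 0" unfolding pt_pow using assms(4) by (auto simp: Im_exp)
qed

lemma good_top:
  assumes "\<And>\<nu>. c \<nu> * exp x < 1"
  shows "Complex x pi \<in> good"
proof -
  have "1 + of_real (c \<nu>) * exp (Complex x pi) \<noteq> 0" for \<nu>
    using C.factor_real_line[of "Complex x pi" \<nu>] assms[of \<nu>] by (metis complex.sel eq_iff_diff_eq_0 less_irrefl of_real_eq_0_iff)
  then show ?thesis using gprod_d_nz[of "Complex x pi"] by (auto simp: good_def cstrip_def C.gprod_eq_0_iff)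
qed

lemma good_bottom:
  assumes "\<And>\<nu>. d \<nu> * exp x < 1"
  shows "Complex x 0 \<in> good"
proof -
  have "1 + of_real (d \<nu>) * exp (Complex x pi) \<noteq> 0" for \<nu>
    using D.factor_real_line[of "Complex x pi" \<nu>] assms[of \<nu>] by (metis complex.sel eq_iff_diff_eq_0 less_irrefl of_real_eq_0_iff)
  then have "gprod d (exp (Complex x pi)) \<noteq> 0" by (auto simp: D.gprod_eq_0_iff)
  moreover have "Complex x pi = refl_strip (Complex x 0)" by (simp add: complex_eq_iff)
  ultimately have "gprod d (- exp (Complex x 0)) \<noteq> 0" using gprod_d_refl by auto
  then show ?thesis using gprod_c_nz[of "Complex x 0"] by (auto simp: good_def cstrip_def)
qed

text \<open>Where the argument has the constant value \<open>v\<close>,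
  \<open>exp (Re (phi s))\<close> is \<open>F\<close> times \<open>exp (- \<i> * v)\<close>. The
  derivative of \<open>F\<close> thus suffices, and \<open>phi\<close> need not be differentiated on
  the boundary.\<close>

lemma line_deriv:
  assumes S: "open S" "x \<in> S" and g: "\<And>x. x \<in> S \<Longrightarrow> Complex x y \<in> good"
    and v: "\<And>x. x \<in> S \<Longrightarrow> Im (phi (Complex x y)) = v"
  shows "((\<lambda>x. exp (Re (phi (Complex x y)))) has_real_derivative
     exp (Re (phi (Complex x y))) * Re (dlog (exp (Complex x y)))) (at x)"
proof -
  let ?H = "\<lambda>s. F (exp (s / of_nat k)) * exp (- \<i> * of_real v)"
  have e: "?H (Complex x y) = of_real (exp (Re (phi (Complex x y))))" if "x \<in> S" for x
  proof -
    have "?H (Complex x y) = exp (phi (Complex x y) - \<i> * of_real v)"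
      unfolding exp_phi[OF g[OF that], symmetric] by (simp add: exp_diff exp_minus divide_inverse)
    also have "phi (Complex x y) - \<i> * of_real v = of_real (Re (phi (Complex x y)))"
      using v[OF that] by (simp add: complex_eq_iff)
    finally show ?thesis by (simp add: exp_of_real)
  qed
  let ?s = "Complex x y"
  have Fnz: "F (exp (?s / of_nat k)) \<noteq> 0" using exp_phi[OF g[OF S(2)]] by (metis exp_not_eq_zero)
  have ek: "exp (?s / of_nat k) ^ k = exp ?s" using kpos by (simp add: exp_divide_power_eq)
  have "((\<lambda>s. F (exp (s / of_nat k))) has_field_derivative
      of_nat k * F (exp (?s / of_nat k)) / exp (?s / of_nat k) * dlog (exp (?s / of_nat k) ^ k) * (exp (?s / of_nat k) / of_nat k)) (at ?s)"
    by (rule DERIV_chain2[where f = F and g = "\<lambda>s. exp (s / of_nat k)", OF F_deriv[OF Fnz]])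
       (use kpos in \<open>auto intro!: derivative_eq_intros\<close>)
  then have "((\<lambda>s. F (exp (s / of_nat k))) has_field_derivative F (exp (?s / of_nat k)) * dlog (exp ?s)) (at ?s)"
    unfolding ek using kpos by simp
  then have "(?H has_field_derivative F (exp (?s / of_nat k)) * dlog (exp ?s) * exp (- \<i> * of_real v)) (at ?s)"
    by (rule DERIV_cmult_right)
  moreover have "((\<lambda>x. Complex x y) has_vector_derivative 1) (at x)"
    unfolding Complex_eq by (auto intro!: derivative_eq_intros)
  ultimately have "((?H \<circ> (\<lambda>x. Complex x y)) has_vector_derivative 1 * (F (exp (?s / of_nat k)) * dlog (exp ?s) * exp (- \<i> * of_real v))) (at x)"
    by (intro field_vector_diff_chain_at)
  moreover have "1 * (F (exp (?s / of_nat k)) * dlog (exp ?s) * exp (- \<i> * of_real v)) = of_real (exp (Re (phi ?s))) * dlog (exp ?s)"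
    using e[OF S(2)] by (simp add: mult_ac)
  ultimately have "((\<lambda>x. ?H (Complex x y)) has_vector_derivative of_real (exp (Re (phi ?s))) * dlog (exp ?s)) (at x)"
    by (simp only: comp_def)
  from bounded_linear.has_vector_derivative[OF bounded_linear_Re this]
  have "((\<lambda>x. Re (?H (Complex x y))) has_vector_derivative Re (of_real (exp (Re (phi ?s))) * dlog (exp ?s))) (at x)" .
  then have "((\<lambda>x. Re (?H (Complex x y))) has_real_derivative exp (Re (phi ?s)) * Re (dlog (exp ?s))) (at x)"
    by (simp add: has_real_derivative_iff_has_vector_derivative)
  then show ?thesis
    by (rule has_field_derivative_transform_within_open[OF _ S]) (simp only: e Re_complex_of_real)
qed

lemma continuous_line:
  assumes "\<And>x. x \<in> S \<Longrightarrow> Complex x y \<in> good"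
  shows "continuous_on S (\<lambda>x. exp (Re (phi (Complex x y))))"
proof -
  have "continuous_on S (\<lambda>x. phi (Complex x y))"
    by (rule continuous_on_compose2[OF continuous_phi]) (use assms in \<open>auto simp: Complex_eq intro!: continuous_intros\<close>)
  then show ?thesis by (intro continuous_intros)
qed

lemma exp_Complex_line: "exp (Complex x 0) = of_real (exp x)" "exp (Complex x pi) = - of_real (exp x)"
  by (simp_all add: complex_eq_iff Re_exp Im_exp)

text \<open>The argument \<open>pik\<close> means that no zero has been passed. So
  \<open>dlog\<close> has negative real part up to both points, and \<open>|F|\<close> cannot take
  the same value twice.\<close>

lemma top_level_unique:
  assumes \<rho>: "0 < \<rho>"
    and s: "s \<in> level \<rho>" "Im s = pi" "Im (phi s) = pik"
    and t: "t \<in> level \<rho>" "Im t = pi" "Im (phi t) = pik"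
  shows "s = t"
proof -
  have False if s: "s \<in> level \<rho>" "Im s = pi" "Im (phi s) = pik"
    and t: "t \<in> level \<rho>" "Im t = pi" "Im (phi t) = pik" and less: "Re s < Re t" for s t
  proof -
    let ?E = "\<lambda>x. exp (Re (phi (Complex x pi)))"
    have tg: "t \<in> good" using t by (simp add: level_def[OF \<rho>])
    have ct: "c \<nu> * exp (Re t) < 1" for \<nu> using Im_phi_top_0[OF tg t(2)] t(3) by blast
    have cx: "c \<nu> * exp x < 1" if "x \<le> Re t" for x \<nu> using mult_exp_less_1_mono[OF C.nonneg that ct] .
    have g: "Complex x pi \<in> good" if "x \<le> Re t" for x using cx[OF that] by (rule good_top)
    have v: "Im (phi (Complex x pi)) = pik" if "x \<le> Re t" for x
      using Im_phi_top_0[OF g[OF that]] cx[OF that] by simp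
    have "?E (Re t) < ?E (Re s)"
    proof (rule DERIV_neg_imp_decreasing_open[OF less])
      fix x assume x: "Re s < x" "x < Re t"
      have "(?E has_real_derivative ?E x * Re (dlog (exp (Complex x pi)))) (at x)"
        by (rule line_deriv[where S = "{..<Re t}" and v = pik]) (use x g v in auto)
      moreover have "Re (dlog (exp (Complex x pi))) < 0"
        unfolding exp_Complex_line using x cx by (intro dlog_neg) auto
      ultimately show "\<exists>y. DERIV ?E x :> y \<and> y < 0" by (meson exp_gt_zero mult_pos_neg)
    qed (use g in \<open>auto intro!: continuous_line\<close>)
    moreover have "Complex (Re t) pi = t" "Complex (Re s) pi = s" using s t by (simp_all add: complex_eq_iff)
    ultimately show False using s t by (simp add: level_def[OF \<rho>])
  qed
  from this[OF s t] this[OF t s] have "Re s = Re t" by (meson linorder_neqE_linordered_idom)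
  then show ?thesis using s t by (simp add: complex_eq_iff)
qed

lemma deriv_nz_top:
  assumes "F (pt s e m) \<noteq> 0" "s \<in> good" "Im s = pi" "Im (phi s) = pik" "e \<in> {1, -1}"
  shows "deriv F (pt s e m) \<noteq> 0"
proof (rule F_deriv_nz[OF assms(1)])
  have "Re (dlog (- of_real (exp (Re s)))) < 0"
    using Im_phi_top_0[OF assms(2,3)] assms(4) by (intro dlog_neg) auto
  moreover have "pt s e m ^ k = - of_real (exp (Re s))"
    unfolding pt_pow using assms(3,5) by (auto simp: complex_eq_iff Re_exp Im_exp)
  ultimately show "dlog (pt s e m ^ k) \<noteq> 0" by auto
qed

text \<open>The derivative of \<open>ln |F|\<close> on the positive ray in the variable
  \<open>x = k * ln |z|\<close>.\<close>

definition slope :: "real \<Rightarrow> real" where "slope x = Re (dlog (of_real (exp x)))"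

lemma slope_mono:
  assumes "x < x'" "\<And>\<nu>. d \<nu> * exp x' < 1"
  shows "slope x < slope x'"
proof -
  have "c 0 * exp x < c 0 * exp x'" using c0 assms by simp
  moreover have "u / (1 + u) < v / (1 + v)" if "0 < u" "u < v" for u v :: real
    using that by (simp add: field_simps)
  ultimately have "c 0 * exp x / (1 + c 0 * exp x) < c 0 * exp x' / (1 + c 0 * exp x')" using c0 by simp
  then show ?thesis using dlog_real_incr[of "exp x" "exp x'"] assms by (simp add: slope_def)
qed

text \<open>On this line the argument is \<open>pi\<close> times the number of poles passed. The
  last condition therefore restricts to level points before the first pole.\<close>

definition bottom0 :: "real \<Rightarrow> complex \<Rightarrow> bool" where
  "bottom0 \<rho> s \<longleftrightarrow> s \<in> level \<rho> \<and> Im s = 0 \<and> Im (phi s) = 0"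

lemma bottom0D:
  assumes "0 < \<rho>" "bottom0 \<rho> s"
  shows "s \<in> level \<rho>" "s \<in> good" "Complex (Re s) 0 = s" "d \<nu> * exp (Re s) < 1"
    "exp (Re (phi s)) = \<rho>" "Im s = 0" "Im (phi s) = 0"
  using assms Im_phi_bottom_0[of s]
  by (auto simp: bottom0_def level_def[OF assms(1)] complex_eq_iff)

lemma below_bottom:
  assumes "\<And>\<nu>. d \<nu> * exp X < 1" "x \<le> X"
  shows "d \<nu> * exp x < 1" "Complex x 0 \<in> good" "Im (phi (Complex x 0)) = 0"
proof -
  show *: "d \<nu> * exp x < 1" for \<nu> using mult_exp_less_1_mono[OF D.nonneg assms(2,1)] .
  show g: "Complex x 0 \<in> good" using * by (rule good_bottom)
  show "Im (phi (Complex x 0)) = 0" using Im_phi_bottom_0[OF g] * by simp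
qed

lemma bottom_deriv:
  assumes "\<And>\<nu>. d \<nu> * exp X < 1" "x < X"
  shows "((\<lambda>x. exp (Re (phi (Complex x 0)))) has_real_derivative
     exp (Re (phi (Complex x 0))) * slope x) (at x)"
  using line_deriv[of "{..<X}" x 0 0] below_bottom[OF assms(1)] assms(2)
  by (auto simp: exp_Complex_line slope_def)

lemma bottom0_rolle:
  assumes \<rho>: "0 < \<rho>" and st: "bottom0 \<rho> s" "bottom0 \<rho> t" "Re s < Re t"
  obtains x where "Re s < x" "x < Re t" "slope x = 0"
proof -
  let ?E = "\<lambda>x. exp (Re (phi (Complex x 0)))"
  note s = bottom0D[OF \<rho> st(1)] and t = bottom0D[OF \<rho> st(2)]
  have "\<exists>x. Re s < x \<and> x < Re t \<and> (\<lambda>h. h * (?E x * slope x)) = (\<lambda>v. 0)"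
  proof (rule Rolle_deriv[OF st(3)])
    show "?E (Re s) = ?E (Re t)" using s t by simp
    show "continuous_on {Re s..Re t} ?E"
      using below_bottom(2)[OF t(4)] by (intro continuous_line) auto
    show "(?E has_derivative (\<lambda>h. h * (?E x * slope x))) (at x)" if "Re s < x" "x < Re t" for x
      using bottom_deriv[OF t(4) that(2)] by (simp add: has_field_derivative_def mult.commute[of _ "_ * _"] mult_commute_abs)
  qed
  then obtain x where "Re s < x" "x < Re t" "(\<lambda>h. h * (?E x * slope x)) = (\<lambda>v. 0)" by blast
  then show thesis using that fun_cong[of _ _ 1] by fastforce
qed

text \<open>By Rolle the increasing slope vanishes between the two points. It follows that there are
  never three such points: the middle one would have slopes of both signs.\<close>

lemma bottom0_slopes:
  assumes \<rho>: "0 < \<rho>" and st: "bottom0 \<rho> s" "bottom0 \<rho> t" "Re s < Re t"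
  shows "slope (Re s) < 0" "0 < slope (Re t)"
proof -
  note t = bottom0D[OF \<rho> st(2)]
  obtain x where x: "Re s < x" "x < Re t" "slope x = 0" by (rule bottom0_rolle[OF assms])
  show "slope (Re s) < 0"
    using slope_mono[OF x(1)] x below_bottom(1)[OF t(4), of x] by (simp add: less_imp_le)
  show "0 < slope (Re t)" using slope_mono[OF x(2) t(4)] x by simp
qed

text \<open>Infinitely many strict inequalities survive a small increase of \<open>x\<close>: those
  of large index hold up to \<open>x + 1\<close> because \<open>d\<close> tends to 0, and only
  finitely many remain.\<close>

lemma bound_extend:
  assumes "\<And>\<nu>. d \<nu> * exp x < 1"
  obtains X where "x < X" "\<And>\<nu>. d \<nu> * exp X < 1"
proof -
  obtain N where N: "\<And>n. N \<le> n \<Longrightarrow> d n * exp (x + 1) < 1 / 2"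
    using D.eventually_small[of "exp (x + 1)"] by (auto simp: eventually_sequentially)
  have "\<forall>\<^sub>F X in at_right x. d n * exp X < 1" for n
  proof -
    have "((\<lambda>X. d n * exp X) \<longlongrightarrow> d n * exp x) (at_right x)" by (intro tendsto_intros)
    then show ?thesis using assms by (rule order_tendstoD)
  qed
  then have "\<forall>\<^sub>F X in at_right x. \<forall>n\<in>{..<N}. d n * exp X < 1"
    by (intro eventually_ball_finite) auto
  moreover have "\<forall>\<^sub>F X in at_right x. x < X \<and> X < x + 1"
    by (rule eventually_at_right_real[of x "x + 1", simplified]) 
  ultimately have "\<forall>\<^sub>F X in at_right x. x < X \<and> X < x + 1 \<and> (\<forall>n\<in>{..<N}. d n * exp X < 1)"
    by eventually_elim auto
  then obtain X where X: "x < X" "X < x + 1" "\<forall>n\<in>{..<N}. d n * exp X < 1"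
    using eventually_happens[of _ "at_right x"] by (auto simp: trivial_limit_at_right_real)
  have "d n * exp X < 1" for n
  proof (cases "n < N")
    case False
    then have "d n * exp (x + 1) < 1" using N[of n] by simp
    then show ?thesis using mult_exp_less_1_mono[OF D.nonneg, of X "x + 1"] X by simp
  qed (use X in auto)
  then show thesis using that X by blast
qed

lemma excess_bottom_sgn:
  assumes \<rho>: "0 < \<rho>" and "Complex x 0 \<in> good"
  shows "excess \<rho> (Complex x 0) = 0 \<longleftrightarrow> exp (Re (phi (Complex x 0))) = \<rho>"
    "excess \<rho> (Complex x 0) < 0 \<longleftrightarrow> exp (Re (phi (Complex x 0))) < \<rho>"
  using excess_good[OF assms(2), of \<rho>] assms(2) by (auto simp: good_def mult_less_0_iff)

text \<open>If the slope is negative, \<open>|F|\<close> drops below \<open>\<rho>\<close> to the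
  right and must return, being infinite at a pole. If it is positive, \<open>|F|\<close> is below
  \<open>\<rho>\<close> on the left and must have come down from its pole at the origin.\<close>

lemma bottom0_second:
  assumes \<rho>: "0 < \<rho>" and s: "bottom0 \<rho> s" and "slope (Re s) \<noteq> 0"
  obtains t where "bottom0 \<rho> t" "Re t \<noteq> Re s"
proof -
  let ?E = "\<lambda>x. exp (Re (phi (Complex x 0)))"
  let ?h = "\<lambda>x. excess \<rho> (Complex x 0)"
  note s = bottom0D[OF \<rho> s]
  obtain X where X: "Re s < X" "\<And>\<nu>. d \<nu> * exp X < 1" by (rule bound_extend[OF s(4)]) blast
  have Es: "?E (Re s) = \<rho>" using s by simp
  have D: "(?E has_real_derivative \<rho> * slope (Re s)) (at (Re s))"
    using bottom_deriv[OF X(2,1)] Es by simp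
  show thesis
  proof (cases "slope (Re s) < 0")
    case True
    then have "\<rho> * slope (Re s) < 0" using \<rho> by (simp add: mult_pos_neg)
    from DERIV_neg_dec_right[OF D this] obtain \<delta> where \<delta>: "0 < \<delta>" "\<forall>h>0. h < \<delta> \<longrightarrow> ?E (Re s + h) < ?E (Re s)" by blast
    define h where "h = min (\<delta> / 2) (X - Re s)"
    define x3 where "x3 = Re s + h"
    have h: "0 < h" "h < \<delta>" "x3 \<le> X" using \<delta> X by (auto simp: h_def x3_def)
    then have "?E x3 < \<rho>" using \<delta>(2) Es unfolding x3_def by simp
    then have h3: "?h x3 < 0" using excess_bottom_sgn(2)[OF \<rho>] below_bottom(2)[OF X(2) h(3)] by simp
    \<comment> \<open>The pole of factor 0, perhaps not the first one. That the crossing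
      \<open>x\<close> found below precedes all poles follows from \<open>turn\<close>, which keeps
      the value 0 from \<open>x3\<close> to \<open>x\<close>.\<close>
    define xp where "xp = - ln (d 0)"
    have "1 + of_real (d 0) * (- exp (Complex xp 0)) = 0"
      using d0 by (simp add: exp_Complex_line xp_def exp_minus)
    then have "gprod d (- exp (Complex xp 0)) = 0" unfolding D.gprod_eq_0_iff by blast
    then have hp: "0 < ?h xp" unfolding excess_def using gprod_c_nz[of "Complex xp 0"] by (simp add: cstrip_def)
    have "d 0 * exp x3 < 1" using below_bottom(1)[OF X(2) h(3)] .
    then have "d 0 * exp x3 < d 0 * exp xp" using d0 by (simp add: xp_def exp_minus)
    then have "x3 \<le> xp" using d0 by simp
    obtain x where x: "x3 < x" "?h x = 0" "\<And>t. x3 \<le> t \<Longrightarrow> t \<le> x \<Longrightarrow> ?h t \<le> 0"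
    proof (rule first_zero[OF \<open>x3 \<le> xp\<close>])
      show "continuous_on {x3..xp} (\<lambda>x. - ?h x)"
        by (intro continuous_on_minus continuous_excess_line(2)[OF \<rho>])
    qed (use h3 hp in auto)
    have hz: "level_height \<rho> t = 0" if "t \<in> {x3..x}" for t
      using x(3)[of t] that level_height(1)[OF \<rho>, of t] level_height(3)[OF \<rho>, of 0 t] by force
    have lev0: "lev \<rho> t = Complex t 0" if "t \<in> {x3..x}" for t using hz[OF that] by (simp add: lev_def[OF \<rho>])
    have "turn \<rho> x = turn \<rho> x3" using x(1) hz by (intro turn_const_bottom[OF \<rho>]) auto
    also have "turn \<rho> x3 = 0"
      using lev0[of x3] x(1) below_bottom(3)[OF X(2) h(3)] by (simp add: turn_def[OF \<rho>])
    finally have "Im (phi (Complex x 0)) = 0" using lev0[of x] x(1) by (simp add: turn_def[OF \<rho>])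
    moreover have "Complex x 0 \<in> level \<rho>"
      using x(1,2) lev0[of x] by (simp add: level_iff_lev[OF \<rho>])
    ultimately have "bottom0 \<rho> (Complex x 0)" by (simp add: bottom0_def)
    then show thesis using that[of "Complex x 0"] x(1) h by (simp add: x3_def)
  next
    case False
    then have "0 < \<rho> * slope (Re s)" using \<rho> assms(3) by simp
    from DERIV_pos_inc_left[OF D this] obtain \<delta> where \<delta>: "0 < \<delta>" "\<forall>h>0. h < \<delta> \<longrightarrow> ?E (Re s - h) < ?E (Re s)" by blast
    define x3 where "x3 = Re s - \<delta> / 2"
    have x3: "x3 < Re s" "?E x3 < \<rho>" using \<delta> Es by (auto simp: x3_def)
    have below: "Complex x 0 \<in> good" "Im (phi (Complex x 0)) = 0" if "x \<le> x3" for x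
      using below_bottom(2,3)[OF s(4), of x] that x3 by auto
    have h3: "?h x3 < 0" using excess_bottom_sgn(2)[OF \<rho> below(1)] x3 by simp
    \<comment> \<open>Near the origin the excess is positive on the line \<open>Im s = pi\<close>,
      hence by \<open>excess_crossing\<close> also on \<open>Im s = 0\<close>.\<close>
    obtain Y where Y: "\<And>x. x \<le> Y \<Longrightarrow> 0 < excess \<rho> (Complex x pi)" using turn_initial[OF \<rho>] by metis
    define y where "y = min Y x3"
    have hy: "0 < ?h y"
    proof (rule ccontr)
      assume "\<not> 0 < ?h y"
      then have "excess \<rho> (Complex y pi) < 0"
        using \<rho> by (intro excess_crossing[of "Complex y 0" "Complex y pi"]) (auto simp: cstrip_def)
      then show False using Y[of y] by (simp add: y_def)
    qed
    have "y \<le> x3" by (simp add: y_def)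
    obtain x where x: "x \<le> x3" "?h x = 0"
      using first_zero[OF \<open>y \<le> x3\<close> continuous_excess_line(2)[OF \<rho>] hy] h3 by (metis less_imp_le)
    have "Complex x 0 \<in> level \<rho>"
      using x below[OF x(1)] excess_sgn(1)[OF below(1)[OF x(1)] \<rho>] by (simp add: level_def[OF \<rho>])
    then have "bottom0 \<rho> (Complex x 0)" using below[OF x(1)] by (simp add: bottom0_def)
    then show thesis using that[of "Complex x 0"] x x3 by simp
  qed
qed

end

section \<open>The points closest to the origin\<close>

text \<open>A pair omitting \<open>za\<close> or \<open>zb\<close> would contain a point that is too
  far away or a simple point twice. The order of the pair remains open because the two moduli may
  agree.\<close>

lemma closest_pair_two:
  assumes m: "alpha_mult f \<alpha> za = 1" "alpha_mult f \<alpha> zb = 1" and ne: "za \<noteq> zb" and le: "norm za \<le> norm zb"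
    and far: "\<And>w. f w = \<alpha> \<Longrightarrow> w = za \<or> w = zb \<or> norm zb < norm w"
  shows "closest_pair f \<alpha> za zb"
    and "closest_pair f \<alpha> z1 z2 \<Longrightarrow> z1 = za \<and> z2 = zb \<or> z1 = zb \<and> z2 = za"
proof -
  have pos: "f w = \<alpha>" if "0 < alpha_mult f \<alpha> w" for w
    using that by (auto simp: alpha_mult_def alpha_set_def split: if_splits)
  show "closest_pair f \<alpha> za zb"
    unfolding closest_pair_def
  proof (intro conjI allI impI)
    show "count {#za, zb#} w \<le> alpha_mult f \<alpha> w" for w using m ne by auto
    show "norm zb \<le> norm w" if "count {#za, zb#} w < alpha_mult f \<alpha> w" for w
      using far[OF pos, of w] that m ne by (auto split: if_splits)
  qed (rule le)
  assume cp: "closest_pair f \<alpha> z1 z2"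
  then have cnt: "count {#z1, z2#} w \<le> alpha_mult f \<alpha> w" "norm z1 \<le> norm z2"
    "count {#z1, z2#} w < alpha_mult f \<alpha> w \<Longrightarrow> norm z2 \<le> norm w" for w
    by (auto simp: closest_pair_def)
  have p1: "f z1 = \<alpha>" and p2: "f z2 = \<alpha>" using cnt(1)[of z1] cnt(1)[of z2] pos by (auto split: if_splits)
  have dup: False if "z1 = z2" "alpha_mult f \<alpha> z1 = 1" using cnt(1)[of z1] that by simp
  have a: "za \<in> {z1, z2}"
  proof (rule ccontr)
    assume n: "za \<notin> {z1, z2}"
    then have "norm z2 \<le> norm za" by (intro cnt(3)) (use m in auto)
    then have "z1 = zb" "z2 = zb" using far[OF p1] far[OF p2] n cnt(2) le by auto
    then show False using dup m by simp
  qed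
  have b: "zb \<in> {z1, z2}"
  proof (rule ccontr)
    assume n: "zb \<notin> {z1, z2}"
    then have "norm z2 \<le> norm zb" by (intro cnt(3)) (use m in auto)
    then have "z1 = za" "z2 = za" using far[OF p1] far[OF p2] n cnt(2) le by auto
    then show False using dup m by simp
  qed
  show "z1 = za \<and> z2 = zb \<or> z1 = zb \<and> z2 = za" using a b ne by auto
qed

lemma closest_pair_double:
  assumes m: "alpha_mult f \<alpha> za = 2" and far: "\<And>w. f w = \<alpha> \<Longrightarrow> w = za \<or> norm za < norm w"
  shows "closest_pair f \<alpha> za za" and "closest_pair f \<alpha> z1 z2 \<Longrightarrow> z1 = za \<and> z2 = za"
proof -
  have pos: "f w = \<alpha>" if "0 < alpha_mult f \<alpha> w" for w
    using that by (auto simp: alpha_mult_def alpha_set_def split: if_splits)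
  show "closest_pair f \<alpha> za za"
    unfolding closest_pair_def
  proof (intro conjI allI impI)
    show "count {#za, za#} w \<le> alpha_mult f \<alpha> w" for w using m by auto
    show "norm za \<le> norm w" if "count {#za, za#} w < alpha_mult f \<alpha> w" for w
      using far[OF pos, of w] that m by (auto split: if_splits)
  qed simp
  assume cp: "closest_pair f \<alpha> z1 z2"
  then have cnt: "count {#z1, z2#} w \<le> alpha_mult f \<alpha> w" "norm z1 \<le> norm z2"
    "count {#z1, z2#} w < alpha_mult f \<alpha> w \<Longrightarrow> norm z2 \<le> norm w" for w
    by (auto simp: closest_pair_def)
  have p: "f z1 = \<alpha>" "f z2 = \<alpha>" using cnt(1)[of z1] cnt(1)[of z2] pos by (auto split: if_splits)
  show "z1 = za \<and> z2 = za"
  proof (rule ccontr)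
    assume n: "\<not> (z1 = za \<and> z2 = za)"
    then have "count {#z1, z2#} za < alpha_mult f \<alpha> za" using m by auto
    then have "norm z2 \<le> norm za" by (rule cnt(3))
    then show False using far[OF p(1)] far[OF p(2)] n cnt(2) by auto
  qed
qed

context pf_quotient
begin

section \<open>Multiplicities of the points\<close>

lemma open_F_nz: "open {z. F z \<noteq> 0}"
proof -
  have "open {z. z \<noteq> 0 \<and> gprod c (z ^ k) \<noteq> 0 \<and> gprod d (- (z ^ k)) \<noteq> 0}"
    by (intro open_Collect_conj open_Collect_neq continuous_intros)
  then show ?thesis by (simp add: F_nz)
qed

lemma holomorphic_F: "F holomorphic_on {z. F z \<noteq> 0}"
  using F_deriv open_F_nz by (auto simp: holomorphic_on_open)

lemma alpha_mult_simple:
  assumes "F z = \<alpha>" "\<alpha> \<noteq> 0" "deriv F z \<noteq> 0"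
  shows "alpha_mult F \<alpha> z = 1"
proof -
  have "zorder (\<lambda>w. F w - \<alpha>) z = 1"
  proof (rule zorder_zero_eqI[OF _ open_F_nz])
    show "(\<lambda>w. F w - \<alpha>) holomorphic_on {z. F z \<noteq> 0}" by (intro holomorphic_intros holomorphic_F)
    have "(F has_field_derivative deriv F z) (at z)"
      using F_deriv[of z] assms DERIV_imp_deriv by force
    then have "((\<lambda>w. F w - \<alpha>) has_field_derivative deriv F z) (at z)"
      by (auto intro!: derivative_eq_intros)
    then show "(deriv ^^ nat 1) (\<lambda>w. F w - \<alpha>) z \<noteq> 0" using assms(3) by (simp add: DERIV_imp_deriv)
  qed (use assms in auto)
  then show ?thesis using assms by (simp add: alpha_mult_def alpha_set_def)
qed

lemma dlog_holomorphic: "dlog holomorphic_on {w. gprod c w \<noteq> 0 \<and> gprod d (- w) \<noteq> 0}"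
proof -
  have hc: "gprod c holomorphic_on S" "deriv (gprod c) holomorphic_on S" for S
    using C.holomorphic_gprod holomorphic_deriv[OF C.holomorphic_gprod] by (auto intro: holomorphic_on_subset)
  have u: "uminus holomorphic_on S" for S :: "complex set"
    by (rule holomorphic_on_minus[OF holomorphic_on_ident])
  have "deriv (gprod d) holomorphic_on UNIV"
    by (rule holomorphic_deriv[OF D.holomorphic_gprod open_UNIV])
  then have "(deriv (gprod d) \<circ> uminus) holomorphic_on S" for S
    by (intro holomorphic_on_compose[OF u]) (auto intro: holomorphic_on_subset)
  moreover have "(gprod d \<circ> uminus) holomorphic_on S" for S
    by (intro holomorphic_on_compose[OF u] holomorphic_on_subset[OF D.holomorphic_gprod]) auto
  ultimately have hd: "(\<lambda>w. gprod d (- w)) holomorphic_on S" "(\<lambda>w. deriv (gprod d) (- w)) holomorphic_on S" for S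
    by (auto simp: comp_def)
  show ?thesis unfolding dlog_def[abs_def] using kpos
    by (intro holomorphic_intros hc hd) auto
qed

text \<open>This bounds the multiplicity of a point on the positive ray by 2. By
  \<open>dlog_real_incr\<close> the real part of \<open>dlog\<close> grows at least as fast as the
  term of \<open>c 0\<close>, whose derivative is positive.\<close>

lemma dlog_deriv_real:
  assumes "\<And>\<nu>. d \<nu> * exp x < 1"
  obtains E where "(dlog has_field_derivative E) (at (of_real (exp x)))" "E \<noteq> 0"
proof -
  define t where "t = exp x"
  have t: "0 < t" by (simp add: t_def)
  let ?U = "{w. gprod c w \<noteq> 0 \<and> gprod d (- w) \<noteq> 0}"
  have U: "open ?U" by (intro open_Collect_conj open_Collect_neq continuous_intros)
  have tU: "of_real t \<in> ?U"
    using good_bottom[of x] assms by (auto simp: good_def exp_Complex_line t_def)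
  obtain E where E: "(dlog has_field_derivative E) (at (of_real t))"
    using dlog_holomorphic U tU by (auto simp: holomorphic_on_open)
  have "((\<lambda>u. of_real u) has_vector_derivative (1::complex)) (at t)"
    by (auto intro!: derivative_eq_intros)
  from field_vector_diff_chain_at[OF this E]
  have "((\<lambda>u. dlog (of_real u)) has_vector_derivative E) (at t)" by (simp add: comp_def)
  from bounded_linear.has_vector_derivative[OF bounded_linear_Re this]
  have D1: "((\<lambda>u. Re (dlog (of_real u))) has_real_derivative Re E) (at t)"
    by (simp add: has_real_derivative_iff_has_vector_derivative)
  have nz: "1 + c 0 * t \<noteq> 0" using c0 t by (metis add_pos_pos less_irrefl mult_pos_pos zero_less_one)
  have D2: "((\<lambda>u. c 0 * u / (1 + c 0 * u)) has_real_derivative c 0 / (1 + c 0 * t)\<^sup>2) (at t)"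
    using nz by (auto intro!: derivative_eq_intros simp: power2_eq_square field_simps)
  have D: "((\<lambda>u. Re (dlog (of_real u)) - c 0 * u / (1 + c 0 * u)) has_real_derivative Re E - c 0 / (1 + c 0 * t)\<^sup>2) (at t)"
    by (rule DERIV_diff[OF D1 D2])
  have "E \<noteq> 0"
  proof
    assume "E = 0"
    then have "Re E - c 0 / (1 + c 0 * t)\<^sup>2 < 0" using c0 nz by simp
    from DERIV_neg_dec_right[OF D this] obtain \<delta> where \<delta>: "0 < \<delta>"
      "\<And>h. 0 < h \<Longrightarrow> h < \<delta> \<Longrightarrow> Re (dlog (of_real (t + h))) - c 0 * (t + h) / (1 + c 0 * (t + h))
        < Re (dlog (of_real t)) - c 0 * t / (1 + c 0 * t)" by blast
    obtain X where X: "x < X" "\<And>\<nu>. d \<nu> * exp X < 1" by (rule bound_extend[OF assms]) blast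
    define h where "h = min (\<delta> / 2) (exp X - t)"
    have h: "0 < h" "h < \<delta>" "t + h \<le> exp X" using \<delta> X(1) by (auto simp: h_def t_def)
    have "d \<nu> * (t + h) < 1" for \<nu>
      using mult_left_mono[OF h(3) D.nonneg[of \<nu>]] X(2)[of \<nu>] by linarith
    then show False using dlog_real_incr[of t "t + h"] \<delta>(2)[OF h(1,2)] t h(1) by fastforce
  qed
  then show thesis using that E by (simp add: t_def)
qed

text \<open>\<open>slope\<close> sees only the real part, but \<open>dlog\<close> is real on the
  real axis.\<close>

lemma dlog_eq_0:
  assumes "\<And>\<nu>. d \<nu> * exp x < 1" "slope x = 0"
  shows "dlog (of_real (exp x)) = 0"
proof -
  define u where "u = exp x"
  have g: "gprod c (of_real u) \<noteq> 0" "gprod d (- of_real u) \<noteq> 0"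
    using good_bottom[of x] assms by (auto simp: good_def exp_Complex_line u_def)
  have e: "of_real (c \<nu>) * of_real u / (1 + of_real (c \<nu>) * of_real u) + of_real (d \<nu>) * of_real u / (1 - of_real (d \<nu>) * of_real u)
       = complex_of_real (c \<nu> * u / (1 + c \<nu> * u) + d \<nu> * u / (1 - d \<nu> * u))" for \<nu>
    by simp
  have "(\<lambda>\<nu>. 0) sums Im (dlog (of_real u) - of_real (of_int p / of_nat k) - of_real A * of_real u)"
    using dlog_sums[OF g] unfolding e by (simp only: sums_complex_iff Im_complex_of_real)
  then have "Im (dlog (of_real u) - of_real (of_int p / of_nat k) - of_real A * of_real u) = 0"
    by (rule sums_unique2[OF _ sums_zero])
  then show ?thesis using assms(2) by (simp add: complex_eq_iff slope_def u_def)
qed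

lemma pt_pow_bottom: "Im s = 0 \<Longrightarrow> pt s e m ^ k = of_real (exp (Re s))"
  unfolding pt_pow by (simp add: complex_eq_iff Re_exp Im_exp)

text \<open>\<open>F'\<close> is \<open>k * F z / z * dlog (z ^ k)\<close>, and here
  \<open>dlog\<close> has a zero of order one. So the first derivative vanishes and the second does
  not.\<close>

lemma alpha_mult_double:
  assumes \<rho>: "0 < \<rho>" and s: "bottom0 \<rho> s" and sl: "slope (Re s) = 0"
    and F: "F (pt s e m) = \<alpha>" "\<alpha> \<noteq> 0"
  shows "alpha_mult F \<alpha> (pt s e m) = 2"
proof -
  note s' = bottom0D[OF \<rho> s]
  define z where "z = pt s e m"
  have zk: "z ^ k = of_real (exp (Re s))" unfolding z_def using s' by (intro pt_pow_bottom)
  have Fz: "F z \<noteq> 0" "F z = \<alpha>" using F by (auto simp: z_def)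
  have z0: "z \<noteq> 0" using Fz F_nz by blast
  have dl0: "dlog (z ^ k) = 0" unfolding zk by (rule dlog_eq_0[OF s'(4) sl])
  obtain E where E: "(dlog has_field_derivative E) (at (z ^ k))" "E \<noteq> 0"
    unfolding zk by (rule dlog_deriv_real[OF s'(4)]) blast
  let ?W = "{z. F z \<noteq> 0}"
  have d1: "deriv (\<lambda>w. F w - \<alpha>) v = of_nat k * F v / v * dlog (v ^ k)" if "v \<in> ?W" for v
    using that by (intro DERIV_imp_deriv) (auto intro!: derivative_eq_intros F_deriv)
  have "((\<lambda>v. of_nat k * F v / v) has_field_derivative
      (of_nat k * (of_nat k * F z / z * dlog (z ^ k)) * z - of_nat k * F z * 1) / (z * z)) (at z)"
    by (intro DERIV_divide DERIV_cmult F_deriv DERIV_ident Fz z0)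
  moreover have "((\<lambda>v. dlog (v ^ k)) has_field_derivative E * (of_nat k * z ^ (k - 1))) (at z)"
    by (rule DERIV_chain2[where f = dlog and g = "\<lambda>v. v ^ k", OF E(1)]) (auto intro!: derivative_eq_intros)
  ultimately have "((\<lambda>v. of_nat k * F v / v * dlog (v ^ k)) has_field_derivative
      (of_nat k * (of_nat k * F z / z * dlog (z ^ k)) * z - of_nat k * F z * 1) / (z * z) * dlog (z ^ k)
       + E * (of_nat k * z ^ (k - 1)) * (of_nat k * F z / z)) (at z)"
    by (rule DERIV_mult)
  then have "((\<lambda>v. of_nat k * F v / v * dlog (v ^ k)) has_field_derivative
      E * (of_nat k * z ^ (k - 1)) * (of_nat k * F z / z)) (at z)" unfolding dl0 by simp
  then have "(deriv (\<lambda>w. F w - \<alpha>) has_field_derivative E * (of_nat k * z ^ (k - 1)) * (of_nat k * F z / z)) (at z)"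
    by (rule has_field_derivative_transform_within_open[OF _ open_F_nz]) (use Fz d1 in auto)
  then have d2: "deriv (deriv (\<lambda>w. F w - \<alpha>)) z \<noteq> 0"
    using E(2) z0 Fz kpos by (simp add: DERIV_imp_deriv)
  have "zorder (\<lambda>w. F w - \<alpha>) z = 2"
  proof (rule zorder_zero_eqI[OF _ open_F_nz])
    show "(\<lambda>w. F w - \<alpha>) holomorphic_on ?W" by (intro holomorphic_intros holomorphic_F)
    show "(deriv ^^ i) (\<lambda>w. F w - \<alpha>) z = 0" if "i < nat 2" for i
    proof -
      have "i = 0 \<or> i = 1" using that by auto
      then show ?thesis using d1[of z] dl0 Fz by auto
    qed
    show "(deriv ^^ nat 2) (\<lambda>w. F w - \<alpha>) z \<noteq> 0" using d2 by (simp add: numeral_2_eq_2)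
  qed (use Fz in auto)
  then show ?thesis using F by (simp add: alpha_mult_def alpha_set_def z_def)
qed

section \<open>Arguments in units of \<open>pi / k\<close> and the
  \<open>\<alpha>\<close>-points\<close>

lemma Im_phi_tau: "Im (phi s) = tau s * (pi / k)"
  using kpos by (simp add: tau_def)

lemma tau_ge: "s \<in> good \<Longrightarrow> of_int p \<le> tau s"
  using Im_phi_ge(2)[of s] kpos by (simp add: tau_def field_simps)

lemma tau_bottom:
  assumes "s \<in> good" "Im s = 0"
  obtains N :: nat where "tau s = of_nat N * of_nat k"
proof -
  obtain N :: nat where "Im (phi s) = of_nat N * pi" by (rule Im_phi_bottom[OF assms])
  then have "tau s = of_nat N * of_nat k" by (simp add: tau_def)
  then show thesis using that by blast
qed

lemma tau_top:
  assumes "s \<in> good" "Im s = pi"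
  obtains N :: nat where "tau s = of_int p + of_nat N * of_nat k"
proof -
  obtain N :: nat where "Im (phi s) = pik + of_nat N * pi" by (rule Im_phi_top[OF assms])
  then have "tau s = of_int p + of_nat N * of_nat k" using kpos by (simp add: tau_def field_simps)
  then show thesis using that by blast
qed

context
  fixes \<rho> b :: real and \<alpha> :: complex
  assumes \<rho>: "0 < \<rho>" and \<alpha>: "\<alpha> = of_real \<rho> * exp (\<i> * of_real (b * pi / of_nat k))"
begin

lemma alpha_nz: "\<alpha> \<noteq> 0" using \<rho> \<alpha> by simp

lemma level_good: "s \<in> level \<rho> \<Longrightarrow> s \<in> good" by (simp add: level_def[OF \<rho>])

lemma level_cstrip: "s \<in> level \<rho> \<Longrightarrow> s \<in> cstrip" using level_good good_cstrip by blast

lemma alpha_pt_iff: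
  assumes "s \<in> cstrip" "e \<in> {1, -1}"
  shows "F (pt s e m) = \<alpha> \<longleftrightarrow>
    s \<in> level \<rho> \<and> (\<exists>n::int. of_int e * tau s + 2 * of_int (p * m) = b + 2 * of_nat k * of_int n)"
  unfolding \<alpha> by (rule alpha_pt[OF assms \<rho>])

lemma alpha_point_obtain:
  assumes "F z = \<alpha>"
  obtains s e m where "s \<in> level \<rho>" "e \<in> {1, -1}" "z = pt s e m" "target b (tau s)"
proof -
  have "z \<noteq> 0" using assms alpha_nz F_nz by metis
  then obtain s e m where s: "s \<in> cstrip" "e \<in> {1, -1}" "z = pt s e m" by (rule pt_exists)
  then obtain n :: int where n: "s \<in> level \<rho>" "of_int e * tau s + 2 * of_int (p * m) = b + 2 * of_nat k * of_int n"
    using assms alpha_pt_iff by blast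
  have "of_int e * tau s = b + 2 * of_int (int k * n - p * m)" using n(2) by (simp add: algebra_simps)
  then show thesis using that s n(1) unfolding target_def by blast
qed

lemma alpha_point_exists:
  assumes "s \<in> level \<rho>" "e \<in> {1, -1}" "of_int e * tau s = b + 2 * of_int j"
  obtains m where "F (pt s e m) = \<alpha>"
proof -
  obtain m n where mn: "p * m = - j + int k * n" using residue_exists by blast
  have "of_int e * tau s + 2 * of_int (p * m) = b + 2 * of_nat k * of_int n"
    unfolding assms(3) mn by (simp add: algebra_simps)
  then show thesis using that alpha_pt_iff[OF level_cstrip[OF assms(1)] assms(2)] assms(1) by blast
qed

text \<open>Two admissible rotations satisfy \<open>p * m \<equiv> p * m'\<close> modulo
  \<open>k\<close>, and \<open>p\<close> can be cancelled. A level point thus yields at most one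
  \<open>\<alpha>\<close>-point for each sign \<open>e\<close>.\<close>

lemma alpha_point_cong:
  assumes "s \<in> cstrip" "e \<in> {1, -1}" "F (pt s e m) = \<alpha>" "F (pt s e m') = \<alpha>"
  shows "pt s e m = pt s e m'"
proof -
  obtain n :: int where n: "of_int e * tau s + 2 * of_int (p * m) = b + 2 * of_nat k * of_int n"
    using assms(3) unfolding alpha_pt_iff[OF assms(1,2)] by blast
  obtain n' :: int where n': "of_int e * tau s + 2 * of_int (p * m') = b + 2 * of_nat k * of_int n'"
    using assms(4) unfolding alpha_pt_iff[OF assms(1,2)] by blast
  from n n' have "2 * real_of_int (p * m) = 2 * of_int (p * m') + (2 * of_nat k * of_int n - 2 * of_nat k * of_int n')"
    by linarith
  then have "real_of_int (2 * (p * m)) = of_int (2 * (p * m' + int k * (n - n')))" by (simp add: algebra_simps)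
  then have "2 * (p * m) = 2 * (p * m' + int k * (n - n'))" by (simp only: of_int_eq_iff)
  then have "p * m = p * m' + int k * (n - n')" by (simp only: mult_cancel_left) simp
  then have "p * m - p * m' = int k * (n - n')" by linarith
  then have "[p * m = p * m'] (mod int k)" unfolding cong_iff_dvd_diff by (metis dvd_triv_left)
  then show ?thesis by (rule pt_cong[OF residue_cancel])
qed

lemma level_eqI: "s \<in> level \<rho> \<Longrightarrow> t \<in> level \<rho> \<Longrightarrow> Re s = Re t \<Longrightarrow> s = t"
  using level_point_unique by (simp add: level_def[OF \<rho>])

lemma tau_mono:
  assumes "s \<in> level \<rho>" "t \<in> level \<rho>" "Re s < Re t"
  shows "tau s \<le> tau t"
proof -
  have "Im (phi s) \<le> Im (phi t)" using assms by (intro Im_phi_mono_on_level) (auto simp: level_def[OF \<rho>])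
  then show ?thesis using kpos by (simp add: tau_def divide_right_mono mult_right_mono)
qed

lemma tau_less: "s \<in> level \<rho> \<Longrightarrow> t \<in> level \<rho> \<Longrightarrow> tau s < tau t \<Longrightarrow> Re s < Re t"
  using tau_mono[of t s] level_eqI[of s t] by fastforce

text \<open>An interior point is transversal to every other point, so the strict inequality on the
  level set applies. On a boundary line several level points may share a value, which is the origin
  of the exceptional case.\<close>

lemma tau_interior_unique:
  assumes "s \<in> level \<rho>" "t \<in> level \<rho>" "0 < Im s" "Im s < pi" "tau s = tau t"
  shows "s = t"
proof (rule ccontr)
  assume ne: "s \<noteq> t"
  have eq: "Im (phi s) = Im (phi t)" using assms(5) by (simp add: Im_phi_tau)
  have "transversal s t" "transversal t s" using ne assms(3,4) by (auto simp: transversal_def)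
  then have "\<not> Re s < Re t" "\<not> Re t < Re s"
    using Im_phi_increasing_on_level[of s t] Im_phi_increasing_on_level[of t s] assms(1,2) eq
    by (auto simp: level_def[OF \<rho>])
  then show False using level_eqI[OF assms(1,2)] ne by linarith
qed

lemma reach_tau:
  assumes "s \<in> level \<rho>" "of_int p < t" "t \<le> tau s"
  obtains s' where "s' \<in> level \<rho>" "Re s' \<le> Re s" "tau s' = t"
proof -
  have "pik < t * (pi / k)" using assms kpos by (simp add: field_simps)
  moreover have "t * (pi / k) \<le> Im (phi s)" unfolding Im_phi_tau using assms kpos by (intro mult_right_mono) auto
  ultimately obtain s' where s': "s' \<in> level \<rho>" "Re s' \<le> Re s" "Im (phi s') = t * (pi / k)"
    using reach[OF \<rho> assms(1)] by blast
  then show thesis using that kpos by (simp add: tau_def)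
qed

text \<open>If an \<open>\<alpha>\<close>-point has the argument of \<open>z0\<close>, then \<open>tau\<close> exceeds \<open>tau s0\<close> by a positive multiple of
  \<open>2 * k\<close> there; so the intermediate value \<open>t1\<close> has been attained before, at another \<open>\<alpha>\<close>-point.\<close>

lemma first_level_point_closest:
  assumes s0: "s0 \<in> level \<rho>"
    and min: "\<And>s. s \<in> level \<rho> \<Longrightarrow> target b (tau s) \<Longrightarrow> tau s0 \<le> tau s"
    and uniq: "\<And>s. s \<in> level \<rho> \<Longrightarrow> tau s = tau s0 \<Longrightarrow> s = s0"
    and form: "\<And>e m. e \<in> {1, -1} \<Longrightarrow> F (pt s0 e m) = \<alpha> \<Longrightarrow> \<exists>m'. pt s0 e m = pt s0 e0 m'"
    and e0: "e0 \<in> {1, -1}" "of_int e0 * tau s0 = b + 2 * of_int j0"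
    and t1: "tau s0 < t1" "t1 < tau s0 + 2 * real k" "e1 \<in> {1, -1}" "of_int e1 * t1 = b + 2 * of_int j1"
    and simple: "\<And>m. F (pt s0 e0 m) = \<alpha> \<Longrightarrow> deriv F (pt s0 e0 m) \<noteq> 0"
  shows "\<exists>!z0. closest_alpha_point F \<alpha> z0"
    and "closest_alpha_point F \<alpha> z0 \<Longrightarrow> simple_point F z0 \<and>
       (\<forall>w. succeeding_alpha_point F \<alpha> z0 w \<longrightarrow> Arg w \<noteq> Arg z0 \<and> norm w \<noteq> norm z0) \<and>
       (\<exists>m. z0 = pt s0 e0 m \<and> F z0 = \<alpha>)"
proof -
  obtain m0 where m0: "F (pt s0 e0 m0) = \<alpha>" by (rule alpha_point_exists[OF s0 e0])
  let ?z = "pt s0 e0 m0"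
  have other: "w = ?z \<or> norm ?z < norm w" if w: "F w = \<alpha>" for w
  proof -
    obtain s e m where s: "s \<in> level \<rho>" "e \<in> {1, -1}" "w = pt s e m" "target b (tau s)"
      by (rule alpha_point_obtain[OF w])
    show ?thesis
    proof (cases "s = s0")
      case True
      then obtain m' where "w = pt s0 e0 m'" using form s w by blast
      then show ?thesis using alpha_point_cong[OF level_cstrip[OF s0] e0(1) _ m0] w by blast
    next
      case False
      then have "tau s0 < tau s" using min[OF s(1,4)] uniq[OF s(1)] by force
      then have "Re s0 < Re s" using tau_less s0 s(1) by blast
      then have "norm ?z < norm w" unfolding s(3) by (simp only: norm_pt_less)
      then show ?thesis by blast
    qed
  qed
  have cl: "closest_alpha_point F \<alpha> z \<longleftrightarrow> z = ?z" for z
  proof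
    assume "closest_alpha_point F \<alpha> z"
    then have "F z = \<alpha>" "norm z \<le> norm ?z" using m0 by (auto simp: closest_alpha_point_def alpha_set_def)
    then show "z = ?z" using other by force
  next
    assume "z = ?z"
    then show "closest_alpha_point F \<alpha> z"
      using m0 other by (force simp: closest_alpha_point_def alpha_set_def)
  qed
  then show "\<exists>!z0. closest_alpha_point F \<alpha> z0" by simp
  assume "closest_alpha_point F \<alpha> z0"
  then have z0: "z0 = ?z" using cl by blast
  have "Arg w \<noteq> Arg z0 \<and> norm w \<noteq> norm z0" if suc: "succeeding_alpha_point F \<alpha> z0 w" for w
  proof -
    have w: "F w = \<alpha>" "w \<noteq> ?z" "\<And>u. F u = \<alpha> \<Longrightarrow> u \<noteq> ?z \<Longrightarrow> norm w \<le> norm u"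
      using suc unfolding z0 by (auto simp: succeeding_alpha_point_def alpha_set_def)
    have less: "norm ?z < norm w" using other w by blast
    have "Arg w \<noteq> Arg ?z"
    proof
      assume eq: "Arg w = Arg ?z"
      define x where "x = k * ln (norm w)"
      have wn0: "w \<noteq> 0" using less norm_ge_zero[of ?z] by (auto simp del: norm_pt)
      have zn0: "?z \<noteq> 0" by (simp add: pt_def)
      \<comment> \<open>Having the argument of \<open>?z\<close>, the point \<open>w\<close> is a
        positive multiple of it. So it comes from the same height, sign and rotation at another
        abscissa.\<close>
      define s where "s = Complex x (Im s0)"
      have "w = of_real (norm w) * exp (\<i> * Arg w)" using Arg_eq[OF wn0] .
      also have "\<dots> = of_real (norm w / norm ?z) * (of_real (norm ?z) * exp (\<i> * Arg ?z))"
        using zn0 by (simp add: eq del: norm_pt)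
      also have "of_real (norm ?z) * exp (\<i> * Arg ?z) = ?z" using Arg_eq[OF zn0] by simp
      also have "norm w / norm ?z = exp ((x - Re s0) / k)"
        using wn0 kpos by (simp add: x_def diff_divide_distrib exp_diff)
      also have "of_real (exp ((x - Re s0) / k)) * ?z = pt s e0 m0"
        unfolding pt_def exp_of_real[symmetric] exp_add[symmetric]
        by (rule arg_cong[of _ _ exp]) (simp add: s_def complex_eq_iff diff_divide_distrib)
      finally have ws: "w = pt s e0 m0" .
      have "s \<in> cstrip" using level_cstrip[OF s0] by (simp add: s_def cstrip_def)
      then obtain n :: int where n: "s \<in> level \<rho>" "of_int e0 * tau s + 2 * of_int (p * m0) = b + 2 * of_nat k * of_int n"
        using w(1) unfolding ws using alpha_pt_iff e0(1) by blast
      obtain n0 :: int where n0: "of_int e0 * tau s0 + 2 * of_int (p * m0) = b + 2 * of_nat k * of_int n0"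
        using m0 alpha_pt_iff[OF level_cstrip[OF s0] e0(1)] by blast
      have ts: "target b (tau s)"
      proof -
        have "of_int e0 * tau s = b + 2 * of_int (int k * n - p * m0)" using n(2) by (simp add: algebra_simps)
        then show ?thesis unfolding target_def using e0(1) by blast
      qed
      have "s \<noteq> s0" using less unfolding ws by auto
      then have gt: "tau s0 < tau s" using min[OF n(1) ts] uniq[OF n(1)] by force
      \<comment> \<open>Sign and rotation agree, so the difference of the two conditions is a whole
        number of turns.\<close>
      have "of_int e0 * (tau s - tau s0) = 2 * of_nat k * of_int (n - n0)" using n(2) n0 by (simp add: algebra_simps)
      then have "tau s - tau s0 = 2 * of_nat k * of_int (e0 * (n - n0))" using e0(1) by (auto simp: algebra_simps)
      then obtain N :: int where N: "tau s - tau s0 = 2 * of_nat k * of_int N" by blast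
      have "0 < 2 * real k * of_int N" using gt N by linarith
      then have "1 \<le> real_of_int N" using kpos by (simp add: zero_less_mult_iff)
      then have "2 * real k * 1 \<le> 2 * real k * of_int N" by (intro mult_left_mono) auto
      then have "t1 < tau s" using t1(2) N by linarith
      moreover have "of_int p < t1" using tau_ge[OF level_good[OF s0]] t1(1) by linarith
      ultimately obtain s' where s': "s' \<in> level \<rho>" "Re s' \<le> Re s" "tau s' = t1"
        using reach_tau[OF n(1), of t1] by (metis less_imp_le)
      have "Re s0 < Re s'" using tau_less[OF s0 s'(1)] s'(3) t1(1) by simp
      have "Re s' \<noteq> Re s" using level_eqI[OF s'(1) n(1)] s'(3) \<open>t1 < tau s\<close> by auto
      obtain m where m: "F (pt s' e1 m) = \<alpha>"
        using alpha_point_exists[OF s'(1) t1(3)] s'(3) t1(4) by metis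
      have "norm ?z < norm (pt s' e1 m)" using \<open>Re s0 < Re s'\<close> by (simp only: norm_pt_less)
      moreover have "norm (pt s' e1 m) < norm w"
        unfolding ws using s'(2) \<open>Re s' \<noteq> Re s\<close> by (simp only: norm_pt_less)
      moreover from calculation(1) have "pt s' e1 m \<noteq> ?z" by (metis less_irrefl)
      ultimately show False using w(3)[OF m] by linarith
    qed
    then show ?thesis using less unfolding z0 by simp
  qed
  moreover have "simple_point F z0" using simple[OF m0] unfolding z0 simple_point_def .
  ultimately show "simple_point F z0 \<and>
       (\<forall>w. succeeding_alpha_point F \<alpha> z0 w \<longrightarrow> Arg w \<noteq> Arg z0 \<and> norm w \<noteq> norm z0) \<and>
       (\<exists>m. z0 = pt s0 e0 m \<and> F z0 = \<alpha>)" using z0 m0 by blast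
qed

lemma interior_of_nonint:
  assumes "s \<in> good" "tau s \<notin> \<int>"
  shows "0 < Im s" "Im s < pi"
proof -
  have b: "0 \<le> Im s" "Im s \<le> pi" using assms by (auto simp: good_def cstrip_def)
  have "Im s \<noteq> 0"
  proof
    assume "Im s = 0"
    then obtain N :: nat where "tau s = of_nat N * of_nat k" by (rule tau_bottom[OF assms(1)])
    then show False using assms(2) by simp
  qed
  moreover have "Im s \<noteq> pi"
  proof
    assume "Im s = pi"
    then obtain N :: nat where "tau s = of_int p + of_nat N * of_nat k" by (rule tau_top[OF assms(1)])
    then show False using assms(2) by simp
  qed
  ultimately show "0 < Im s" "Im s < pi" using b by auto
qed

lemma not_Ints_between: "of_int B < (t::real) \<Longrightarrow> t < of_int B + 1 \<Longrightarrow> t \<notin> \<int>"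
  by (auto elim!: Ints_cases)

text \<open>Exactly one number congruent to \<open>b\<close> or \<open>- b\<close> modulo 2 lies
  between \<open>p\<close> and \<open>p + 1\<close>, and \<open>tau\<close> is at least
  \<open>p\<close>, so this is the first target attained. The parity of \<open>p - B\<close> decides
  which sign occurs, hence whether the point lies in an even or an odd sector.\<close>

lemma closest_open_sector:
  assumes B: "of_int B < b" "b < of_int B + 1" and ne: "F z = \<alpha>"
  shows "\<exists>!z0. closest_alpha_point F \<alpha> z0"
    and "closest_alpha_point F \<alpha> z0 \<Longrightarrow> simple_point F z0 \<and>
       (\<forall>w. succeeding_alpha_point F \<alpha> z0 w \<longrightarrow> Arg w \<noteq> Arg z0 \<and> norm w \<noteq> norm z0) \<and>
       (\<exists>m n. (even (p - B) \<longrightarrow> 2 * (p * m) = B - p + 2 * int k * n \<and> z0 \<in> open_sector k (2 * m)) \<and>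
          (odd (p - B) \<longrightarrow> 2 * (p * m) = B + 1 + p + 2 * int k * n \<and> z0 \<in> open_sector k (2 * m - 1)))"
proof -
  define e0 :: int where "e0 = (if even (p - B) then 1 else -1)"
  \<comment> \<open>\<open>b\<close> is moved from the interval above \<open>B\<close> to the one
    above \<open>p\<close>: by an even translation if the parities of \<open>p\<close> and
    \<open>B\<close> agree, otherwise by a reflection.\<close>
  define t0 :: real where "t0 = (if even (p - B) then b - of_int B + of_int p else of_int B + 1 + of_int p - b)"
  have e0: "e0 \<in> {1, -1}" by (simp add: e0_def)
  have t0: "of_int p < t0" "t0 < of_int p + 1" using B by (auto simp: t0_def)
  obtain j0 where j0: "of_int e0 * t0 = b + 2 * of_int j0"
  proof (cases "even (p - B)")
    case True
    then obtain j where "p - B = 2 * j" by blast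
    then have "real_of_int (p - B) = 2 * of_int j" by simp
    then show thesis using that[of j] True by (simp add: e0_def t0_def)
  next
    case False
    then have "even (p + B + 1)" by simp
    then obtain j where "p + B + 1 = 2 * j" by blast
    then have "real_of_int (p + B + 1) = 2 * of_int j" by simp
    then show thesis using that[of "- j"] False by (simp add: e0_def t0_def)
  qed
  have tmin: "t0 \<le> t" if t: "target b t" "of_int p \<le> t" for t
  proof -
    obtain e j where ej: "e \<in> {1, -1}" "of_int e * t = b + 2 * of_int j" using t(1) by (auto simp: target_def)
    have "of_int e * t = of_int e0 * t0 + 2 * of_int (j - j0)" using ej(2) j0 by simp
    then have "t = of_int (e * e0) * t0 + 2 * of_int (e * (j - j0))" using ej(1) by auto
    moreover have "e * e0 = 1 \<or> e * e0 = - 1" using ej(1) e0 by auto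
    ultimately have "t = t0 + 2 * of_int (e * (j - j0)) \<or> t = - t0 + 2 * of_int (e * (j - j0))"
      by (elim disjE) (simp_all only: of_int_1 of_int_minus mult_1_left mult_minus1 simp_thms)
    then obtain i :: int where "t = t0 + 2 * of_int i \<or> t = - t0 + 2 * of_int i" by blast
    then show ?thesis
    proof
      assume i: "t = t0 + 2 * of_int i"
      have "real_of_int (- 1) < of_int i" using i t(2) t0 by simp
      then have "0 \<le> i" by (simp only: of_int_less_iff)
      then show ?thesis using i by simp
    next
      assume i: "t = - t0 + 2 * of_int i"
      have "real_of_int p < of_int i" using i t(2) t0 by linarith
      then have "real_of_int (p + 1) \<le> of_int i" by (simp only: of_int_less_iff of_int_le_iff)
      then show ?thesis using i t0 by simp
    qed
  qed
  obtain s e m where s: "s \<in> level \<rho>" "target b (tau s)" using alpha_point_obtain[OF ne] by metis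
  have "t0 \<le> tau s" using tmin[OF s(2) tau_ge[OF level_good[OF s(1)]]] .
  then obtain s0 where s0: "s0 \<in> level \<rho>" "tau s0 = t0" using reach_tau[OF s(1) t0(1)] by metis
  have int: "0 < Im s0" "Im s0 < pi"
    using interior_of_nonint[OF level_good[OF s0(1)]] not_Ints_between t0 s0(2) by auto
  \<comment> \<open>If both signs gave \<open>\<alpha>\<close>-points at \<open>s0\<close>, then
    \<open>2 * b\<close> would be an even integer, whereas \<open>b\<close> lies strictly between
    two integers.\<close>
  have form: "\<exists>m'. pt s0 e m = pt s0 e0 m'" if e: "e \<in> {1, -1}" and Fe: "F (pt s0 e m) = \<alpha>" for e m
  proof (cases "e = e0")
    case False
    then have "e = - e0" using e e0 by auto
    moreover obtain n :: int where "of_int e * tau s0 + 2 * of_int (p * m) = b + 2 * of_nat k * of_int n"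
      using Fe alpha_pt_iff[OF level_cstrip[OF s0(1)] e] by blast
    ultimately have "2 * b = of_int (2 * (p * m - int k * n - j0))" using j0 s0(2) by (simp add: algebra_simps)
    then have "b = of_int (p * m - int k * n - j0)" by simp
    then show ?thesis using not_Ints_between[OF B] Ints_of_int by blast
  qed blast
  \<comment> \<open>The next target: the mirror image of \<open>t0\<close> at \<open>p + 1\<close>,
    reached with the opposite sign. It is less than 2 above \<open>t0\<close>.\<close>
  let ?t1 = "2 * (of_int p + 1) - t0"
  have min: "tau s0 \<le> tau s" if "s \<in> level \<rho>" "target b (tau s)" for s
    using tmin[OF that(2) tau_ge[OF level_good[OF that(1)]]] s0(2) by simp
  have uniq: "s = s0" if "s \<in> level \<rho>" "tau s = tau s0" for s
    using tau_interior_unique[OF s0(1) that(1) int] that(2) by simp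
  have j0': "of_int e0 * tau s0 = b + 2 * of_int j0" using j0 s0(2) by simp
  have "2 \<le> real k" using k2 by simp
  then have t1: "tau s0 < ?t1" "?t1 < tau s0 + 2 * real k" using t0 s0(2) by auto
  have e1: "- e0 \<in> {1, -1}" using e0 by auto
  have j1: "of_int (- e0) * ?t1 = b + 2 * of_int (j0 - e0 * (p + 1))"
    using j0 by (simp add: algebra_simps)
  have simple: "deriv F (pt s0 e0 m) \<noteq> 0" if "F (pt s0 e0 m) = \<alpha>" for m
    by (rule deriv_nz_interior[OF _ int e0]) (use that alpha_nz in simp)
  have cs: "\<exists>!z0. closest_alpha_point F \<alpha> z0"
    by (rule first_level_point_closest(1)[OF s0(1) min uniq form e0 j0' t1 e1 j1 simple])
  have cs2: "simple_point F z0 \<and>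
       (\<forall>w. succeeding_alpha_point F \<alpha> z0 w \<longrightarrow> Arg w \<noteq> Arg z0 \<and> norm w \<noteq> norm z0) \<and>
       (\<exists>m. z0 = pt s0 e0 m \<and> F z0 = \<alpha>)" if "closest_alpha_point F \<alpha> z0" for z0
    by (rule first_level_point_closest(2)[OF s0(1) min uniq form e0 j0' t1 e1 j1 simple]) (assumption | rule that)+
  show "\<exists>!z0. closest_alpha_point F \<alpha> z0" by (rule cs)
  assume z0: "closest_alpha_point F \<alpha> z0"
  obtain m where m: "z0 = pt s0 e0 m" "F z0 = \<alpha>" using cs2[OF z0] by blast
  then obtain n :: int where n: "of_int e0 * t0 + 2 * of_int (p * m) = b + 2 * of_nat k * of_int n"
    using alpha_pt_iff[OF level_cstrip[OF s0(1)] e0] s0(2) by blast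
  have "(even (p - B) \<longrightarrow> 2 * (p * m) = B - p + 2 * int k * n \<and> z0 \<in> open_sector k (2 * m)) \<and>
          (odd (p - B) \<longrightarrow> 2 * (p * m) = B + 1 + p + 2 * int k * n \<and> z0 \<in> open_sector k (2 * m - 1))"
  proof (intro conjI impI)
    assume ev: "even (p - B)"
    then have "real_of_int (2 * (p * m)) = of_int (B - p + 2 * int k * n)" using n by (simp add: e0_def t0_def)
    then show "2 * (p * m) = B - p + 2 * int k * n" by (simp only: of_int_eq_iff)
    show "z0 \<in> open_sector k (2 * m)" using m(1) ev pt_sector(1)[OF int] by (simp add: e0_def)
  next
    assume od: "odd (p - B)"
    then have "real_of_int (2 * (p * m)) = of_int (B + 1 + p + 2 * int k * n)" using n by (simp add: e0_def t0_def)
    then show "2 * (p * m) = B + 1 + p + 2 * int k * n" by (simp only: of_int_eq_iff)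
    show "z0 \<in> open_sector k (2 * m - 1)" using m(1) od pt_sector(2)[OF int] by (simp add: e0_def)
  qed
  then show "simple_point F z0 \<and>
       (\<forall>w. succeeding_alpha_point F \<alpha> z0 w \<longrightarrow> Arg w \<noteq> Arg z0 \<and> norm w \<noteq> norm z0) \<and>
       (\<exists>m n. (even (p - B) \<longrightarrow> 2 * (p * m) = B - p + 2 * int k * n \<and> z0 \<in> open_sector k (2 * m)) \<and>
          (odd (p - B) \<longrightarrow> 2 * (p * m) = B + 1 + p + 2 * int k * n \<and> z0 \<in> open_sector k (2 * m - 1)))"
    using cs2[OF z0] by blast
qed

text \<open>Now \<open>p\<close>, the least possible value of \<open>tau\<close>, is itself a
  target. By the first bound of \<open>Im_phi_ge\<close> it is taken only on the line
  \<open>Im s = pi\<close>, and there at exactly one level point.\<close>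

lemma closest_ray:
  assumes B: "b = of_int B" "even (p - B)"
  shows "\<exists>!z0. closest_alpha_point F \<alpha> z0"
    and "closest_alpha_point F \<alpha> z0 \<Longrightarrow> simple_point F z0 \<and>
       (\<forall>w. succeeding_alpha_point F \<alpha> z0 w \<longrightarrow> Arg w \<noteq> Arg z0 \<and> norm w \<noteq> norm z0) \<and>
       (\<exists>m n. 2 * (p * m) = B + p + 2 * int k * n \<and> (\<forall>m'. [m' = m] (mod int k) \<longrightarrow> 0 < z0 * root_e k (- 2 * m' + 1)))"
proof -
  obtain s0 where s0: "s0 \<in> level \<rho>" "Im s0 = pi" "Im (phi s0) = pik" by (rule top_level_point[OF \<rho>])
  have t0: "tau s0 = of_int p" using s0(3) kpos by (simp add: tau_def)
  have uniq: "s = s0" if s: "s \<in> level \<rho>" "tau s = tau s0" for s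
  proof -
    have V: "Im (phi s) = pik" using s(2) t0 by (simp add: Im_phi_tau)
    then have "of_int p / of_nat k * Im s \<le> of_int p / of_nat k * pi" using Im_phi_ge(1)[OF level_good[OF s(1)]] by simp
    moreover have "real_of_int p / of_nat k < 0" using p_neg kpos by (simp add: divide_neg_pos)
    ultimately have "pi \<le> Im s" by (simp only: mult_le_cancel_left_neg)
    then have "Im s = pi" using level_cstrip[OF s(1)] by (simp add: cstrip_def)
    then show ?thesis using top_level_unique[OF \<rho> s(1) _ V s0] by simp
  qed
  have form: "\<exists>m'. pt s0 e m = pt s0 (-1) m'" if "e \<in> {1, -1}" for e m
    using that pt_flip_top[OF s0(2)] by auto
  obtain i where i: "p - B = 2 * i" using B(2) by blast
  then have "real_of_int (p - B) = 2 * of_int i" by simp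
  then have pB: "real_of_int p = of_int B + 2 * of_int i" by simp
  have j0: "of_int (- 1) * tau s0 = b + 2 * of_int (i - p)" using B(1) t0 pB by simp
  \<comment> \<open>The targets are the integers of the parity of \<open>p\<close>, so the next one
    is \<open>p + 2\<close>; it lies below \<open>p + 2 * k\<close> because \<open>k\<close> is at
    least 2.\<close>
  have nx: "of_int 1 * (of_int p + 2) = b + 2 * of_int (i + 1)" using B(1) pB by simp
  have t1: "tau s0 < of_int p + 2" "of_int p + 2 < tau s0 + 2 * real k" using t0 k2 by simp_all
  have simple: "deriv F (pt s0 (-1) m) \<noteq> 0" if "F (pt s0 (-1) m) = \<alpha>" for m
    by (rule deriv_nz_top[OF _ level_good[OF s0(1)] s0(2,3)]) (use that alpha_nz in simp_all)
  have min: "tau s0 \<le> tau s" if "s \<in> level \<rho>" "target b (tau s)" for s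
    using tau_ge[OF level_good[OF that(1)]] t0 by simp
  have pm: "-1 \<in> {1, -1::int}" "1 \<in> {1, -1::int}" by simp_all
  have cs: "\<exists>!z0. closest_alpha_point F \<alpha> z0"
    by (rule first_level_point_closest(1)[OF s0(1) min uniq form pm(1) j0 t1 pm(2) nx simple])
  have cs2: "simple_point F z0 \<and>
       (\<forall>w. succeeding_alpha_point F \<alpha> z0 w \<longrightarrow> Arg w \<noteq> Arg z0 \<and> norm w \<noteq> norm z0) \<and>
       (\<exists>m. z0 = pt s0 (-1) m \<and> F z0 = \<alpha>)" if "closest_alpha_point F \<alpha> z0" for z0
    by (rule first_level_point_closest(2)[OF s0(1) min uniq form pm(1) j0 t1 pm(2) nx simple]) (assumption | rule that)+
  show "\<exists>!z0. closest_alpha_point F \<alpha> z0" by (rule cs)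
  assume z0: "closest_alpha_point F \<alpha> z0"
  obtain m where m: "z0 = pt s0 (-1) m" "F z0 = \<alpha>" using cs2[OF z0] by blast
  then obtain n :: int where n: "of_int (- 1) * tau s0 + 2 * of_int (p * m) = b + 2 * of_nat k * of_int n"
    using alpha_pt_iff[OF level_cstrip[OF s0(1)], of "-1"] by blast
  then have "real_of_int (2 * (p * m)) = of_int (B + p + 2 * int k * n)" using B(1) t0 by simp
  then have n': "2 * (p * m) = B + p + 2 * int k * n" by (simp only: of_int_eq_iff)
  have "0 < z0 * root_e k (- 2 * m' + 1)" if "[m' = m] (mod int k)" for m'
    using pt_positive_top[OF s0(2), of m'] pt_cong[OF that, of s0 "-1"] m(1) by simp
  then show "simple_point F z0 \<and>
       (\<forall>w. succeeding_alpha_point F \<alpha> z0 w \<longrightarrow> Arg w \<noteq> Arg z0 \<and> norm w \<noteq> norm z0) \<and>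
       (\<exists>m n. 2 * (p * m) = B + p + 2 * int k * n \<and> (\<forall>m'. [m' = m] (mod int k) \<longrightarrow> 0 < z0 * root_e k (- 2 * m' + 1)))"
    using cs2[OF z0] n' by blast
qed

text \<open>The targets are the integers of the parity of \<open>p + 1\<close>, so
  \<open>p + 1\<close> is the least candidate, and it serves both signs. It cannot occur on
  \<open>Im s = pi\<close>, where \<open>tau - p\<close> is a multiple of \<open>k\<close>. On
  \<open>Im s = 0\<close>, \<open>tau\<close> is a nonnegative multiple of \<open>k\<close>, which
  forces \<open>p = -1\<close> and \<open>tau = 0\<close>.\<close>

lemma closest_pair_cases:
  assumes B: "b = of_int B" "odd (p - B)" and ne: "F z = \<alpha>"
  obtains (interior) s m m' n n' where "0 < Im s" "Im s < pi"
      "2 * (p * m) = B - p - 1 + 2 * int k * n" "2 * (p * m') = B + p + 1 + 2 * int k * n'"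
      "closest_pair F \<alpha> (pt s 1 m) (pt s (-1) m')"
      "\<And>z1 z2. closest_pair F \<alpha> z1 z2 \<Longrightarrow>
         z1 = pt s 1 m \<and> z2 = pt s (-1) m' \<or> z1 = pt s (-1) m' \<and> z2 = pt s 1 m"
  | (bottom) s t m n where "p = - 1" "Im s = 0" "Im t = 0" "2 * (p * m) = B + 2 * int k * n" "Re s < Re t"
      "closest_pair F \<alpha> (pt s 1 m) (pt t 1 m)"
      "\<And>z1 z2. closest_pair F \<alpha> z1 z2 \<Longrightarrow>
         z1 = pt s 1 m \<and> z2 = pt t 1 m \<or> z1 = pt t 1 m \<and> z2 = pt s 1 m"
  | (double) s m n where "p = - 1" "Im s = 0" "2 * (p * m) = B + 2 * int k * n"
      "closest_pair F \<alpha> (pt s 1 m) (pt s 1 m)" "alpha_mult F \<alpha> (pt s 1 m) = 2"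
      "\<And>z1 z2. closest_pair F \<alpha> z1 z2 \<Longrightarrow> z1 = pt s 1 m \<and> z2 = pt s 1 m"
proof -
  obtain i where i: "p + 1 - B = 2 * i" using B(2) by (metis even_add even_diff odd_one evenE)
  then have "real_of_int (p + 1 - B) = 2 * of_int i" by simp
  then have pB: "real_of_int p + 1 = of_int B + 2 * of_int i" by simp
  have tmin: "of_int p + 1 \<le> t" if t: "target b t" "of_int p \<le> t" for t
  proof -
    obtain e j where ej: "e \<in> {1, -1}" "of_int e * t = b + 2 * of_int j" using t(1) by (auto simp: target_def)
    then have "of_int e * t = of_int (B + 2 * j)" using B(1) by simp
    then have "t = of_int (e * (B + 2 * j))" using ej(1) by auto
    moreover have "odd (p - e * (B + 2 * j))" using B(2) ej(1) by auto
    ultimately obtain T where T: "t = of_int T" "odd (p - T)" by blast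
    then have "p \<le> T" "p \<noteq> T" using t(2) by auto
    then have "p + 1 \<le> T" by linarith
    then have "real_of_int (p + 1) \<le> of_int T" by (simp only: of_int_le_iff)
    then show ?thesis using T(1) by simp
  qed
  have tgt: "of_int p + 1 \<le> tau s" if "s \<in> level \<rho>" "target b (tau s)" for s
    using tmin[OF that(2) tau_ge[OF level_good[OF that(1)]]] .
  have e1: "of_int 1 * tau s = b + 2 * of_int i" "of_int (- 1) * tau s = b + 2 * of_int (i - p - 1)"
    if "tau s = of_int p + 1" for s using that B(1) pB by auto
  have solve: "2 * (p * m) = B - p - 1 + 2 * int k * n"
    if "of_int 1 * tau s + 2 * of_int (p * m) = b + 2 * of_nat k * of_int n" "tau s = of_int p + 1" for s m n
  proof -
    have "real_of_int (2 * (p * m)) = of_int (B - p - 1 + 2 * int k * n)" using that B(1) by simp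
    then show ?thesis by (simp only: of_int_eq_iff)
  qed
  have solve': "2 * (p * m) = B + p + 1 + 2 * int k * n"
    if "of_int (- 1) * tau s + 2 * of_int (p * m) = b + 2 * of_nat k * of_int n" "tau s = of_int p + 1" for s m n
  proof -
    have "real_of_int (2 * (p * m)) = of_int (B + p + 1 + 2 * int k * n)" using that B(1) by simp
    then show ?thesis by (simp only: of_int_eq_iff)
  qed
  obtain s2 where s2: "s2 \<in> level \<rho>" "target b (tau s2)" using alpha_point_obtain[OF ne] by metis
  obtain s1 where s1: "s1 \<in> level \<rho>" "tau s1 = of_int p + 1"
    using reach_tau[OF s2(1), of "of_int p + 1"] tgt[OF s2] by auto
  show thesis
  proof (cases "\<exists>s. s \<in> level \<rho> \<and> tau s = of_int p + 1 \<and> 0 < Im s \<and> Im s < pi")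
    case True
    then obtain s where s: "s \<in> level \<rho>" "tau s = of_int p + 1" "0 < Im s" "Im s < pi" by blast
    obtain m where m: "F (pt s 1 m) = \<alpha>" using alpha_point_exists[OF s(1) _ e1(1)[OF s(2)]] by blast
    obtain m' where m': "F (pt s (-1) m') = \<alpha>" using alpha_point_exists[OF s(1) _ e1(2)[OF s(2)]] by blast
    obtain n where n: "2 * (p * m) = B - p - 1 + 2 * int k * n"
      using m alpha_pt_iff[OF level_cstrip[OF s(1)], of 1] solve s(2) by blast
    obtain n' where n': "2 * (p * m') = B + p + 1 + 2 * int k * n'"
      using m' alpha_pt_iff[OF level_cstrip[OF s(1)], of "-1"] solve' s(2) by blast
    have mult: "alpha_mult F \<alpha> (pt s 1 m) = 1" "alpha_mult F \<alpha> (pt s (-1) m') = 1"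
    proof -
      have nz: "F (pt s 1 m) \<noteq> 0" "F (pt s (-1) m') \<noteq> 0" using m m' alpha_nz by simp_all
      show "alpha_mult F \<alpha> (pt s 1 m) = 1"
        by (rule alpha_mult_simple[OF m alpha_nz deriv_nz_interior[OF nz(1) s(3,4)]]) simp
      show "alpha_mult F \<alpha> (pt s (-1) m') = 1"
        by (rule alpha_mult_simple[OF m' alpha_nz deriv_nz_interior[OF nz(2) s(3,4)]]) simp
    qed
    have far: "w = pt s 1 m \<or> w = pt s (-1) m' \<or> norm (pt s (-1) m') < norm w" if w: "F w = \<alpha>" for w
    proof -
      obtain t e l where t: "t \<in> level \<rho>" "e \<in> {1, -1}" "w = pt t e l" "target b (tau t)"
        by (rule alpha_point_obtain[OF w])
      show ?thesis
      proof (cases "t = s")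
        case True
        then show ?thesis
          using t w m m' alpha_point_cong[OF level_cstrip[OF s(1)]] by auto
      next
        case False
        then have "tau t \<noteq> tau s" using tau_interior_unique[OF s(1) t(1) s(3,4)] by auto
        then have "tau s < tau t" using tgt[OF t(1,4)] s(2) by linarith
        then have "Re s < Re t" using tau_less s(1) t(1) by blast
        then have "norm (pt s (-1) m') < norm w" unfolding t(3) by (simp only: norm_pt_less)
        then show ?thesis by blast
      qed
    qed
    have ne: "pt s 1 m \<noteq> pt s (-1) m'" by (rule pt_flip_interior[OF s(3,4)])
    have le: "norm (pt s 1 m) \<le> norm (pt s (-1) m')" by simp
    note cp = closest_pair_two[OF mult ne le far]
    show thesis by (rule interior[OF s(3,4) n n' cp])
  next
    case False
    have bot: "p = - 1 \<and> bottom0 \<rho> s" if s: "s \<in> level \<rho>" "tau s = of_int p + 1" for s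
    proof -
      have g: "s \<in> good" using level_good s by blast
      have "Im s = 0 \<or> Im s = pi" using False s level_cstrip[OF s(1)] by (force simp: cstrip_def)
      moreover have "Im s \<noteq> pi"
      proof
        assume "Im s = pi"
        then obtain N :: nat where "tau s = of_int p + of_nat N * of_nat k" by (rule tau_top[OF g])
        then have "real (N * k) = 1" using s(2) by simp
        then have "N * k = 1" by (simp only: of_nat_eq_1_iff)
        then show False using k2 by simp
      qed
      ultimately have I: "Im s = 0" by blast
      then obtain N :: nat where "tau s = of_nat N * of_nat k" by (rule tau_bottom[OF g])
      then have "0 \<le> real_of_int p + 1" using s(2) by simp
      then have p: "p = - 1" using p_neg by linarith
      then have "real_of_int p = - 1" by simp
      then have "tau s = 0" using s(2) by linarith
      then have "Im (phi s) = 0" by (simp add: Im_phi_tau)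
      then show ?thesis using p I s(1) unfolding bottom0_def by blast
    qed
    then have p: "p = - 1" and b1: "bottom0 \<rho> s1" using s1 by auto
    have botl: "s \<in> level \<rho>" "Im s = 0" "tau s = of_int p + 1" if "bottom0 \<rho> s" for s
    proof -
      show "s \<in> level \<rho>" "Im s = 0" using that unfolding bottom0_def by blast+
      have "tau s = 0" using that unfolding bottom0_def tau_def by simp
      moreover have "real_of_int p = - 1" using p by simp
      ultimately show "tau s = of_int p + 1" by linarith
    qed
    obtain m where m: "F (pt s1 1 m) = \<alpha>" using alpha_point_exists[OF s1(1) _ e1(1)[OF s1(2)]] by blast
    obtain n where "2 * (p * m) = B - p - 1 + 2 * int k * n"
      using m alpha_pt_iff[OF level_cstrip[OF s1(1)], of 1] solve s1(2) by blast
    then have n: "2 * (p * m) = B + 2 * int k * n" using p by simp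
    have Fm: "F (pt s 1 m) = \<alpha>" if s: "bottom0 \<rho> s" for s
      using m s1 botl[OF s] alpha_pt_iff[OF level_cstrip, of s 1] alpha_pt_iff[OF level_cstrip, of s1 1] by simp
    have rep: "(\<exists>t. bottom0 \<rho> t \<and> w = pt t 1 m) \<or> (\<forall>s. bottom0 \<rho> s \<longrightarrow> norm (pt s 1 m) < norm w)"
      if w: "F w = \<alpha>" for w
    proof -
      obtain t e l where t: "t \<in> level \<rho>" "e \<in> {1, -1}" "w = pt t e l" "target b (tau t)"
        by (rule alpha_point_obtain[OF w])
      show ?thesis
      proof (cases "tau t = of_int p + 1")
        case True
        then have bt: "bottom0 \<rho> t" using bot t(1) by blast
        have w1: "w = pt t 1 l" unfolding t(3) using botl(2)[OF bt] by (rule pt_flip_bottom)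
        then have "w = pt t 1 m" using alpha_point_cong[OF level_cstrip[OF t(1)] _ _ Fm[OF bt], of l] w by simp
        then show ?thesis using bt by blast
      next
        case False
        then have lt: "of_int p + 1 < tau t" using tgt[OF t(1,4)] by linarith
        have "norm (pt s 1 m) < norm w" if s: "bottom0 \<rho> s" for s
        proof -
          have "Re s < Re t" using lt botl[OF s] by (intro tau_less t) auto
          then show ?thesis unfolding t(3) by (simp only: norm_pt_less)
        qed
        then show ?thesis by blast
      qed
    qed
    show thesis
    \<comment> \<open>By convexity, either the minimum of \<open>|F|\<close> on the ray equals
      \<open>\<rho>\<close>, which gives one double point, or \<open>\<rho>\<close> is taken once on
      each side of the minimum.\<close>
    proof (cases "slope (Re s1) = 0")
      case True
      have only: "t = s1" if t: "bottom0 \<rho> t" for t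
      proof (rule ccontr)
        assume "t \<noteq> s1"
        then have "Re t \<noteq> Re s1" using level_eqI botl(1)[OF t] s1(1) by blast
        then show False using bottom0_slopes[OF \<rho> t b1] bottom0_slopes[OF \<rho> b1 t] True by linarith
      qed
      have mult: "alpha_mult F \<alpha> (pt s1 1 m) = 2"
        by (rule alpha_mult_double[OF \<rho> b1 True m alpha_nz])
      have far: "w = pt s1 1 m \<or> norm (pt s1 1 m) < norm w" if "F w = \<alpha>" for w
        using rep[OF that] only b1 by blast
      note cp = closest_pair_double[OF mult far]
      show thesis by (rule double[OF p botl(2)[OF b1] n cp(1) mult cp(2)])
    next
      case sl: False
      obtain s' where s': "bottom0 \<rho> s'" "Re s' \<noteq> Re s1" by (rule bottom0_second[OF \<rho> b1 sl])
      obtain s t where st: "bottom0 \<rho> s" "bottom0 \<rho> t" "Re s < Re t"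
        using s' b1 by (metis linorder_neqE_linordered_idom)
      note sl = bottom0_slopes[OF \<rho> st]
      have only: "u = s \<or> u = t" if u: "bottom0 \<rho> u" for u
      proof (rule ccontr)
        assume "\<not> (u = s \<or> u = t)"
        then have "Re u \<noteq> Re s" "Re u \<noteq> Re t" using level_eqI botl(1)[OF u] botl(1)[OF st(1)] botl(1)[OF st(2)] by blast+
        then consider "Re u < Re s" | "Re s < Re u" "Re u < Re t" | "Re t < Re u" by linarith
        then show False
        proof cases
          case 1
          then show False using bottom0_slopes(2)[OF \<rho> u st(1)] sl by simp
        next
          case 2
          then show False using bottom0_slopes(2)[OF \<rho> st(1) u] bottom0_slopes(1)[OF \<rho> u st(2)] by simp
        next
          case 3
          then show False using bottom0_slopes(1)[OF \<rho> st(2) u] sl by simp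
        qed
      qed
      have mult: "alpha_mult F \<alpha> (pt u 1 m) = 1" if u: "bottom0 \<rho> u" "slope (Re u) \<noteq> 0" for u
      proof (rule alpha_mult_simple[OF Fm[OF u(1)] alpha_nz F_deriv_nz])
        show "F (pt u 1 m) \<noteq> 0" using Fm[OF u(1)] alpha_nz by simp
        show "dlog (pt u 1 m ^ k) \<noteq> 0"
          unfolding pt_pow_bottom[OF botl(2)[OF u(1)]] using u(2) by (auto simp: slope_def)
      qed
      have ms: "alpha_mult F \<alpha> (pt s 1 m) = 1" "alpha_mult F \<alpha> (pt t 1 m) = 1" using mult st sl by auto
      have lt: "norm (pt s 1 m) < norm (pt t 1 m)" using st(3) by (simp only: norm_pt_less)
      then have ne: "pt s 1 m \<noteq> pt t 1 m" by (metis less_irrefl)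
      have far: "w = pt s 1 m \<or> w = pt t 1 m \<or> norm (pt t 1 m) < norm w" if "F w = \<alpha>" for w
        using rep[OF that] only st by blast
      note cp = closest_pair_two[OF ms ne less_imp_le[OF lt] far]
      show thesis by (rule bottom[OF p botl(2)[OF st(1)] botl(2)[OF st(2)] n st(3) cp])
    qed
  qed
qed

end

end

section \<open>Sector indices and the final assembly\<close>

lemma ceiling_half: "\<lceil>real_of_int n / 2\<rceil> = (n + 1) div 2"
proof (cases "even n")
  case True
  then obtain j where "n = 2 * j" by blast
  then show ?thesis by simp
next
  case False
  then obtain j where j: "n = 2 * j + 1" by (blast elim: oddE)
  have "\<lceil>real_of_int n / 2\<rceil> = j + 1" by (rule ceiling_unique) (simp_all add: j)
  then show ?thesis by (simp add: j)
qed

lemma root_e_mult: "root_e k i * root_e k j = root_e k (i + j)"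
  by (simp add: root_e_def exp_add[symmetric] add_divide_distrib algebra_simps)

lemma root_e_0 [simp]: "root_e k 0 = 1"
  by (simp add: root_e_def)

lemma norm_root_e [simp]: "norm (root_e k j) = 1"
  by (simp add: root_e_def)

lemma root_e_periodic:
  assumes "0 < k"
  shows "root_e k (i + 2 * (int k * n)) = root_e k i"
proof -
  have "root_e k (2 * (int k * n)) = exp (2 * of_int n * pi * \<i>)"
    using assms by (simp add: root_e_def mult_ac)
  also have "\<dots> = 1" unfolding exp_eq_1 by (auto intro: exI[of _ n])
  finally show ?thesis unfolding root_e_mult[symmetric] by simp
qed

lemma open_sector_cong:
  assumes "0 < k" "[m = m'] (mod int k)"
  shows "open_sector k (2 * m + j) = open_sector k (2 * m' + j)"
proof -
  obtain n where n: "m = m' + int k * n" using assms(2) by (metis cong_iff_lin cong_sym)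
  have "root_e k (- (2 * m + j)) = root_e k (- (2 * m' + j) + 2 * (int k * (- n)))"
    unfolding n by (rule arg_cong[of _ _ "root_e k"]) (simp add: algebra_simps)
  then have "root_e k (- (2 * m + j)) = root_e k (- (2 * m' + j))"
    unfolding root_e_periodic[OF assms(1)] .
  then show ?thesis unfolding open_sector_def by simp
qed

text \<open>\<open>b\<close> is the argument in units of \<open>pi / k\<close>, taken in the unit
  interval that starts at the sector index \<open>B\<close> instead of in the principal range. The
  conditions on the sector thus become conditions on \<open>b\<close>.\<close>

lemma half_open_sector_polar:
  assumes "0 < k" "\<alpha> \<noteq> 0" "\<alpha> \<in> half_open_sector k B"
  obtains b where "\<alpha> = of_real (norm \<alpha>) * exp (\<i> * of_real (b * pi / of_nat k))"
    "of_int B \<le> b" "b < of_int B + 1" "\<alpha> \<in> open_sector k B \<Longrightarrow> of_int B < b"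
    "0 < \<alpha> * root_e k (- B) \<Longrightarrow> b = of_int B"
proof -
  define \<theta> where "\<theta> = Arg (\<alpha> * root_e k (- B))"
  define b where "b = of_int B + \<theta> * k / pi"
  have nz: "\<alpha> * root_e k (- B) \<noteq> 0" using assms(2) by (simp add: root_e_def)
  have "\<alpha> = \<alpha> * root_e k (- B) * root_e k B" by (simp add: mult.assoc root_e_mult)
  also have "\<alpha> * root_e k (- B) = of_real (norm \<alpha>) * exp (\<i> * of_real \<theta>)"
    using Arg_eq[OF nz] unfolding \<theta>_def by (simp add: norm_mult)
  also have "of_real (norm \<alpha>) * exp (\<i> * of_real \<theta>) * root_e k B =
      of_real (norm \<alpha>) * exp (\<i> * of_real (b * pi / of_nat k))"
  proof -
    have "b * pi / of_nat k = \<theta> + of_int B / of_nat k * pi" using assms(1) by (simp add: b_def field_simps)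
    then show ?thesis by (simp only: root_e_def mult.assoc exp_add[symmetric] of_real_add distrib_left)
  qed
  finally have 1: "\<alpha> = of_real (norm \<alpha>) * exp (\<i> * of_real (b * pi / of_nat k))" .
  have \<theta>: "0 \<le> \<theta>" "\<theta> < pi / k" using assms(3) by (auto simp: half_open_sector_def \<theta>_def)
  have "of_int B \<le> b" using \<theta>(1) by (simp add: b_def)
  moreover have "b < of_int B + 1" using \<theta>(2) assms(1) by (simp add: b_def field_simps)
  moreover have "of_int B < b" if "\<alpha> \<in> open_sector k B"
    using that assms(1) by (auto simp: b_def open_sector_def \<theta>_def)
  moreover have "b = of_int B" if "0 < \<alpha> * root_e k (- B)"
  proof -
    have "\<theta> = 0" unfolding \<theta>_def using that by (subst Arg_eq_0) (auto simp: less_complex_def complex_is_Real_iff)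
    then show ?thesis by (simp add: b_def)
  qed
  ultimately show thesis using that 1 by blast
qed

theorem theorem23:
  fixes k :: nat and p q :: int and \<kappa> \<sigma> :: nat
    and A :: real and a b :: "nat \<Rightarrow> real" and \<omega>1 \<omega>2 :: enat
    and F :: "complex \<Rightarrow> complex" and \<alpha> :: complex
  assumes "2 \<le> k" and "p < 0" and "gcd \<bar>p\<bar> (int k) = 1"
    and "0 < \<omega>1" and "0 < \<omega>2" and "0 \<le> A"
    and "\<And>\<nu>. enat \<nu> < \<omega>1 \<Longrightarrow> 0 < a \<nu>"
    and "\<And>\<mu>. enat \<mu> < \<omega>2 \<Longrightarrow> 0 < b \<mu>"
    and "\<And>z. abs_convergent_prod (num_factor k \<omega>1 a z)"
    and "\<And>z. abs_convergent_prod (den_factor k \<omega>2 b z)"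
    and "F = mero_fun k p A \<omega>1 a \<omega>2 b"
    and "\<exists>z \<in> mero_domain k \<omega>2 b. F z \<noteq> z powi p"
    and "\<alpha> \<noteq> 0" and "alpha_set F \<alpha> \<noteq> {}"
    and "q \<in> {0..int k - 1}" and "\<kappa> \<in> {0, 1}"
    and "\<alpha> \<in> half_open_sector k (2 * q - int \<kappa>)"
    and "\<sigma> = (if even p then \<kappa> else 1 - \<kappa>)"
  shows
   "(\<alpha> \<in> open_sector k (2 * q - int \<kappa>) \<longrightarrow>
      (\<exists>!z0. closest_alpha_point F \<alpha> z0) \<and>
      (\<forall>z0. closest_alpha_point F \<alpha> z0 \<longrightarrow>
         simple_point F z0 \<and>
         (\<forall>w. succeeding_alpha_point F \<alpha> z0 w \<longrightarrow> Arg w \<noteq> Arg z0 \<and> norm w \<noteq> norm z0) \<and>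
         (\<forall>m. [p * m = q - (-1) ^ \<sigma> * \<lceil>of_int p / 2 :: real\<rceil>] (mod int k) \<longrightarrow>
              z0 \<in> open_sector k (2 * m - int \<sigma>))))
    \<and>
    (0 < \<alpha> * root_e k (- 2 * q + int \<kappa>) \<and> (even p \<longleftrightarrow> even \<kappa>) \<longrightarrow>
      (\<exists>!z0. closest_alpha_point F \<alpha> z0) \<and>
      (\<forall>z0. closest_alpha_point F \<alpha> z0 \<longrightarrow>
         simple_point F z0 \<and>
         (\<forall>w. succeeding_alpha_point F \<alpha> z0 w \<longrightarrow> Arg w \<noteq> Arg z0 \<and> norm w \<noteq> norm z0) \<and>
         (\<forall>m. [p * m = q + \<lceil>(of_int p - 1) / 2 :: real\<rceil>] (mod int k) \<longrightarrow>
              0 < z0 * root_e k (- 2 * m + 1))))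
    \<and>
    (0 < \<alpha> * root_e k (- 2 * q + int \<kappa>) \<and> (even p \<longleftrightarrow> odd \<kappa>) \<longrightarrow>
      (\<exists>z1 z2. closest_pair F \<alpha> z1 z2) \<and>
      (\<forall>z1 z2. closest_pair F \<alpha> z1 z2 \<longrightarrow>
         (norm z1 = norm z2 \<or> Arg z1 = Arg z2) \<and>
         (Arg z1 = Arg z2 \<longrightarrow>
            p = -1 \<and>
            (z1 = z2 \<longrightarrow> alpha_mult F \<alpha> z1 = 2) \<and>
            (\<forall>m. [p * m = q - \<lceil>(of_int p + 1) / 2 :: real\<rceil>] (mod int k) \<longrightarrow>
                 0 < z1 * root_e k (- 2 * m) \<and> 0 < z2 * root_e k (- 2 * m))) \<and>
         (z1 \<noteq> z2 \<and> norm z1 = norm z2 \<longrightarrow>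
            (\<forall>m s. [p * m = q - \<lceil>(of_int p + 1) / 2 :: real\<rceil>] (mod int k) \<and>
                   Im (\<alpha> * root_e k (p * s)) = 0 \<longrightarrow>
                 (z1 \<in> open_sector k (2 * m) \<and> z2 \<in> open_sector k (- 2 * s - 2 * m - 1)) \<or>
                 (z2 \<in> open_sector k (2 * m) \<and> z1 \<in> open_sector k (- 2 * s - 2 * m - 1))))))"
proof -
  define c where "c = (\<lambda>\<nu>. if enat \<nu> < \<omega>1 then 1 / a \<nu> else 0)"
  define d where "d = (\<lambda>\<mu>. if enat \<mu> < \<omega>2 then 1 / b \<mu> else 0)"
  have nf: "num_factor k \<omega>1 a z = (\<lambda>\<nu>. 1 + of_real (c \<nu>) * z ^ k)" for z
    by (auto simp: num_factor_def factor_def c_def)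
  have df: "den_factor k \<omega>2 b z = (\<lambda>\<nu>. 1 + of_real (d \<nu>) * (- (z ^ k)))" for z
    by (auto simp: den_factor_def factor_def d_def)
  have cn: "0 \<le> c \<nu>" and dn: "0 \<le> d \<nu>" for \<nu> using assms(7,8) by (auto simp: c_def d_def less_imp_le)
  \<comment> \<open>At \<open>z = 1\<close> the factors of the numerator are
    \<open>1 + c \<nu>\<close>, so absolute convergence of the product means summability of
    \<open>c\<close>.\<close>
  have "summable c"
    using abs_convergent_prod_imp_summable[OF assms(9)[of 1]] cn unfolding nf by simp
  moreover have "summable d"
    using abs_convergent_prod_imp_summable[OF assms(10)[of 1]] dn unfolding df by simp
  moreover have "coprime p (int k)" using assms(3) by (simp add: coprime_iff_gcd_eq_1)
  moreover have "0 < c 0" "0 < d 0"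
    using assms(4,5) assms(7,8)[of 0] by (auto simp: c_def d_def zero_enat_def)
  ultimately interpret I: pf_quotient k p A c d
    using assms(1,2,6) cn dn by unfold_locales auto
  have F: "F = I.F"
    unfolding assms(11) by (rule ext) (simp add: mero_fun_def I.F_def gprod_def nf df)
  have k0: "0 < k" using assms(1) by simp
  define B where "B = 2 * q - int \<kappa>"
  obtain \<beta> where \<beta>: "\<alpha> = of_real (norm \<alpha>) * exp (\<i> * of_real (\<beta> * pi / of_nat k))"
    "of_int B \<le> \<beta>" "\<beta> < of_int B + 1" "\<alpha> \<in> open_sector k B \<Longrightarrow> of_int B < \<beta>"
    "0 < \<alpha> * root_e k (- B) \<Longrightarrow> \<beta> = of_int B"
    using half_open_sector_polar[OF k0 assms(13) assms(17)[folded B_def]] by blast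
  have \<rho>: "0 < norm \<alpha>" using assms(13) by simp
  obtain z where z: "I.F z = \<alpha>" using assms(14) unfolding F alpha_set_def by blast
  have mB: "- 2 * q + int \<kappa> = - B" by (simp add: B_def)
  have \<kappa>: "\<kappa> = 0 \<or> \<kappa> = 1" using assms(16) by simp
  have solve: "[m' = m] (mod int k)" if "2 * (p * m) = 2 * x + 2 * int k * n" "[p * m' = x] (mod int k)" for m m' n x
  proof -
    have "p * m - x = int k * n" using that(1) by (simp add: algebra_simps)
    then have "[p * m = x] (mod int k)" unfolding cong_iff_dvd_diff by (metis dvd_triv_left)
    then have "[p * m' = p * m] (mod int k)" using that(2) cong_sym cong_trans by blast
    then show ?thesis by (rule I.residue_cancel)
  qed
  have part1: "(\<exists>!z0. closest_alpha_point I.F \<alpha> z0) \<and>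
      (\<forall>z0. closest_alpha_point I.F \<alpha> z0 \<longrightarrow>
         simple_point I.F z0 \<and>
         (\<forall>w. succeeding_alpha_point I.F \<alpha> z0 w \<longrightarrow> Arg w \<noteq> Arg z0 \<and> norm w \<noteq> norm z0) \<and>
         (\<forall>m. [p * m = q - (-1) ^ \<sigma> * \<lceil>of_int p / 2 :: real\<rceil>] (mod int k) \<longrightarrow>
              z0 \<in> open_sector k (2 * m - int \<sigma>)))"
    if os: "\<alpha> \<in> open_sector k B"
  proof -
    note gc = I.closest_open_sector[OF \<rho> \<beta>(1) \<beta>(4)[OF os] \<beta>(3) z]
    have "z0 \<in> open_sector k (2 * m - int \<sigma>)"
      if z0: "closest_alpha_point I.F \<alpha> z0" and m: "[p * m = q - (-1) ^ \<sigma> * \<lceil>of_int p / 2 :: real\<rceil>] (mod int k)" for z0 m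
    proof -
      obtain m' n where ev: "even (p - B) \<Longrightarrow> 2 * (p * m') = B - p + 2 * int k * n \<and> z0 \<in> open_sector k (2 * m')"
        and od: "odd (p - B) \<Longrightarrow> 2 * (p * m') = B + 1 + p + 2 * int k * n \<and> z0 \<in> open_sector k (2 * m' - 1)"
        using gc(2)[OF z0] by blast
      show ?thesis
      proof (cases "even (p - B)")
        case True
        have \<sigma>: "\<sigma> = 0" using True \<kappa> by (auto simp: assms(18) B_def)
        \<comment> \<open>Here \<open>\<kappa>\<close> has the parity of \<open>p\<close>, so
          \<open>p + \<kappa>\<close> is twice the ceiling of \<open>p / 2\<close>. In the other
          case \<open>1 - \<kappa>\<close> takes the place of \<open>\<kappa>\<close>.\<close>
        have "B - p = 2 * (q - (p + 1) div 2)" using True \<kappa> by (auto simp: B_def; presburger)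
        then have e: "2 * (p * m') = 2 * (q - (p + 1) div 2) + 2 * int k * n" using ev[OF True] by linarith
        have "[p * m = q - (p + 1) div 2] (mod int k)" using m by (simp add: \<sigma> ceiling_half)
        from solve[OF e this] have "[m = m'] (mod int k)" .
        then show ?thesis using open_sector_cong[OF k0, of m m' 0] ev[OF True] by (simp add: \<sigma>)
      next
        case False
        have \<sigma>: "\<sigma> = 1" using False \<kappa> by (auto simp: assms(18) B_def)
        have "B + 1 + p = 2 * (q + (p + 1) div 2)" using False \<kappa> by (auto simp: B_def; presburger)
        then have e: "2 * (p * m') = 2 * (q + (p + 1) div 2) + 2 * int k * n" using od[OF False] by linarith
        have "[p * m = q + (p + 1) div 2] (mod int k)" using m by (simp add: \<sigma> ceiling_half)
        from solve[OF e this] have "[m = m'] (mod int k)" .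
        then show ?thesis using open_sector_cong[OF k0, of m m' "-1"] od[OF False] by (simp add: \<sigma>)
      qed
    qed
    then show ?thesis using gc by blast
  qed
  have part2: "(\<exists>!z0. closest_alpha_point I.F \<alpha> z0) \<and>
      (\<forall>z0. closest_alpha_point I.F \<alpha> z0 \<longrightarrow>
         simple_point I.F z0 \<and>
         (\<forall>w. succeeding_alpha_point I.F \<alpha> z0 w \<longrightarrow> Arg w \<noteq> Arg z0 \<and> norm w \<noteq> norm z0) \<and>
         (\<forall>m. [p * m = q + \<lceil>(of_int p - 1) / 2 :: real\<rceil>] (mod int k) \<longrightarrow>
              0 < z0 * root_e k (- 2 * m + 1)))"
    if pos: "0 < \<alpha> * root_e k (- B)" and par: "even p \<longleftrightarrow> even \<kappa>"
  proof -
    have evB: "even (p - B)" using par by (auto simp: B_def)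
    note rc = I.closest_ray[OF \<rho> \<beta>(1) \<beta>(5)[OF pos] evB]
    have cl: "\<lceil>(of_int p - 1) / 2 :: real\<rceil> = p div 2" using ceiling_half[of "p - 1"] by simp
    have "0 < z0 * root_e k (- 2 * m + 1)"
      if z0: "closest_alpha_point I.F \<alpha> z0" and m: "[p * m = q + \<lceil>(of_int p - 1) / 2 :: real\<rceil>] (mod int k)" for z0 m
    proof -
      obtain m' n where mn: "2 * (p * m') = B + p + 2 * int k * n"
        and ps: "\<And>l. [l = m'] (mod int k) \<Longrightarrow> 0 < z0 * root_e k (- 2 * l + 1)"
        using rc(2)[OF z0] by blast
      have "B + p = 2 * (q + p div 2)" using evB \<kappa> by (auto simp: B_def; presburger)
      then have e: "2 * (p * m') = 2 * (q + p div 2) + 2 * int k * n" using mn by linarith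
      have "[m = m'] (mod int k)" by (rule solve[OF e m[unfolded cl]])
      then show ?thesis by (rule ps)
    qed
    then show ?thesis using rc by blast
  qed
  have part3: "(\<exists>z1 z2. closest_pair I.F \<alpha> z1 z2) \<and>
      (\<forall>z1 z2. closest_pair I.F \<alpha> z1 z2 \<longrightarrow>
         (norm z1 = norm z2 \<or> Arg z1 = Arg z2) \<and>
         (Arg z1 = Arg z2 \<longrightarrow>
            p = -1 \<and>
            (z1 = z2 \<longrightarrow> alpha_mult I.F \<alpha> z1 = 2) \<and>
            (\<forall>m. [p * m = q - \<lceil>(of_int p + 1) / 2 :: real\<rceil>] (mod int k) \<longrightarrow>
                 0 < z1 * root_e k (- 2 * m) \<and> 0 < z2 * root_e k (- 2 * m))) \<and>
         (z1 \<noteq> z2 \<and> norm z1 = norm z2 \<longrightarrow>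
            (\<forall>m s. [p * m = q - \<lceil>(of_int p + 1) / 2 :: real\<rceil>] (mod int k) \<and>
                   Im (\<alpha> * root_e k (p * s)) = 0 \<longrightarrow>
                 (z1 \<in> open_sector k (2 * m) \<and> z2 \<in> open_sector k (- 2 * s - 2 * m - 1)) \<or>
                 (z2 \<in> open_sector k (2 * m) \<and> z1 \<in> open_sector k (- 2 * s - 2 * m - 1)))))"
    if pos: "0 < \<alpha> * root_e k (- B)" and par: "even p \<longleftrightarrow> odd \<kappa>"
  proof -
    have odB: "odd (p - B)" using par by (auto simp: B_def)
    have bB: "\<beta> = of_int B" by (rule \<beta>(5)[OF pos])
    have cl: "\<lceil>(of_int p + 1) / 2 :: real\<rceil> = (p + 2) div 2" using ceiling_half[of "p + 1"] by simp
    have half: "B - p - 1 = 2 * (q - (p + 2) div 2)" using odB \<kappa> by (auto simp: B_def; presburger)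
    from \<rho> \<beta>(1) bB odB z show ?thesis
    proof (cases rule: I.closest_pair_cases)
      case (interior s m m' n n')
      let ?za = "I.pt s 1 m" and ?zb = "I.pt s (-1) m'"
      have ne: "?za \<noteq> ?zb" by (rule I.pt_flip_interior[OF interior(1,2)])
      have nn: "norm ?za = norm ?zb" by simp
      have an: "Arg ?za \<noteq> Arg ?zb"
      proof
        assume eq: "Arg ?za = Arg ?zb"
        have "?za \<noteq> 0" "?zb \<noteq> 0" by (simp_all add: I.pt_def)
        then have "?za = ?zb" using Arg_eq[of ?za] Arg_eq[of ?zb] eq nn by simp
        then show False using ne by contradiction
      qed
      have sec: "?za \<in> open_sector k (2 * l) \<and> ?zb \<in> open_sector k (- 2 * s' - 2 * l - 1)"
        if l: "[p * l = q - \<lceil>(of_int p + 1) / 2 :: real\<rceil>] (mod int k)" and im: "Im (\<alpha> * root_e k (p * s')) = 0" for l s'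
      proof -
        have e: "2 * (p * m) = 2 * (q - (p + 2) div 2) + 2 * int k * n" using interior(3) half by linarith
        have lm: "[l = m] (mod int k)" by (rule solve[OF e l[unfolded cl]])
        have "\<alpha> = of_real (norm \<alpha>) * root_e k B"
          using \<beta>(1) unfolding bB by (simp add: root_e_def mult.commute)
        then have "\<alpha> * root_e k (p * s') = of_real (norm \<alpha>) * root_e k (B + p * s')"
          by (metis mult.assoc root_e_mult)
        then have "Im (root_e k (B + p * s')) = 0" using im \<rho> by simp
        then have "sin (of_int (B + p * s') / of_nat k * pi) = 0" by (simp add: root_e_def Im_exp)
        then obtain i :: int where "of_int (B + p * s') / of_nat k * pi = of_int i * pi"
          unfolding sin_zero_iff_int2 by blast
        then have "real_of_int (B + p * s') / of_nat k = of_int i" using pi_neq_zero by (metis mult_right_cancel)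
        then have "real_of_int (B + p * s') = of_int (int k * i)" using k0 by (simp add: field_simps)
        then have i: "B + p * s' = int k * i" by (simp only: of_int_eq_iff)
        \<comment> \<open>The two solutions add up to \<open>p * (m + m') \<equiv> B\<close> modulo
          \<open>k\<close>, while \<open>\<alpha> * root_e k (p * s')\<close> being real says that
          \<open>B + p * s'\<close> is divisible by \<open>k\<close>. Cancelling \<open>p\<close>
          leaves \<open>m' \<equiv> - s' - m\<close>.\<close>
        have "p * m + p * m' = B + int k * (n + n')" using interior(3,4) by (simp add: algebra_simps)
        then have "p * m' - p * (- s' - m) = int k * (n + n' + i)" using i by (simp add: algebra_simps)
        then have "[p * m' = p * (- s' - m)] (mod int k)" unfolding cong_iff_dvd_diff by (metis dvd_triv_left)
        then have 1: "[m' = - s' - m] (mod int k)" by (rule I.residue_cancel)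
        have "[- s' - m = - s' - l] (mod int k)" by (rule cong_diff[OF cong_refl cong_sym[OF lm]])
        then have "[m' = - s' - l] (mod int k)" using 1 cong_trans by blast
        have "open_sector k (2 * m' + - 1) = open_sector k (2 * (- s' - l) + - 1)"
          "open_sector k (2 * l + 0) = open_sector k (2 * m + 0)"
          using open_sector_cong[OF k0] \<open>[m' = - s' - l] (mod int k)\<close> lm by blast+
        moreover have "2 * (- s' - l) + - 1 = - 2 * s' - 2 * l - 1" "2 * m' + - 1 = 2 * m' - 1" by simp_all
        ultimately show ?thesis using I.pt_sector(1)[OF interior(1,2), of m] I.pt_sector(2)[OF interior(1,2), of m']
          by (simp only: add_0_right)
      qed
      show ?thesis
      proof (intro conjI allI impI)
        show "\<exists>z1 z2. closest_pair I.F \<alpha> z1 z2" using interior(5) by blast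
        fix z1 z2 assume cp: "closest_pair I.F \<alpha> z1 z2"
        have zz: "z1 = ?za \<and> z2 = ?zb \<or> z1 = ?zb \<and> z2 = ?za" by (rule interior(6)[OF cp])
        have args: "Arg z1 \<noteq> Arg z2" using zz an by metis
        show "norm z1 = norm z2 \<or> Arg z1 = Arg z2" using zz nn by metis
        show "p = -1" "alpha_mult I.F \<alpha> z1 = 2" "0 < z1 * root_e k (- 2 * m)" "0 < z2 * root_e k (- 2 * m)"
          if "Arg z1 = Arg z2" for m using that args by blast+
        show "(z1 \<in> open_sector k (2 * m) \<and> z2 \<in> open_sector k (- 2 * s - 2 * m - 1)) \<or>
              (z2 \<in> open_sector k (2 * m) \<and> z1 \<in> open_sector k (- 2 * s - 2 * m - 1))"
          if "[p * m = q - \<lceil>(of_int p + 1) / 2 :: real\<rceil>] (mod int k) \<and> Im (\<alpha> * root_e k (p * s)) = 0" for m s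
          using sec[of m s] that zz by metis
      qed
    next
      case (bottom s t m n)
      let ?za = "I.pt s 1 m" and ?zb = "I.pt t 1 m"
      have ray: "0 < ?za * root_e k (- 2 * l) \<and> 0 < ?zb * root_e k (- 2 * l)"
        if l: "[p * l = q - \<lceil>(of_int p + 1) / 2 :: real\<rceil>] (mod int k)" for l
      proof -
        have e: "2 * (p * m) = 2 * (q - (p + 2) div 2) + 2 * int k * n" using bottom(1,4) half by linarith
        have "[l = m] (mod int k)" by (rule solve[OF e l[unfolded cl]])
        then show ?thesis
          using I.pt_positive_bottom[OF bottom(2), of 1 l] I.pt_positive_bottom[OF bottom(3), of 1 l] I.pt_cong by metis
      qed
      have na: "norm ?za \<noteq> norm ?zb" using bottom(5) by (metis I.Re_eqI_norm_pt less_irrefl)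
      have "?zb = of_real (exp ((Re t - Re s) / k)) * ?za"
        unfolding I.pt_def exp_of_real[symmetric] exp_add[symmetric] using bottom(2,3)
        by (intro arg_cong[of _ _ exp]) (simp add: complex_eq_iff diff_divide_distrib)
      then have ar: "Arg ?zb = Arg ?za" by simp
      show ?thesis
      proof (intro conjI allI impI)
        show "\<exists>z1 z2. closest_pair I.F \<alpha> z1 z2" using bottom(6) by blast
        fix z1 z2 assume cp: "closest_pair I.F \<alpha> z1 z2"
        have zz: "z1 = ?za \<and> z2 = ?zb \<or> z1 = ?zb \<and> z2 = ?za" by (rule bottom(7)[OF cp])
        have nz: "norm z1 \<noteq> norm z2" using zz na by metis
        show "norm z1 = norm z2 \<or> Arg z1 = Arg z2" using zz ar by metis
        show "p = -1" by (rule bottom(1))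
        show "alpha_mult I.F \<alpha> z1 = 2" if "z1 = z2" using that nz by blast
        show "0 < z1 * root_e k (- 2 * m)" "0 < z2 * root_e k (- 2 * m)"
          if "[p * m = q - \<lceil>(of_int p + 1) / 2 :: real\<rceil>] (mod int k)" for m
          using ray[OF that] zz by metis+
        show "(z1 \<in> open_sector k (2 * m) \<and> z2 \<in> open_sector k (- 2 * s - 2 * m - 1)) \<or>
              (z2 \<in> open_sector k (2 * m) \<and> z1 \<in> open_sector k (- 2 * s - 2 * m - 1))"
          if "z1 \<noteq> z2 \<and> norm z1 = norm z2" for m s
          using that nz by blast
      qed
    next
      case (double s m n)
      let ?za = "I.pt s 1 m"
      have ray: "0 < ?za * root_e k (- 2 * l)"
        if l: "[p * l = q - \<lceil>(of_int p + 1) / 2 :: real\<rceil>] (mod int k)" for l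
      proof -
        have e: "2 * (p * m) = 2 * (q - (p + 2) div 2) + 2 * int k * n" using double(1,3) half by linarith
        have "[l = m] (mod int k)" by (rule solve[OF e l[unfolded cl]])
        then show ?thesis using I.pt_positive_bottom[OF double(2), of 1 l] I.pt_cong by metis
      qed
      show ?thesis using double ray by blast
    qed
  qed
  show ?thesis
    unfolding F mB B_def[symmetric]
    by (rule conjI[OF impI[OF part1] conjI[OF impI[OF part2[OF conjunct1 conjunct2]]
          impI[OF part3[OF conjunct1 conjunct2]]]])
qed

end
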